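(* Let $\alpha\in(-\infty,\min\{2,N\})$ and let $D\in C(\mathbb{R}^N)$ satisfy $D(x)>0$ for all $x$ and $\lim_{|x|\to\infty}\big(|x|^{-\alpha}D(x)\big)=D_0$ for some constant $D_0>0$. Let $\sigma\in(0,\frac{N-\alpha}{2})$ and let $v_0$ satisfy $\langle x\rangle^{\sigma-\frac{\alpha}{2}}v_0\in L^2(\Omega)$. Then the solution $v(t)=T(t)v_0$ of the problem $$\partial_tv-D(x)\Delta v=0\ \text{ in }\Omega\times(0,\infty),\qquad v=0\ \text{ on }\partial\Omega\times(0,\infty),\qquad v(x,0)=v_0(x)\ \text{ in }\Omega$$ satisfies $$\big\|\langle x\rangle^{-\frac{\alpha}{2}}v(t)\big\|_{L^2(\Omega)}\le C(1+t)^{-\frac{\sigma}{2-\alpha}}\big\|\langle x\rangle^{\sigma-\frac{\alpha}{2}}v_0\big\|_{L^2(\Omega)},\quad t\ge 0,$$ for some positive constant $C$ independent of $v_0$.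
   Context: $\langle x\rangle=\sqrt{1+|x|^2}$. $N\ge 2$ and $\Omega\subset\mathbb{R}^N$ is an exterior domain (i.e. $\mathbb{R}^N\setminus\Omega$ is compact) with smooth boundary. Put $a(x)=D(x)^{-1}$, $d\mu=a(x)\,dx$, and let $L^2_{d\mu}=L^2(\Omega;d\mu)$ with inner product $(f,g)_{L^2_{d\mu}}=\int_\Omega fg\,d\mu$. The solution semigroup $T(t)$ is defined as follows. Let $\mathfrak{a}(u,v)=\int_\Omega\nabla u\cdot\nabla v\,dx$ with domain $$D(\mathfrak{a})=\Big\{u\in L^2_{d\mu}\cap\dot H^1(\Omega)\;;\;\int_\Omega\frac{\partial u}{\partial x_j}\varphi\,dx=-\int_\Omega u\frac{\partial\varphi}{\partial x_j}\,dx\ \ \forall\varphi\in C_c^\infty(\mathbb{R}^N),\ j=1,\dots,N\Big\}$$ (which encodes the Dirichlet condition; $\dot H^1(\Omega)$ denotes functions whose weak gradient belongs to $L^2(\Omega)$). Let $L$ be the operator in $L^2_{d\mu}$ with domain $D(L)=\{u\in D(\mathfrak{a});\exists f\in L^2_{d\mu}\text{ such that }\mathfrak{a}(u,v)=(f,v)_{L^2_{d\mu}}\ \forall v\in D(\mathfrak{a})\}$ and $-Lu=f$. The operator $-L$ (the Friedrichs extension of $-a(x)^{-1}\Delta=-D(x)\Delta$) is nonnegative and selfadjoint in $L^2_{d\mu}$, and $\{T(t)\}_{t\ge0}$ is the analytic semigroup on $L^2_{d\mu}$ generated by $L$. *)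

theory Defs
  imports "HOL-Analysis.Analysis"
begin

subsection \<open>Smooth functions, test functions, exterior domains\<close>

definition partial_deriv :: "'a::euclidean_space \<Rightarrow> ('a \<Rightarrow> real) \<Rightarrow> 'a \<Rightarrow> real" where
  "partial_deriv j f x = frechet_derivative f (at x) j"

fun Ck :: "nat \<Rightarrow> ('a::euclidean_space \<Rightarrow> real) \<Rightarrow> bool" where
  "Ck 0 f \<longleftrightarrow> continuous_on UNIV f"
| "Ck (Suc k) f \<longleftrightarrow> (\<forall>x. f differentiable (at x)) \<and> (\<forall>j\<in>Basis. Ck k (partial_deriv j f))"

definition smooth :: "('a::euclidean_space \<Rightarrow> real) \<Rightarrow> bool" where
  "smooth f \<longleftrightarrow> (\<forall>k. Ck k f)"

text \<open>Test functions on \<open>S\<close> are extended by zero to the whole space.\<close>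

definition test_functions :: "'a::euclidean_space set \<Rightarrow> ('a \<Rightarrow> real) set" where
  "test_functions S =
     {\<phi>. smooth \<phi> \<and> compact (closure {x. \<phi> x \<noteq> 0}) \<and> closure {x. \<phi> x \<noteq> 0} \<subseteq> S}"

definition exterior_domain :: "'a::euclidean_space set \<Rightarrow> bool" where
  "exterior_domain \<Omega> \<longleftrightarrow> open \<Omega> \<and> connected \<Omega> \<and> compact (- \<Omega>)"

text \<open>Near each boundary point \<open>\<Omega>\<close> is the region above the graph of a smooth function
  of the variables orthogonal to some direction \<open>e\<close>; the function \<open>\<gamma>\<close> is only evaluated
  on the hyperplane orthogonal to \<open>e\<close>.\<close>

definition smooth_boundary :: "'a::euclidean_space set \<Rightarrow> bool" where
  "smooth_boundary \<Omega> \<longleftrightarrow>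
     (\<forall>p\<in>frontier \<Omega>. \<exists>r>0. \<exists>e \<gamma>. norm e = 1 \<and> smooth \<gamma> \<and>
        \<Omega> \<inter> ball p r = {x \<in> ball p r. x \<bullet> e > \<gamma> (x - (x \<bullet> e) *\<^sub>R e)})"

definition japanese_bracket :: "'a::euclidean_space \<Rightarrow> real" where
  "japanese_bracket x = sqrt (1 + (norm x)\<^sup>2)"

subsection \<open>Square-integrable functions\<close>

text \<open>Elements of \<open>L\<^sup>2\<close> are represented by functions; identities between them are
  required almost everywhere.\<close>

definition L2 :: "'x measure \<Rightarrow> ('x \<Rightarrow> 'b::{banach,second_countable_topology}) set" where
  "L2 M = {f \<in> borel_measurable M. integrable M (\<lambda>x. (norm (f x))\<^sup>2)}"

definition L2_norm :: "'x measure \<Rightarrow> ('x \<Rightarrow> 'b::{banach,second_countable_topology}) \<Rightarrow> real" where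
  "L2_norm M f = sqrt (\<integral>x. (norm (f x))\<^sup>2 \<partial>M)"

definition L2_inner :: "'x measure \<Rightarrow> ('x \<Rightarrow> real) \<Rightarrow> ('x \<Rightarrow> real) \<Rightarrow> real" where
  "L2_inner M f g = (\<integral>x. f x * g x \<partial>M)"

definition L2_tendsto ::
  "'x measure \<Rightarrow> ('i \<Rightarrow> 'x \<Rightarrow> 'b::{banach,second_countable_topology}) \<Rightarrow> ('x \<Rightarrow> 'b) \<Rightarrow> 'i filter \<Rightarrow> bool"
  where "L2_tendsto M F f \<F> \<longleftrightarrow> ((\<lambda>i. L2_norm M (\<lambda>x. F i x - f x)) \<longlongrightarrow> 0) \<F>"

text \<open>Linearity is over the scalar field \<open>'b\<close> (real or complex). Linearity and
  boundedness together make such an operator compatible with equality almost everywhere.\<close>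

definition L2_operator ::
  "'x measure \<Rightarrow> (('x \<Rightarrow> 'b::{real_normed_field,banach,second_countable_topology}) \<Rightarrow> 'x \<Rightarrow> 'b) \<Rightarrow> bool"
  where "L2_operator M A \<longleftrightarrow>
    (\<forall>f\<in>L2 M. A f \<in> L2 M) \<and>
    (\<forall>f\<in>L2 M. \<forall>g\<in>L2 M. \<forall>a b.
       AE x in M. A (\<lambda>x. a * f x + b * g x) x = a * A f x + b * A g x) \<and>
    (\<exists>K. \<forall>f\<in>L2 M. L2_norm M (A f) \<le> K * L2_norm M f)"

subsection \<open>Analytic semigroups and their generators\<close>

definition C0_semigroup :: "'x measure \<Rightarrow> (real \<Rightarrow> ('x \<Rightarrow> real) \<Rightarrow> 'x \<Rightarrow> real) \<Rightarrow> bool" where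
  "C0_semigroup M T \<longleftrightarrow>
    (\<forall>t\<ge>0. L2_operator M (T t)) \<and>
    (\<forall>f\<in>L2 M. AE x in M. T 0 f x = f x) \<and>
    (\<forall>s\<ge>0. \<forall>t\<ge>0. \<forall>f\<in>L2 M. AE x in M. T (s + t) f x = T s (T t f) x) \<and>
    (\<forall>f\<in>L2 M. L2_tendsto M (\<lambda>t. T t f) f (at_right 0))"

definition generator ::
  "'x measure \<Rightarrow> (real \<Rightarrow> ('x \<Rightarrow> real) \<Rightarrow> 'x \<Rightarrow> real) \<Rightarrow> (('x \<Rightarrow> real) \<times> ('x \<Rightarrow> real)) set" where
  "generator M T = {(u, w). u \<in> L2 M \<and> w \<in> L2 M \<and>
     L2_tendsto M (\<lambda>h x. (T h u x - u x) / h) w (at_right 0)}"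

definition sector :: "real \<Rightarrow> complex set" where
  "sector \<theta> = {z. z \<noteq> 0 \<and> \<bar>Arg z\<bar> < \<theta>}"

text \<open>A semigroup on the real space is analytic if its complexification extends to a
  holomorphic semigroup on a sector around the positive half-line.\<close>

definition analytic_semigroup :: "'x measure \<Rightarrow> (real \<Rightarrow> ('x \<Rightarrow> real) \<Rightarrow> 'x \<Rightarrow> real) \<Rightarrow> bool" where
  "analytic_semigroup M T \<longleftrightarrow> C0_semigroup M T \<and>
    (\<exists>\<theta> (S :: complex \<Rightarrow> ('x \<Rightarrow> complex) \<Rightarrow> 'x \<Rightarrow> complex). 0 < \<theta> \<and> \<theta> \<le> pi / 2 \<and>
       (\<forall>z\<in>sector \<theta>. L2_operator M (S z)) \<and>
       (\<forall>t>0. \<forall>f\<in>L2 M.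
          AE x in M. S (complex_of_real t) (\<lambda>y. complex_of_real (f y)) x = complex_of_real (T t f x)) \<and>
       (\<forall>z\<in>sector \<theta>. \<forall>w\<in>sector \<theta>. \<forall>f\<in>L2 M. AE x in M. S (z + w) f x = S z (S w f) x) \<and>
       (\<forall>f\<in>L2 M. L2_tendsto M (\<lambda>z. S z f) f (at 0 within sector \<theta>)) \<and>
       (\<forall>z\<in>sector \<theta>. \<forall>f\<in>L2 M. \<exists>g\<in>L2 M.
          L2_tendsto M (\<lambda>w x. (S w f x - S z f x) / (w - z)) g (at z)))"

subsection \<open>The Dirichlet operator \<open>D(x)\<Delta>\<close>\<close>

definition locally_integrable ::
  "'a::euclidean_space set \<Rightarrow> ('a \<Rightarrow> 'b::{banach,second_countable_topology}) \<Rightarrow> bool" where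
  "locally_integrable \<Omega> f \<longleftrightarrow> (\<forall>K. compact K \<and> K \<subseteq> \<Omega> \<longrightarrow> integrable (lebesgue_on K) f)"

definition has_weak_gradient ::
  "'a::euclidean_space set \<Rightarrow> ('a \<Rightarrow> real) \<Rightarrow> ('a \<Rightarrow> 'a) \<Rightarrow> bool" where
  "has_weak_gradient \<Omega> u g \<longleftrightarrow> locally_integrable \<Omega> u \<and> locally_integrable \<Omega> g \<and>
     (\<forall>\<phi>\<in>test_functions \<Omega>. \<forall>j\<in>Basis.
        (\<integral>x. (g x \<bullet> j) * \<phi> x \<partial>lebesgue_on \<Omega>) = - (\<integral>x. u x * partial_deriv j \<phi> x \<partial>lebesgue_on \<Omega>))"

text \<open>The weak gradient is unique up to null sets, so the choice below is immaterial.\<close>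

definition weak_gradient :: "'a::euclidean_space set \<Rightarrow> ('a \<Rightarrow> real) \<Rightarrow> 'a \<Rightarrow> 'a" where
  "weak_gradient \<Omega> u = (SOME g. has_weak_gradient \<Omega> u g)"

definition H1_dot :: "'a::euclidean_space set \<Rightarrow> ('a \<Rightarrow> real) set" where
  "H1_dot \<Omega> = {u. (\<exists>g. has_weak_gradient \<Omega> u g) \<and> weak_gradient \<Omega> u \<in> L2 (lebesgue_on \<Omega>)}"

definition weighted_measure :: "'a::euclidean_space set \<Rightarrow> ('a \<Rightarrow> real) \<Rightarrow> 'a measure" where
  "weighted_measure \<Omega> D = density (lebesgue_on \<Omega>) (\<lambda>x. ennreal (inverse (D x)))"

definition form_domain :: "'a::euclidean_space set \<Rightarrow> ('a \<Rightarrow> real) \<Rightarrow> ('a \<Rightarrow> real) set" where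
  "form_domain \<Omega> D = {u \<in> L2 (weighted_measure \<Omega> D) \<inter> H1_dot \<Omega>.
     \<forall>\<phi>\<in>test_functions UNIV. \<forall>j\<in>Basis.
       (\<integral>x. (weak_gradient \<Omega> u x \<bullet> j) * \<phi> x \<partial>lebesgue_on \<Omega>)
         = - (\<integral>x. u x * partial_deriv j \<phi> x \<partial>lebesgue_on \<Omega>)}"

definition dirichlet_form :: "'a::euclidean_space set \<Rightarrow> ('a \<Rightarrow> real) \<Rightarrow> ('a \<Rightarrow> real) \<Rightarrow> real" where
  "dirichlet_form \<Omega> u v = (\<integral>x. weak_gradient \<Omega> u x \<bullet> weak_gradient \<Omega> v x \<partial>lebesgue_on \<Omega>)"

text \<open>The graph of \<open>L\<close>, i.e. the pairs \<open>(u, Lu)\<close> with \<open>-Lu = f\<close>.\<close>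

definition dirichlet_operator ::
  "'a::euclidean_space set \<Rightarrow> ('a \<Rightarrow> real) \<Rightarrow> (('a \<Rightarrow> real) \<times> ('a \<Rightarrow> real)) set" where
  "dirichlet_operator \<Omega> D = {(u, \<lambda>x. - f x) | u f.
     u \<in> form_domain \<Omega> D \<and> f \<in> L2 (weighted_measure \<Omega> D) \<and>
     (\<forall>v\<in>form_domain \<Omega> D. dirichlet_form \<Omega> u v = L2_inner (weighted_measure \<Omega> D) f v)}"

end

(*
  For a solution v(t) = T(t) f, smoothing gives |L v(t)| <= C t^-1 |f| in L^2(dmu).  Put
  X_s = <x>^s L^2(dmu), the space with norm |<x>^-s u|.  If 0 <= s <= (N-2)/2, the weight
  <x>^(-2s) is superharmonic, so testing the equation for L u with <x>^(-2s) u gives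
  |<x>^-s grad u|^2 <= |L u|_(X_s) |u|_(X_s).  Integrating div(x <x>^(-2 sigma - alpha)) u^2 by
  parts gives, for 2 sigma < N - alpha and 2 sigma = s + sigma' + (2-alpha)/2, the Hardy type bound
  |u|_(X_sigma)^2 <= C |<x>^-s grad u| |u|_(X_sigma').  Hence decay of T(t) : X_0 -> X_s at rate
  t^(-s/(2-alpha)) and the same for sigma' imply it for sigma, and iterating reaches every
  sigma < (N-alpha)/2.  Duality turns X_0 -> X_sigma into the claim.

  Both integrations by parts are one identity for the zero extension of u, whose weak gradient on the
  whole space is the zero extension of grad u; it is obtained from difference quotients and the
  density of test functions in L^2.
*)
theory Submission
  imports Defs
begin

section \<open>Smooth functions and test functions\<close>

text \<open>Since \<alpha> < 2, the critical exponent (N-\<alpha>)/2 lies beyond (N-2)/2, where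
  <x>^(-2s) stops being superharmonic and the gradient bound stops. The Hardy type bound therefore
  mixes a gradient weight s kept in the superharmonic range with a function weight \<sigma>'. As
  long as s = \<sigma>' is allowed, a step gains (2-\<alpha>)/4; beyond that, with s = (N-2)/2, it
  moves \<sigma>' to the midpoint of \<sigma>' and (N-\<alpha>)/2. The rates fit because L costs
  t^-1 under a square root, and t^(-1/2) is the rate of weight (2-\<alpha>)/2.

  The form domain is given by integral identities alone, so u^2 comes without a product rule.
  Translating w by -h along an axis turns the integral of x_j w^2 into an exact identity with a
  remainder of order h, which replaces it. In the same spirit the semigroup is known only through
  its generator: contraction, symmetry and smoothing are all read off from t-derivatives of inner
  products, at positive times only.\<close>

lemma partial_deriv_eq:
  "(f has_derivative f') (at x) \<Longrightarrow> partial_deriv j f x = f' j"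
  unfolding partial_deriv_def using frechet_derivative_at by metis

text \<open>\<open>partial_deriv\<close> hides a choice of derivative. Any explicitly known
  derivative determines it, so the closure proofs below can compute with f' instead.\<close>

lemma Ck_SucI:
  assumes "\<And>x. (f has_derivative f' x) (at x)" and "\<And>j. j \<in> Basis \<Longrightarrow> Ck k (\<lambda>x. f' x j)"
  shows "Ck (Suc k) f"
proof -
  have "partial_deriv j f = (\<lambda>x. f' x j)" for j
    using partial_deriv_eq[OF assms(1)] by blast
  then show ?thesis using assms by (auto simp: differentiable_def)
qed

lemma Ck_Suc_derivative:
  "Ck (Suc k) f \<Longrightarrow> (f has_derivative frechet_derivative f (at x)) (at x)"
  using frechet_derivative_works by auto

lemma Ck_SucD: "Ck (Suc k) f \<Longrightarrow> Ck k f"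
proof (induction k arbitrary: f)
  case 0
  then show ?case
    by (auto intro!: differentiable_imp_continuous_on simp: differentiable_on_def differentiable_at_withinI)
qed auto

lemma Ck_const [intro, simp]: "Ck k (\<lambda>x. c)"
proof (induction k arbitrary: c)
  case (Suc k)
  then show ?case by (intro Ck_SucI[where f' = "\<lambda>x h. 0"]) auto
qed auto

lemma Ck_add [intro]: "Ck k f \<Longrightarrow> Ck k g \<Longrightarrow> Ck k (\<lambda>x. f x + g x)"
proof (induction k arbitrary: f g)
  case (Suc k)
  show ?case
    by (rule Ck_SucI[OF has_derivative_add[OF Suc.prems[THEN Ck_Suc_derivative]]])
      (use Suc in \<open>auto simp flip: partial_deriv_def\<close>)
qed (auto intro: continuous_intros)

text \<open>By the Leibniz rule each summand keeps one undifferentiated factor; it is of class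
  \<open>Suc k\<close>, and \<open>Ck_SucD\<close> lowers it to class k, where the induction
  hypothesis applies.\<close>

lemma Ck_mult [intro]: "Ck k f \<Longrightarrow> Ck k g \<Longrightarrow> Ck k (\<lambda>x. f x * g x)"
proof (induction k arbitrary: f g)
  case (Suc k)
  show ?case
    by (rule Ck_SucI[OF has_derivative_mult[OF Suc.prems[THEN Ck_Suc_derivative]]],
        unfold partial_deriv_def[symmetric], intro Ck_add Suc.IH)
      (use Suc.prems Ck_SucD in auto)
qed (auto intro: continuous_intros)

lemma Ck_prod: "(\<And>i. i \<in> I \<Longrightarrow> Ck k (f i)) \<Longrightarrow> Ck k (\<lambda>x. \<Prod>i\<in>I. f i x)"
  by (induction I rule: infinite_finite_induct) auto

lemma Ck_inner [intro]: "Ck k (\<lambda>x. x \<bullet> i)"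
proof (cases k)
  case (Suc m)
  show ?thesis unfolding Suc
    by (rule Ck_SucI[where f' = "\<lambda>x h. h \<bullet> i"]) (auto intro!: derivative_eq_intros)
qed (auto intro: continuous_intros)

lemma Ck_shift: "Ck k f \<Longrightarrow> Ck k (\<lambda>x. f (x + a))"
proof (induction k arbitrary: f)
  case 0
  then show ?case by (auto intro!: continuous_on_compose2[of UNIV f] continuous_intros)
next
  case (Suc k)
  show ?case
  proof (rule Ck_SucI)
    fix x
    have "((\<lambda>x. x + a) has_derivative (\<lambda>h. h)) (at x)" by (auto intro!: derivative_eq_intros)
    from has_derivative_compose[OF this Ck_Suc_derivative[OF Suc.prems]]
    show "((\<lambda>x. f (x + a)) has_derivative (\<lambda>h. frechet_derivative f (at (x + a)) h)) (at x)" .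
  next
    fix j :: 'a assume "j \<in> Basis"
    then show "Ck k (\<lambda>x. frechet_derivative f (at (x + a)) j)"
      using Suc by (auto simp flip: partial_deriv_def)
  qed
qed

lemma Ck_norm_square: "Ck k (\<lambda>x. (norm x)\<^sup>2)"
proof (cases k)
  case (Suc m)
  show ?thesis unfolding Suc
  proof (rule Ck_SucI[where f' = "\<lambda>x h. 2 * (x \<bullet> h)"])
    show "((\<lambda>x. (norm x)\<^sup>2) has_derivative (\<lambda>h. 2 * (x \<bullet> h))) (at x)" for x
      unfolding power2_norm_eq_inner
      by (auto intro!: derivative_eq_intros simp: inner_commute)
  qed auto
qed (auto intro!: continuous_intros)

text \<open>Differentiation lowers the exponent to p - 1 without leaving the family of real powers,
  so the induction runs over all p at once; positivity of q keeps every power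
  differentiable.\<close>

lemma Ck_powr:
  assumes "\<And>k. Ck k q" and pos: "\<And>x. q x > 0"
  shows "Ck k (\<lambda>x. q x powr p)"
proof (induction k arbitrary: p)
  case 0
  show ?case using assms(1)[of 0] pos by (auto intro!: continuous_intros simp: less_imp_neq[symmetric])
next
  case (Suc k)
  have D: "(q has_derivative (\<lambda>h. frechet_derivative q (at x) h)) (at x)" for x
    using Ck_Suc_derivative[OF assms(1)[of "Suc 0"]] by simp
  show ?case
  proof (rule Ck_SucI[where f' = "\<lambda>x h. p * q x powr (p - 1) * frechet_derivative q (at x) h"])
    show "((\<lambda>x. q x powr p) has_derivative (\<lambda>h. p * q x powr (p - 1) * frechet_derivative q (at x) h)) (at x)" for x
    proof -
      have "((\<lambda>y. y powr p) has_real_derivative p * q x powr (p - 1)) (at (q x))"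
        using has_real_derivative_powr[OF pos] .
      from has_derivative_compose[OF D this[unfolded has_field_derivative_def]]
      show ?thesis .
    qed
    show "Ck k (\<lambda>x. p * q x powr (p - 1) * frechet_derivative q (at x) j)" if "j \<in> Basis" for j
      using Suc assms(1)[of "Suc k"] that unfolding partial_deriv_def[symmetric]
      by (intro Ck_mult) auto
  qed
qed

text \<open>For \<open>n = 0\<close> this is the classical smooth function that vanishes to infinite order at the
  origin; the family is closed under differentiation up to linear combinations.\<close>

definition flat :: "nat \<Rightarrow> real \<Rightarrow> real" where
  "flat n x = (if x > 0 then (1 / x) ^ n * exp (- (1 / x)) else 0)"

lemma flat_nonneg: "0 \<le> flat n x"
  by (auto simp: flat_def)

text \<open>Substituting y = 1/x reduces this to exp growing faster than every power of y.\<close>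

lemma flat_tendsto_0: "(flat n \<longlongrightarrow> 0) (at_right 0)"
proof -
  have "((\<lambda>y. y ^ n / exp y) \<longlongrightarrow> (0::real)) at_top"
    by (rule tendsto_power_div_exp_0)
  then have "((\<lambda>x. (inverse x) ^ n / exp (inverse x)) \<longlongrightarrow> (0::real)) (at_right 0)"
    by (rule filterlim_compose[OF _ filterlim_inverse_at_top_right])
  then show ?thesis
    by (rule Lim_transform_eventually)
      (auto simp: eventually_at_filter flat_def exp_minus divide_simps)
qed

text \<open>Away from 0 this is the product rule. At 0 the right difference quotient of
  \<open>flat n\<close> is \<open>flat (Suc n)\<close>, which tends to 0 by the previous limit, and
  the left one vanishes.\<close>

lemma flat_derivative:
  "(flat n has_real_derivative (flat (n + 2) x - real n * flat (n + 1) x)) (at x)"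
proof -
  consider "x > 0" | "x < 0" | "x = 0" by linarith
  then show ?thesis
  proof cases
    case 1
    have D: "((\<lambda>x. 1 / x) has_real_derivative - (1 / x * (1 / x))) (at x)"
      using 1 by (auto intro!: derivative_eq_intros simp: power2_eq_square)
    \<comment> \<open>The truncated exponent \<open>n - Suc 0\<close> is off only for n = 0, where
      the factor n removes it.\<close>
    have "real n * (- (1 / x * (1 / x)) * (1 / x) ^ (n - Suc 0)) = - (real n * (1 / x) ^ (n + 1))"
      by (cases n) auto
    then have "((\<lambda>x. (1 / x) ^ n * exp (- (1 / x))) has_real_derivative
        (flat (n + 2) x - real n * flat (n + 1) x)) (at x)"
      using 1 by (intro DERIV_cong[OF DERIV_mult[OF DERIV_power[OF D] DERIV_fun_exp[OF DERIV_minus[OF D]]]])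
        (simp add: flat_def power_add algebra_simps)
    then show ?thesis
      by (rule has_field_derivative_transform_within_open[where S = "{0<..}"])
        (use 1 in \<open>auto simp: flat_def\<close>)
  next
    case 2
    have "((\<lambda>x. 0) has_real_derivative (flat (n + 2) x - real n * flat (n + 1) x)) (at x)"
      using 2 by (auto simp: flat_def)
    then show ?thesis
      by (rule has_field_derivative_transform_within_open[where S = "{..<0}"])
        (use 2 in \<open>auto simp: flat_def\<close>)
  next
    case 3
    have "(\<lambda>h. (flat n h - flat n 0) / (h - 0)) \<midarrow>0\<rightarrow> 0"
    proof -
      have "((\<lambda>h. (flat n h - flat n 0) / (h - 0)) \<longlongrightarrow> 0) (at_right 0)"
        using flat_tendsto_0[of "Suc n"]
        by (rule Lim_transform_eventually) (auto simp: eventually_at_filter flat_def)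
      moreover have "((\<lambda>h. (flat n h - flat n 0) / (h - 0)) \<longlongrightarrow> 0) (at_left 0)"
        by (rule Lim_transform_eventually[OF tendsto_const])
          (auto simp: eventually_at_filter flat_def)
      ultimately show ?thesis by (simp add: filterlim_split_at)
    qed
    then show ?thesis using 3 by (simp add: has_field_derivative_iff flat_def)
  qed
qed

lemma continuous_flat: "continuous_on UNIV (flat n)"
  by (rule DERIV_continuous_on[OF DERIV_subset[OF flat_derivative]]) auto

text \<open>The derivative of \<open>flat n\<close> is a combination of \<open>flat (n + 1)\<close>
  and \<open>flat (n + 2)\<close>, hence the induction over k with n varying.\<close>

lemma Ck_flat:
  assumes "\<And>k. Ck k q"
  shows "Ck k (\<lambda>x. flat n (q x))"
proof (induction k arbitrary: n)
  case 0
  show ?case using assms[of 0] by (auto intro!: continuous_on_compose2[OF continuous_flat])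
next
  case (Suc k)
  have D: "(q has_derivative (\<lambda>h. frechet_derivative q (at x) h)) (at x)" for x
    using Ck_Suc_derivative[OF assms(1)[of "Suc 0"]] by simp
  show ?case
  proof (rule Ck_SucI)
    show "((\<lambda>x. flat n (q x)) has_derivative
       (\<lambda>h. (flat (n + 2) (q x) + - real n * flat (n + 1) (q x)) * frechet_derivative q (at x) h)) (at x)" for x
      using has_derivative_compose[OF D flat_derivative[unfolded has_field_derivative_def]]
      by simp
    show "Ck k (\<lambda>x. (flat (n + 2) (q x) + - real n * flat (n + 1) (q x)) * frechet_derivative q (at x) j)"
      if "j \<in> Basis" for j
      using Suc assms(1)[of "Suc k"] that unfolding partial_deriv_def[symmetric]
      by (intro Ck_mult Ck_add) auto
  qed
qed

section \<open>Closure properties of smooth functions\<close>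

lemma smooth_const [intro, simp]: "smooth (\<lambda>x. c)"
  and smooth_add [intro]: "smooth f \<Longrightarrow> smooth g \<Longrightarrow> smooth (\<lambda>x. f x + g x)"
  and smooth_mult [intro]: "smooth f \<Longrightarrow> smooth g \<Longrightarrow> smooth (\<lambda>x. f x * g x)"
  and smooth_shift: "smooth f \<Longrightarrow> smooth (\<lambda>x. f (x + a))"
  and smooth_prod: "(\<And>i. i \<in> I \<Longrightarrow> smooth (h i)) \<Longrightarrow> smooth (\<lambda>x. \<Prod>i\<in>I. h i x)"
  and smooth_inner [intro]: "smooth (\<lambda>x. x \<bullet> i)"
  and smooth_norm_square [intro]: "smooth (\<lambda>x. (norm x)\<^sup>2)"
  and smooth_powr: "smooth f \<Longrightarrow> (\<And>x. f x > 0) \<Longrightarrow> smooth (\<lambda>x. f x powr p)"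
  and smooth_flat: "smooth f \<Longrightarrow> smooth (\<lambda>x. flat n (f x))"
  by (auto simp: smooth_def intro: Ck_shift Ck_prod Ck_norm_square Ck_powr Ck_flat)

lemma smooth_continuous: "smooth f \<Longrightarrow> continuous_on S f"
  unfolding smooth_def by (metis Ck.simps(1) continuous_on_subset subset_UNIV)

lemma smooth_derivative: "smooth f \<Longrightarrow> (f has_derivative frechet_derivative f (at x)) (at x)"
  unfolding smooth_def using Ck_Suc_derivative by blast

lemma smooth_partial_deriv: "smooth f \<Longrightarrow> j \<in> Basis \<Longrightarrow> smooth (partial_deriv j f)"
  unfolding smooth_def by (metis Ck.simps(2))

lemma partial_deriv_mult:
  assumes "smooth f" "smooth g"
  shows "partial_deriv j (\<lambda>x. f x * g x) x = f x * partial_deriv j g x + partial_deriv j f x * g x"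
  using partial_deriv_eq[OF has_derivative_mult[OF assms[THEN smooth_derivative]]]
  by (simp add: partial_deriv_def)

definition grad :: "('a::euclidean_space \<Rightarrow> real) \<Rightarrow> 'a \<Rightarrow> 'a" where
  "grad f x = (\<Sum>j\<in>Basis. partial_deriv j f x *\<^sub>R j)"

lemma grad_inner_Basis: "j \<in> Basis \<Longrightarrow> grad f x \<bullet> j = partial_deriv j f x"
  by (simp add: grad_def)

lemma grad_eqI:
  assumes "(f has_derivative (\<lambda>h. g \<bullet> h)) (at x)"
  shows "grad f x = g"
  by (rule euclidean_eqI) (simp add: grad_inner_Basis partial_deriv_eq[OF assms])

lemma smooth_has_derivative_grad:
  assumes "smooth f"
  shows "(f has_derivative (\<lambda>h. grad f x \<bullet> h)) (at x)"
proof -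
  note D = smooth_derivative[OF assms, of x]
  interpret linear "frechet_derivative f (at x)" using has_derivative_linear[OF D] .
  have "frechet_derivative f (at x) h = grad f x \<bullet> h" for h
  proof -
    have "frechet_derivative f (at x) h = frechet_derivative f (at x) (\<Sum>j\<in>Basis. (h \<bullet> j) *\<^sub>R j)"
      by (simp only: euclidean_representation)
    also have "\<dots> = (\<Sum>j\<in>Basis. (h \<bullet> j) * partial_deriv j f x)"
      by (simp only: sum scaleR partial_deriv_def real_scaleR_def)
    also have "\<dots> = grad f x \<bullet> h"
      by (simp add: grad_def inner_sum_left inner_commute[of h] mult.commute)
    finally show ?thesis .
  qed
  with D show ?thesis by (metis (no_types, lifting) ext)
qed

lemma continuous_grad: "smooth f \<Longrightarrow> continuous_on S (grad f)"
  unfolding grad_def by (intro continuous_intros smooth_continuous smooth_partial_deriv)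

section \<open>Test functions\<close>

lemma test_functionsD:
  assumes "\<phi> \<in> test_functions S"
  shows "smooth \<phi>" "compact (closure {x. \<phi> x \<noteq> 0})" "closure {x. \<phi> x \<noteq> 0} \<subseteq> S"
  using assms by (auto simp: test_functions_def)

lemma test_functionsI:
  assumes "smooth \<phi>" "compact K" "K \<subseteq> S" "\<And>x. x \<notin> K \<Longrightarrow> \<phi> x = 0"
  shows "\<phi> \<in> test_functions S"
proof -
  have sub: "closure {x. \<phi> x \<noteq> 0} \<subseteq> K"
    using assms(4) by (intro closure_minimal compact_imp_closed[OF assms(2)]) blast
  have "bounded (closure {x. \<phi> x \<noteq> 0})"
    by (rule bounded_subset[OF compact_imp_bounded[OF assms(2)] sub])
  then have "compact (closure {x. \<phi> x \<noteq> 0})"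
    using compact_eq_bounded_closed by blast
  with sub assms(1,3) show ?thesis
    unfolding test_functions_def by blast
qed

lemma test_function_outside: "x \<notin> closure {x. \<phi> x \<noteq> 0} \<Longrightarrow> \<phi> x = 0"
  using closure_subset[of "{x. \<phi> x \<noteq> 0}"] by blast

lemma test_functions_mono: "S \<subseteq> S' \<Longrightarrow> test_functions S \<subseteq> test_functions S'"
  by (auto simp: test_functions_def)

lemma test_functions_mult:
  assumes "smooth \<rho>" "\<phi> \<in> test_functions S"
  shows "(\<lambda>x. \<rho> x * \<phi> x) \<in> test_functions S"
proof (rule test_functionsI)
  show "\<rho> x * \<phi> x = 0" if "x \<notin> closure {x. \<phi> x \<noteq> 0}" for x
    using test_function_outside[OF that] by simp
qed (use assms(1) test_functionsD[OF assms(2)] in auto)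

lemma test_functions_add:
  assumes "\<phi> \<in> test_functions S" "\<psi> \<in> test_functions S"
  shows "(\<lambda>x. \<phi> x + \<psi> x) \<in> test_functions S"
proof (rule test_functionsI)
  show "\<phi> x + \<psi> x = 0" if "x \<notin> closure {x. \<phi> x \<noteq> 0} \<union> closure {x. \<psi> x \<noteq> 0}" for x
    using that test_function_outside[of x \<phi>] test_function_outside[of x \<psi>] by simp
qed (use test_functionsD[OF assms(1)] test_functionsD[OF assms(2)] in auto)

lemma zero_test_function: "(\<lambda>x. 0) \<in> test_functions S"
  by (auto simp: test_functions_def)

lemma test_functions_shift:
  assumes "\<phi> \<in> test_functions UNIV"
  shows "(\<lambda>x. \<phi> (x + a)) \<in> test_functions UNIV"
proof (rule test_functionsI)
  show "compact ((\<lambda>x. x - a) ` closure {x. \<phi> x \<noteq> 0})"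
    by (intro compact_continuous_image continuous_intros test_functionsD[OF assms])
  show "\<phi> (x + a) = 0" if "x \<notin> (\<lambda>x. x - a) ` closure {x. \<phi> x \<noteq> 0}" for x
    using that by (intro test_function_outside) (force simp: image_iff)
qed (simp_all add: smooth_shift[OF test_functionsD(1)[OF assms]])

lemma partial_deriv_outside_support:
  assumes "x \<notin> closure {x. \<phi> x \<noteq> 0}"
  shows "partial_deriv j \<phi> x = 0"
proof -
  have "((\<lambda>x. 0) has_derivative (\<lambda>h. 0)) (at x)" by simp
  then have "(\<phi> has_derivative (\<lambda>h. 0)) (at x)"
    by (rule has_derivative_transform_within_open[OF _ open_Compl[OF closed_closure]])
      (use assms in \<open>auto dest: test_function_outside\<close>)
  then show ?thesis by (rule partial_deriv_eq)
qed

lemma test_functions_partial_deriv: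
  assumes "\<phi> \<in> test_functions S" "j \<in> Basis"
  shows "partial_deriv j \<phi> \<in> test_functions S"
  using test_functionsD[OF assms(1)] assms(2)
  by (intro test_functionsI[where K = "closure {x. \<phi> x \<noteq> 0}"])
    (auto intro: smooth_partial_deriv partial_deriv_outside_support)

lemma test_function_bounded:
  assumes "\<phi> \<in> test_functions S"
  obtains B where "B > 0" "\<And>x. \<bar>\<phi> x\<bar> \<le> B"
proof -
  let ?K = "closure {x. \<phi> x \<noteq> 0}"
  have "compact (\<phi> ` ?K)"
    using test_functionsD[OF assms] by (intro compact_continuous_image smooth_continuous)
  then obtain B where B: "B > 0" "\<And>x. x \<in> ?K \<Longrightarrow> \<bar>\<phi> x\<bar> \<le> B"
    by (auto dest!: compact_imp_bounded simp: bounded_pos)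
  have "\<bar>\<phi> x\<bar> \<le> B" for x
    using B test_function_outside[of x \<phi>] by (cases "x \<in> ?K") auto
  with B show ?thesis using that by blast
qed

section \<open>Square-integrable functions\<close>

lemma L2_real_iff:
  "(f :: 'x \<Rightarrow> real) \<in> L2 M \<longleftrightarrow> f \<in> borel_measurable M \<and> integrable M (\<lambda>x. (f x)\<^sup>2)"
  by (simp add: L2_def)

lemma L2_measurable: "f \<in> L2 M \<Longrightarrow> f \<in> borel_measurable M"
  by (simp add: L2_def)

lemma L2_integrable_mult:
  fixes f g :: "'x \<Rightarrow> real"
  assumes "f \<in> L2 M" "g \<in> L2 M"
  shows "integrable M (\<lambda>x. f x * g x)"
proof (rule Bochner_Integration.integrable_bound)
  show "integrable M (\<lambda>x. (f x)\<^sup>2 + (g x)\<^sup>2)" using assms by (auto simp: L2_real_iff)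
  have "\<bar>a * b\<bar> \<le> a\<^sup>2 + b\<^sup>2" for a b :: real
  proof -
    have "0 \<le> \<bar>a\<bar> * \<bar>b\<bar>" by simp
    with sum_squares_bound[of "\<bar>a\<bar>" "\<bar>b\<bar>"] show ?thesis
      unfolding abs_mult power2_abs by linarith
  qed
  then show "AE x in M. norm (f x * g x) \<le> norm ((f x)\<^sup>2 + (g x)\<^sup>2)" by simp
  show "(\<lambda>x. f x * g x) \<in> borel_measurable M"
    using assms by (auto simp: L2_real_iff)
qed

lemma L2_dominated:
  fixes f :: "'x \<Rightarrow> real"
  assumes "f \<in> L2 M" "g \<in> borel_measurable M" "AE x in M. \<bar>g x\<bar> \<le> \<bar>f x\<bar>"
  shows "g \<in> L2 M"
proof -
  have "integrable M (\<lambda>x. (g x)\<^sup>2)"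
  proof (rule Bochner_Integration.integrable_bound)
    show "integrable M (\<lambda>x. (f x)\<^sup>2)" using assms by (auto simp: L2_real_iff)
    show "AE x in M. norm ((g x)\<^sup>2) \<le> norm ((f x)\<^sup>2)"
      using assms(3) by eventually_elim (simp add: abs_le_square_iff)
  qed (use assms in measurable)
  with assms(2) show ?thesis by (simp add: L2_real_iff)
qed

lemma L2_cmult:
  fixes f :: "'x \<Rightarrow> real"
  shows "f \<in> L2 M \<Longrightarrow> (\<lambda>x. c * f x) \<in> L2 M"
  by (auto simp: L2_real_iff power_mult_distrib)

lemma L2_add:
  fixes f g :: "'x \<Rightarrow> real"
  assumes "f \<in> L2 M" "g \<in> L2 M"
  shows "(\<lambda>x. f x + g x) \<in> L2 M"
  using assms L2_integrable_mult[OF assms]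
  by (auto simp: L2_real_iff power2_sum mult.assoc)

lemma L2_diff:
  fixes f g :: "'x \<Rightarrow> real"
  assumes "f \<in> L2 M" "g \<in> L2 M"
  shows "(\<lambda>x. f x - g x) \<in> L2 M"
  using L2_add[OF assms(1) L2_cmult[OF assms(2), of "-1"]] by simp

lemma L2_bounded_mult:
  fixes f b :: "'x \<Rightarrow> real"
  assumes "f \<in> L2 M" "b \<in> borel_measurable M" "\<And>x. x \<in> space M \<Longrightarrow> \<bar>b x\<bar> \<le> B"
  shows "(\<lambda>x. b x * f x) \<in> L2 M"
proof (rule L2_dominated[OF L2_cmult[OF assms(1), of B]])
  show "AE x in M. \<bar>b x * f x\<bar> \<le> \<bar>B * f x\<bar>"
  proof (rule AE_I2)
    fix x assume "x \<in> space M"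
    from assms(3)[OF this] show "\<bar>b x * f x\<bar> \<le> \<bar>B * f x\<bar>"
      by (auto simp: abs_mult intro!: mult_right_mono)
  qed
qed (use assms in \<open>auto simp: L2_real_iff\<close>)

lemma L2_cong_AE:
  fixes f g :: "'x \<Rightarrow> real"
  assumes "f \<in> L2 M" "g \<in> borel_measurable M" "AE x in M. g x = f x"
  shows "g \<in> L2 M"
  by (rule L2_dominated[OF assms(1,2)]) (use assms(3) in auto)

lemma L2_norm_nonneg [simp]: "0 \<le> L2_norm M f"
  by (simp add: L2_norm_def)

lemma L2_norm_power2: "(L2_norm M f)\<^sup>2 = (\<integral>x. (norm (f x))\<^sup>2 \<partial>M)"
  by (simp add: L2_norm_def)

lemma L2_inner_same: "L2_inner M f f = (L2_norm M f)\<^sup>2"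
  by (simp add: L2_norm_power2 L2_inner_def flip: power2_eq_square)

lemma L2_inner_commute: "L2_inner M f g = L2_inner M g f"
  by (simp add: L2_inner_def mult.commute)

lemma L2_inner_add_left:
  "f \<in> L2 M \<Longrightarrow> g \<in> L2 M \<Longrightarrow> h \<in> L2 M \<Longrightarrow>
   L2_inner M (\<lambda>x. f x + g x) h = L2_inner M f h + L2_inner M g h"
  by (simp add: L2_inner_def distrib_right L2_integrable_mult)

lemma L2_inner_diff_left:
  "f \<in> L2 M \<Longrightarrow> g \<in> L2 M \<Longrightarrow> h \<in> L2 M \<Longrightarrow>
   L2_inner M (\<lambda>x. f x - g x) h = L2_inner M f h - L2_inner M g h"
  by (simp add: L2_inner_def left_diff_distrib L2_integrable_mult)

lemma L2_inner_cmult_left: "L2_inner M (\<lambda>x. c * f x) h = c * L2_inner M f h"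
  by (simp add: L2_inner_def mult.assoc)

lemma L2_inner_cong_AE:
  assumes "f \<in> borel_measurable M" "f' \<in> borel_measurable M" "AE x in M. f x = f' x" "g \<in> borel_measurable M"
  shows "L2_inner M f g = L2_inner M f' g"
  unfolding L2_inner_def using assms by (intro integral_cong_AE) auto

lemma L2_norm_cong_AE:
  fixes f g :: "'x \<Rightarrow> real"
  assumes "f \<in> borel_measurable M" "g \<in> borel_measurable M" "AE x in M. f x = g x"
  shows "L2_norm M f = L2_norm M g"
proof -
  have "(\<integral>x. (norm (f x))\<^sup>2 \<partial>M) = (\<integral>x. (norm (g x))\<^sup>2 \<partial>M)"
    using assms by (intro integral_cong_AE) auto
  then show ?thesis by (simp add: L2_norm_def)
qed

lemma L2_norm_mono_AE:
  fixes f g :: "'x \<Rightarrow> real"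
  assumes "g \<in> L2 M" "f \<in> borel_measurable M" "AE x in M. \<bar>f x\<bar> \<le> \<bar>g x\<bar>"
  shows "L2_norm M f \<le> L2_norm M g"
proof -
  have "f \<in> L2 M" by (rule L2_dominated[OF assms])
  then have "(\<integral>x. (norm (f x))\<^sup>2 \<partial>M) \<le> (\<integral>x. (norm (g x))\<^sup>2 \<partial>M)"
    using assms by (intro integral_mono_AE) (auto simp: L2_real_iff abs_le_square_iff)
  then show ?thesis by (simp add: L2_norm_def)
qed

lemma L2_norm_cmult: "L2_norm M (\<lambda>x. c * f x) = \<bar>c\<bar> * L2_norm M (f :: 'x \<Rightarrow> real)"
  by (simp add: L2_norm_def power_mult_distrib real_sqrt_mult)

lemma L2_norm_abs: "L2_norm M (\<lambda>x. \<bar>f x\<bar>) = L2_norm M (f :: 'x \<Rightarrow> real)"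
  by (simp add: L2_norm_def)

text \<open>Integrating (s f + t g)^2 gives a nonnegative quadratic form in s and t, and its values
  at suitable points bound the mixed coefficient. The case where the norm of g vanishes is separate,
  since the main case divides by it.\<close>

lemma L2_Cauchy_Schwarz:
  assumes "f \<in> L2 M" "g \<in> L2 M"
  shows "\<bar>L2_inner M f g\<bar> \<le> L2_norm M f * L2_norm M g"
proof -
  let ?a = "L2_norm M f" and ?b = "L2_norm M g" and ?c = "L2_inner M f g"
  have Q: "0 \<le> s\<^sup>2 * ?a\<^sup>2 + 2 * s * t * ?c + t\<^sup>2 * ?b\<^sup>2" for s t
  proof -
    have "0 \<le> (\<integral>x. (s * f x + t * g x)\<^sup>2 \<partial>M)" by simp
    also have "\<dots> = (\<integral>x. s\<^sup>2 * (f x)\<^sup>2 + 2 * s * t * (f x * g x) + t\<^sup>2 * (g x)\<^sup>2 \<partial>M)"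
      by (intro Bochner_Integration.integral_cong) (auto simp: power2_eq_square algebra_simps)
    also have "\<dots> = s\<^sup>2 * ?a\<^sup>2 + 2 * s * t * ?c + t\<^sup>2 * ?b\<^sup>2"
      using assms L2_integrable_mult[OF assms]
      by (simp add: L2_real_iff L2_norm_power2 L2_inner_def)
    finally show ?thesis .
  qed
  have "?c\<^sup>2 \<le> (?a * ?b)\<^sup>2"
  proof (cases "?b = 0")
    case True
    have "?c = 0"
    proof (rule ccontr)
      \<comment> \<open>With the norm of g equal to 0 the form is s^2 a^2 + 2 s t c, and s = c, t =
        -(a^2 + 1)/2 give it the value -c^2.\<close>
      assume "?c \<noteq> 0"
      have "?c\<^sup>2 * ?a\<^sup>2 + 2 * ?c * (- (?a\<^sup>2 + 1) / 2) * ?c = - ?c\<^sup>2"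
        by (simp add: power2_eq_square field_simps)
      with Q[of "?c" "- (?a\<^sup>2 + 1) / 2"] True \<open>?c \<noteq> 0\<close> show False by simp
    qed
    then show ?thesis by simp
  next
    case False
    have "0 \<le> (?b\<^sup>2)\<^sup>2 * ?a\<^sup>2 - ?b\<^sup>2 * ?c\<^sup>2"
      using Q[of "?b\<^sup>2" "- ?c"] by (simp add: power2_eq_square algebra_simps)
    then have "0 \<le> ?b\<^sup>2 * ((?a * ?b)\<^sup>2 - ?c\<^sup>2)"
      by (simp add: power2_eq_square algebra_simps)
    then show ?thesis using False by (simp add: zero_le_mult_iff)
  qed
  then show ?thesis by (metis L2_norm_nonneg abs_le_square_iff abs_of_nonneg mult_nonneg_nonneg)
qed

lemma L2_Cauchy_Schwarz_abs:
  assumes "f \<in> L2 M" "g \<in> L2 M"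
  shows "(\<integral>x. \<bar>f x\<bar> * \<bar>g x\<bar> \<partial>M) \<le> L2_norm M f * L2_norm M g"
proof -
  have "(\<lambda>x. \<bar>f x\<bar>) \<in> L2 M" "(\<lambda>x. \<bar>g x\<bar>) \<in> L2 M" using assms by (auto simp: L2_real_iff)
  from L2_Cauchy_Schwarz[OF this] show ?thesis by (simp add: L2_norm_abs L2_inner_def)
qed

lemma L2_norm_add:
  fixes f g :: "'x \<Rightarrow> real"
  assumes "f \<in> L2 M" "g \<in> L2 M"
  shows "L2_norm M (\<lambda>x. f x + g x) \<le> L2_norm M f + L2_norm M g"
proof -
  have "(L2_norm M (\<lambda>x. f x + g x))\<^sup>2 = (L2_norm M f)\<^sup>2 + 2 * L2_inner M f g + (L2_norm M g)\<^sup>2"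
    unfolding L2_inner_same[symmetric] using assms
    by (simp add: L2_inner_add_left L2_add L2_inner_commute[of _ f "\<lambda>x. f x + g x"] L2_inner_commute[of _ g "\<lambda>x. f x + g x"] L2_inner_commute[of M g f])
  also have "\<dots> \<le> (L2_norm M f + L2_norm M g)\<^sup>2"
    using L2_Cauchy_Schwarz[OF assms] by (simp add: power2_sum)
  finally show ?thesis by (rule power2_le_imp_le) simp
qed

lemma L2_norm_triangle:
  fixes f g h :: "'x \<Rightarrow> real"
  assumes "f \<in> L2 M" "g \<in> L2 M" "h \<in> L2 M"
  shows "L2_norm M (\<lambda>x. f x - h x) \<le> L2_norm M (\<lambda>x. f x - g x) + L2_norm M (\<lambda>x. g x - h x)"
  using L2_norm_add[OF L2_diff[OF assms(1,2)] L2_diff[OF assms(2,3)]] by simp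

lemma L2_norm_eq_0_AE:
  fixes f :: "'x \<Rightarrow> real"
  assumes "f \<in> L2 M" "L2_norm M f = 0"
  shows "AE x in M. f x = 0"
proof -
  have "(\<integral>x. (f x)\<^sup>2 \<partial>M) = 0" using assms(2) by (simp add: L2_norm_def)
  then have "AE x in M. (f x)\<^sup>2 = 0"
    using assms(1) by (subst (asm) integral_nonneg_eq_0_iff_AE) (auto simp: L2_real_iff)
  then show ?thesis by auto
qed

text \<open>The Bochner integral of a non-integrable function is 0 by default, so a small
  \<open>L2_norm\<close> means something only for a function in \<open>L2 M\<close>. This is why the
  limit lemmas assume that the approximants eventually lie in L2.\<close>

lemma L2_tendsto_unique_AE:
  fixes f g :: "'x \<Rightarrow> real"
  assumes "L2_tendsto M F f \<F>" "L2_tendsto M F g \<F>" "\<F> \<noteq> bot"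
    and "f \<in> L2 M" "g \<in> L2 M" "\<forall>\<^sub>F i in \<F>. F i \<in> L2 M"
  shows "AE x in M. f x = g x"
proof -
  have "((\<lambda>i. L2_norm M (\<lambda>x. F i x - f x) + L2_norm M (\<lambda>x. F i x - g x)) \<longlongrightarrow> 0 + 0) \<F>"
    using assms(1,2) unfolding L2_tendsto_def by (rule tendsto_add)
  moreover have "\<forall>\<^sub>F i in \<F>. L2_norm M (\<lambda>x. f x - g x) \<le> L2_norm M (\<lambda>x. F i x - f x) + L2_norm M (\<lambda>x. F i x - g x)"
    using assms(6)
  proof eventually_elim
    case (elim i)
    have "L2_norm M (\<lambda>x. f x - F i x) = L2_norm M (\<lambda>x. F i x - f x)"
      unfolding L2_norm_def by (simp add: power2_commute)
    with L2_norm_triangle[OF assms(4) elim assms(5)] show ?case by simp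
  qed
  ultimately have "L2_norm M (\<lambda>x. f x - g x) \<le> 0"
    using tendsto_lowerbound[OF _ _ assms(3)] by fastforce
  then have "L2_norm M (\<lambda>x. f x - g x) = 0"
    using L2_norm_nonneg[of M "\<lambda>x. f x - g x"] by linarith
  from L2_norm_eq_0_AE[OF L2_diff[OF assms(4,5)] this] show ?thesis by simp
qed

lemma L2_tendsto_norm:
  fixes f :: "'x \<Rightarrow> real"
  assumes "L2_tendsto M F f \<F>" "f \<in> L2 M" "\<forall>\<^sub>F i in \<F>. F i \<in> L2 M"
  shows "((\<lambda>i. L2_norm M (F i)) \<longlongrightarrow> L2_norm M f) \<F>"
proof (rule Lim_transform_bound[where g = "\<lambda>i. L2_norm M (\<lambda>x. F i x - f x)", THEN LIM_zero_cancel])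
  show "((\<lambda>i. L2_norm M (\<lambda>x. F i x - f x)) \<longlongrightarrow> 0) \<F>" using assms(1) by (simp add: L2_tendsto_def)
  show "\<forall>\<^sub>F i in \<F>. norm (L2_norm M (F i) - L2_norm M f) \<le> norm (L2_norm M (\<lambda>x. F i x - f x))"
    using assms(3)
  proof eventually_elim
    case (elim i)
    have z: "(\<lambda>x. 0::real) \<in> L2 M" by (simp add: L2_real_iff)
    have "L2_norm M (\<lambda>x. f x - F i x) = L2_norm M (\<lambda>x. F i x - f x)"
      unfolding L2_norm_def by (simp add: power2_commute)
    with L2_norm_triangle[OF elim assms(2) z] L2_norm_triangle[OF assms(2) elim z] show ?case
      by simp
  qed
qed

text \<open>The difference splits as (F i - f, G i) + (f, G i - g). The norms of \<open>G i\<close>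
  converge, so both terms vanish by Cauchy-Schwarz.\<close>

lemma L2_inner_tendsto:
  assumes "L2_tendsto M F f \<F>" "L2_tendsto M G g \<F>"
    and "f \<in> L2 M" "g \<in> L2 M" "\<forall>\<^sub>F i in \<F>. F i \<in> L2 M" "\<forall>\<^sub>F i in \<F>. G i \<in> L2 M"
  shows "((\<lambda>i. L2_inner M (F i) (G i)) \<longlongrightarrow> L2_inner M f g) \<F>"
proof (rule LIM_zero_cancel, rule Lim_null_comparison)
  let ?b = "\<lambda>i. L2_norm M (\<lambda>x. F i x - f x) * L2_norm M (G i) + L2_norm M f * L2_norm M (\<lambda>x. G i x - g x)"
  have "(?b \<longlongrightarrow> 0 * L2_norm M g + L2_norm M f * 0) \<F>"
    using assms(1,2) L2_tendsto_norm[OF assms(2,4,6)]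
    unfolding L2_tendsto_def by (intro tendsto_intros)
  then show "(?b \<longlongrightarrow> 0) \<F>" by simp
  show "\<forall>\<^sub>F i in \<F>. norm (L2_inner M (F i) (G i) - L2_inner M f g) \<le> ?b i"
    using assms(5,6)
  proof eventually_elim
    case (elim i)
    have "L2_inner M (F i) (G i) - L2_inner M f g =
        L2_inner M (\<lambda>x. F i x - f x) (G i) + L2_inner M f (\<lambda>x. G i x - g x)"
      using elim assms(3,4)
      by (simp add: L2_inner_diff_left L2_inner_commute[of M f "\<lambda>x. G i x - g x"]
          L2_inner_commute[of M "G i" f] L2_inner_commute[of M g f])
    then show ?case
      using L2_Cauchy_Schwarz[OF L2_diff[OF elim(1) assms(3)] elim(2)]
        L2_Cauchy_Schwarz[OF assms(3) L2_diff[OF elim(2) assms(4)]] by simp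
  qed
qed

lemma L2_tendsto_const: "L2_tendsto M (\<lambda>_. f) (f :: 'x \<Rightarrow> real) \<F>"
  by (simp add: L2_tendsto_def L2_norm_def)

lemma L2_tendsto_cong_AE:
  fixes f :: "'x \<Rightarrow> real"
  assumes "L2_tendsto M F f \<F>" "\<forall>\<^sub>F i in \<F>. AE x in M. F i x = G i x"
    and "f \<in> borel_measurable M"
    and "\<forall>\<^sub>F i in \<F>. F i \<in> borel_measurable M" "\<forall>\<^sub>F i in \<F>. G i \<in> borel_measurable M"
  shows "L2_tendsto M G f \<F>"
  unfolding L2_tendsto_def
proof (rule Lim_transform_eventually[OF assms(1)[unfolded L2_tendsto_def]])
  show "\<forall>\<^sub>F i in \<F>. L2_norm M (\<lambda>x. F i x - f x) = L2_norm M (\<lambda>x. G i x - f x)"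
    using assms(2,4,5)
    by eventually_elim (rule L2_norm_cong_AE, use assms(3) in auto)
qed

text \<open>The pointwise limit inherits the bound h, so (2 h)^2 is an integrable bound for the
  squared differences.\<close>

lemma L2_dominated_convergence:
  fixes f :: "'x \<Rightarrow> real"
  assumes "f \<in> borel_measurable M" "h \<in> L2 M" "\<And>i. s i \<in> borel_measurable M"
    and "\<And>i x. x \<in> space M \<Longrightarrow> \<bar>s i x\<bar> \<le> h x" "AE x in M. (\<lambda>i. s i x) \<longlonglongrightarrow> f x"
  shows "L2_tendsto M s f sequentially"
proof -
  have "(\<lambda>i. \<integral>x. (norm (s i x - f x))\<^sup>2 \<partial>M) \<longlonglongrightarrow> (\<integral>x. 0 \<partial>M)"
  proof (rule integral_dominated_convergence)
    show "integrable M (\<lambda>x. (2 * h x)\<^sup>2)" using assms(2) by (simp add: L2_real_iff power_mult_distrib)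
    show "AE x in M. (\<lambda>i. (norm (s i x - f x))\<^sup>2) \<longlonglongrightarrow> 0"
      using assms(5)
    proof eventually_elim
      case (elim x)
      then have "(\<lambda>i. norm (s i x - f x)) \<longlonglongrightarrow> 0" using LIM_zero tendsto_norm_zero by blast
      from tendsto_power[OF this, of 2] show ?case by simp
    qed
    show "AE x in M. norm ((norm (s i x - f x))\<^sup>2) \<le> (2 * h x)\<^sup>2" for i
      using assms(5)
    proof (rule AE_mp, intro AE_I2 impI)
      fix x assume x: "x \<in> space M" "(\<lambda>i. s i x) \<longlonglongrightarrow> f x"
      have "\<bar>f x\<bar> \<le> h x"
        by (rule tendsto_upperbound[OF tendsto_rabs[OF x(2)]]) (use assms(4)[OF x(1)] in auto)
      then have "\<bar>s i x - f x\<bar> \<le> 2 * h x" using assms(4)[OF x(1), of i] by linarith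
      from power_mono[OF this abs_ge_zero, of 2]
      show "norm ((norm (s i x - f x))\<^sup>2) \<le> (2 * h x)\<^sup>2" by simp
    qed
  qed (use assms in auto)
  then have "(\<lambda>i. sqrt (\<integral>x. (norm (s i x - f x))\<^sup>2 \<partial>M)) \<longlonglongrightarrow> sqrt 0"
    by (intro tendsto_real_sqrt) simp
  then show ?thesis by (simp add: L2_tendsto_def L2_norm_def)
qed

section \<open>Density of test functions and the lemma of du Bois-Reymond\<close>

text \<open>At depth d below a face the factor is exp (-1/(n d)), which tends to 1 as n grows; the
  product over all faces is a smooth approximation from below of the indicator of the open
  box.\<close>

definition box_bump :: "'a::euclidean_space \<Rightarrow> 'a \<Rightarrow> nat \<Rightarrow> 'a \<Rightarrow> real" where
  "box_bump a b n x = (\<Prod>i\<in>Basis. flat 0 (real n * (x \<bullet> i - a \<bullet> i)) * flat 0 (real n * (b \<bullet> i - x \<bullet> i)))"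

lemma flat_0_le_1: "flat 0 x \<le> 1"
  by (simp add: flat_def)

lemma box_bump_bounds: "0 \<le> box_bump a b n x" "box_bump a b n x \<le> 1"
  unfolding box_bump_def
  by (auto intro!: prod_nonneg prod_le_1 mult_nonneg_nonneg flat_nonneg mult_le_one flat_0_le_1)

lemma box_bump_outside:
  assumes "x \<notin> box a b"
  shows "box_bump a b n x = 0"
proof -
  obtain i where i: "i \<in> Basis" "\<not> (a \<bullet> i < x \<bullet> i \<and> x \<bullet> i < b \<bullet> i)"
    using assms by (auto simp: mem_box)
  then have "flat 0 (real n * (x \<bullet> i - a \<bullet> i)) * flat 0 (real n * (b \<bullet> i - x \<bullet> i)) = 0"
    by (auto simp: flat_def zero_less_mult_iff)
  with i(1) show ?thesis unfolding box_bump_def by (intro prod_zero) auto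
qed

lemma smooth_box_bump: "smooth (box_bump a b n)"
proof -
  have "smooth (\<lambda>x. \<Prod>i\<in>Basis. flat 0 (real n * (x \<bullet> i + - (a \<bullet> i))) * flat 0 (real n * (b \<bullet> i + -1 * (x \<bullet> i))))"
    by (intro smooth_prod smooth_mult smooth_flat smooth_add smooth_const smooth_inner)
  then show ?thesis unfolding box_bump_def[abs_def] by simp
qed

lemma box_bump_test:
  assumes "compact K" "K \<subseteq> S" "box a b \<subseteq> K"
  shows "box_bump a b n \<in> test_functions S"
  by (rule test_functionsI[OF smooth_box_bump assms(1,2)]) (use assms(3) box_bump_outside in blast)

lemma box_bump_tendsto: "(\<lambda>n. box_bump a b n x) \<longlonglongrightarrow> indicator (box a b) x"
proof (cases "x \<in> box a b")
  case False
  then show ?thesis by (simp add: box_bump_outside)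
next
  case True
  have f: "(\<lambda>n. flat 0 (real n * c)) \<longlonglongrightarrow> 1" if "c > 0" for c
  proof -
    have "(\<lambda>n. exp (- (1 / c * (1 / real n)))) \<longlonglongrightarrow> exp (- (1 / c * 0))"
      by (intro tendsto_intros lim_1_over_n)
    then have "(\<lambda>n. exp (- (1 / c * (1 / real n)))) \<longlonglongrightarrow> 1" by simp
    then show ?thesis
    proof (rule Lim_transform_eventually)
      show "\<forall>\<^sub>F n in sequentially. exp (- (1 / c * (1 / real n))) = flat 0 (real n * c)"
        using eventually_gt_at_top[of 0]
        by eventually_elim (use that in \<open>auto simp: flat_def mult.commute\<close>)
    qed
  qed
  have "(\<lambda>n. box_bump a b n x) \<longlonglongrightarrow> (\<Prod>i\<in>(Basis::'a set). 1 * 1)"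
    unfolding box_bump_def using True by (intro tendsto_prod tendsto_mult f) (auto simp: mem_box)
  then show ?thesis using True by simp
qed

lemma test_function_borel [measurable]: "\<phi> \<in> test_functions S \<Longrightarrow> \<phi> \<in> borel_measurable borel"
  by (intro borel_measurable_continuous_onI smooth_continuous test_functionsD)

lemma test_function_lebesgue: "\<phi> \<in> test_functions S \<Longrightarrow> \<phi> \<in> borel_measurable lebesgue"
  by (rule measurable_completion) (use test_function_borel in simp)

section \<open>Vanishing integrals over boxes and the fundamental lemma of the calculus of
  variations\<close>

lemma Int_stable_box: "Int_stable (range (\<lambda>(a, b). box a b :: 'a::euclidean_space set))"
  by (auto simp: Int_stable_def box_Int_box)

lemma sets_borel_box: "sets borel = sigma_sets UNIV (range (\<lambda>(a, b). box a b :: 'a::euclidean_space set))"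
  by (subst borel_eq_box) (simp add: sets_measure_of)

text \<open>The Borel sets over which h integrates to 0 form a Dynkin system: complements use
  \<open>total\<close>, since the whole space is not a box, and disjoint unions use dominated
  convergence. Open boxes are an intersection-stable generator, so all Borel sets are reached.
  Uniqueness of densities then applies to a Borel representative of h.\<close>

lemma AE_zero_of_box_integrals:
  fixes h :: "'a::euclidean_space \<Rightarrow> real"
  assumes h: "integrable lebesgue h"
    and zero: "\<And>c d. (\<integral>x. indicator (box c d) x * h x \<partial>lebesgue) = 0"
    and total: "(\<integral>x. h x \<partial>lebesgue) = 0"
  shows "AE x in lebesgue. h x = 0"
proof -
  obtain h' where h': "h' \<in> borel_measurable lborel" and eq: "AE x in lborel. h x = h' x"
    using completion_ex_borel_measurable_real[OF borel_measurable_integrable[OF h]] by auto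
  have eq': "AE x in lebesgue. h x = h' x" using eq by (rule AE_completion)
  have [measurable]: "h \<in> borel_measurable lebesgue" "h' \<in> borel_measurable lebesgue"
    using h h' by (auto intro: measurable_completion)
  have int': "integrable lebesgue h'"
    using h eq' by (subst integrable_cong_AE[symmetric, of h]) auto
  have int: "integrable lborel h'" using int' h' by (simp add: integrable_completion)
  have inth: "integrable lebesgue (\<lambda>x. indicator A x * h x)" if "A \<in> sets borel" for A
    using integrable_mult_indicator[of A lebesgue h] h that by simp
  have "(\<integral>x. indicator A x * h x \<partial>lebesgue) = 0" if "A \<in> sets borel" for A
    using Int_stable_box subset_Pow_Union[of "range (\<lambda>(a, b). box a b)", THEN subset_trans, OF Pow_mono[OF subset_UNIV]] that[unfolded sets_borel_box]
  proof (induction rule: sigma_sets_induct_disjoint)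
    case (compl A)
    then have A: "A \<in> sets borel" by (simp add: sets_borel_box)
    have "(\<integral>x. indicator (UNIV - A) x * h x \<partial>lebesgue) = (\<integral>x. h x - indicator A x * h x \<partial>lebesgue)"
      by (intro Bochner_Integration.integral_cong) (auto simp: indicator_def)
    also have "\<dots> = 0" using compl total h inth[OF A] by simp
    finally show ?case .
  next
    case (union A)
    then have A: "A i \<in> sets borel" for i by (auto simp: sets_borel_box)
    have "(\<lambda>n. \<integral>x. (\<Sum>i<n. indicator (A i) x) * h x \<partial>lebesgue) \<longlonglongrightarrow> (\<integral>x. indicator (\<Union>i. A i) x * h x \<partial>lebesgue)"
    proof (rule integral_dominated_convergence)
      show "integrable lebesgue (\<lambda>x. \<bar>h x\<bar>)" using h by auto
      show "AE x in lebesgue. (\<lambda>n. (\<Sum>i<n. indicator (A i) x) * h x) \<longlonglongrightarrow> indicator (\<Union>i. A i) x * h x"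
      proof (rule AE_I2)
        fix x
        have "(\<lambda>i. indicator (A i) x :: real) sums indicator (\<Union>i. A i) x"
          using indicator_sums[of A x] union(1) by (auto simp: disjoint_family_on_def)
        then show "(\<lambda>n. (\<Sum>i<n. indicator (A i) x) * h x) \<longlonglongrightarrow> indicator (\<Union>i. A i) x * h x"
          unfolding sums_def by (intro tendsto_intros)
      qed
      show "AE x in lebesgue. norm ((\<Sum>i<n. indicator (A i) x) * h x) \<le> \<bar>h x\<bar>" for n
      proof (rule AE_I2)
        fix x
        have "(\<Sum>i<n. indicator (A i) x :: real) = indicator (\<Union>i<n. A i) x"
          using union(1) by (intro indicator_UN_disjoint[symmetric]) (auto simp: disjoint_family_on_def)
        then show "norm ((\<Sum>i<n. indicator (A i) x) * h x) \<le> \<bar>h x\<bar>"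
          by (auto simp: indicator_def)
      qed
    next
      have AL: "A i \<in> sets lebesgue" for i using A[of i] by auto
      then show "(\<lambda>x. indicator (\<Union>i. A i) x * h x) \<in> borel_measurable lebesgue"
        and "(\<lambda>x. (\<Sum>i<n. indicator (A i) x) * h x) \<in> borel_measurable lebesgue" for n
        using h by (auto intro!: borel_measurable_times borel_measurable_indicator borel_measurable_sum)
    qed
    moreover have "(\<integral>x. (\<Sum>i<n. indicator (A i) x) * h x \<partial>lebesgue) = 0" for n
      unfolding sum_distrib_right using inth[OF A] union(3)
      by (subst Bochner_Integration.integral_sum) auto
    ultimately show ?case by (simp add: LIMSEQ_const_iff)
  qed (auto simp: zero)
  moreover have "(\<integral>x. indicator A x * h x \<partial>lebesgue) = (\<integral>x. indicator A x * h' x \<partial>lborel)" if "A \<in> sets borel" for A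
  proof -
    have "(\<integral>x. indicator A x * h x \<partial>lebesgue) = (\<integral>x. indicator A x * h' x \<partial>lebesgue)"
    proof (rule integral_cong_AE)
      have "A \<in> sets lebesgue" using that by auto
      then show "(\<lambda>x. indicator A x * h x) \<in> borel_measurable lebesgue"
        "(\<lambda>x. indicator A x * h' x) \<in> borel_measurable lebesgue"
        using h int' by (auto intro!: borel_measurable_times borel_measurable_indicator)
    qed (use eq' in auto)
    also have "\<dots> = (\<integral>x. indicator A x * h' x \<partial>lborel)"
      using h' that by (intro integral_completion) auto
    finally show ?thesis .
  qed
  ultimately have "AE x in lborel. h' x = 0"
    using density_unique_real[OF int, of "\<lambda>_. 0"] by (simp add: set_lebesgue_integral_def)
  then have "AE x in lebesgue. h' x = 0" by (rule AE_completion)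
  with eq' show ?thesis by auto
qed

lemma integral_lebesgue_on_eq:
  fixes f :: "'a::euclidean_space \<Rightarrow> real"
  assumes "S \<in> sets lebesgue"
  shows "integral\<^sup>L (lebesgue_on S) f = (\<integral>x. indicator S x * f x \<partial>lebesgue)"
  using assms integral_restrict_space[of S lebesgue f] by simp

lemma integrable_lebesgue_on_eq:
  fixes f :: "'a::euclidean_space \<Rightarrow> real"
  assumes "S \<in> sets lebesgue"
  shows "integrable (lebesgue_on S) f \<longleftrightarrow> integrable lebesgue (\<lambda>x. indicator S x * f x)"
  using assms integrable_restrict_space[of S lebesgue f] by simp

text \<open>The domain is a countable union of closed boxes. Inside one of them the bumps of an open
  sub-box are test functions on the domain, and their limit shows that h integrates to 0 over that
  sub-box; local integrability supplies the dominating function.\<close>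

lemma du_Bois_Reymond:
  fixes h :: "'a::euclidean_space \<Rightarrow> real"
  assumes "open \<Omega>" "locally_integrable \<Omega> h"
    and zero: "\<And>\<phi>. \<phi> \<in> test_functions \<Omega> \<Longrightarrow> (\<integral>x. h x * \<phi> x \<partial>lebesgue_on \<Omega>) = 0"
  shows "AE x in lebesgue_on \<Omega>. h x = 0"
proof -
  have \<Omega>: "\<Omega> \<in> sets lebesgue" using assms(1) by auto
  obtain \<D> where \<D>: "countable \<D>" "\<D> \<subseteq> Pow \<Omega>" "\<And>X. X \<in> \<D> \<Longrightarrow> \<exists>a b. X = cbox a b" "\<Union>\<D> = \<Omega>"
    using open_countable_Union_open_cbox[OF assms(1)] by metis
  have "AE x in lebesgue. x \<in> X \<longrightarrow> h x = 0" if "X \<in> \<D>" for X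
  proof -
    obtain a b where X: "X = cbox a b" using \<D>(3)[OF \<open>X \<in> \<D>\<close>] by blast
    have sub: "cbox a b \<subseteq> \<Omega>" using \<D>(2) X that by blast
    have hi: "integrable lebesgue (\<lambda>x. indicator (cbox a b) x * h x)"
      using assms(2) sub by (simp add: locally_integrable_def flip: integrable_lebesgue_on_eq)
    have box0: "(\<integral>x. indicator (box c d) x * h x \<partial>lebesgue) = 0" if cd: "box c d \<subseteq> cbox a b" for c d
    proof -
      have "(\<lambda>n. \<integral>x. indicator (cbox a b) x * h x * box_bump c d n x \<partial>lebesgue)
          \<longlonglongrightarrow> (\<integral>x. indicator (cbox a b) x * h x * indicator (box c d) x \<partial>lebesgue)"
      proof (rule integral_dominated_convergence)
        show "integrable lebesgue (\<lambda>x. \<bar>indicator (cbox a b) x * h x\<bar>)" using hi by (rule integrable_abs)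
        show "AE x in lebesgue. norm (indicator (cbox a b) x * h x * box_bump c d n x)
          \<le> \<bar>indicator (cbox a b) x * h x\<bar>" for n
          by (intro AE_I2) (auto simp: abs_mult box_bump_bounds intro!: mult_left_le)
        show "AE x in lebesgue. (\<lambda>n. indicator (cbox a b) x * h x * box_bump c d n x) \<longlonglongrightarrow>
          indicator (cbox a b) x * h x * indicator (box c d) x"
          by (intro AE_I2 tendsto_intros box_bump_tendsto)
        show "(\<lambda>x. indicator (cbox a b) x * h x * indicator (box c d) x) \<in> borel_measurable lebesgue"
          by (rule borel_measurable_times[OF borel_measurable_integrable[OF hi]])
            (auto intro!: borel_measurable_indicator)
        show "(\<lambda>x. indicator (cbox a b) x * h x * box_bump c d n x) \<in> borel_measurable lebesgue" for n
          by (rule borel_measurable_times[OF borel_measurable_integrable[OF hi]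
              test_function_lebesgue[OF box_bump_test[OF compact_cbox subset_UNIV box_subset_cbox]]])
      qed
      moreover have "(\<integral>x. indicator (cbox a b) x * h x * box_bump c d n x \<partial>lebesgue) = 0" for n
      proof -
        have "(\<integral>x. indicator (cbox a b) x * h x * box_bump c d n x \<partial>lebesgue) =
            (\<integral>x. h x * box_bump c d n x \<partial>lebesgue_on \<Omega>)"
          unfolding integral_lebesgue_on_eq[OF \<Omega>]
        proof (intro Bochner_Integration.integral_cong refl)
          fix x show "indicator (cbox a b) x * h x * box_bump c d n x = indicator \<Omega> x * (h x * box_bump c d n x)"
            using sub cd box_bump_outside[of x c d n] by (cases "x \<in> box c d") (auto simp: indicator_def)
        qed
        also have "\<dots> = 0" by (rule zero[OF box_bump_test[OF compact_cbox sub cd]])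
        finally show ?thesis .
      qed
      ultimately have "(\<integral>x. indicator (cbox a b) x * h x * indicator (box c d) x \<partial>lebesgue) = 0"
        by (simp add: LIMSEQ_const_iff)
      moreover have "indicator (cbox a b) x * h x * indicator (box c d) x = indicator (box c d) x * h x" for x
        using cd by (auto simp: indicator_def)
      ultimately show ?thesis by simp
    qed
    have "AE x in lebesgue. indicator (box a b) x * h x = 0"
    proof (rule AE_zero_of_box_integrals)
      have "integrable lebesgue (\<lambda>x. indicator (box a b) x *\<^sub>R (indicator (cbox a b) x * h x))"
        by (rule integrable_mult_indicator[OF _ hi]) auto
      moreover have "(\<lambda>x. indicator (box a b) x *\<^sub>R (indicator (cbox a b) x * h x)) = (\<lambda>x. indicator (box a b) x * h x)"
        using box_subset_cbox[of a b] by (auto simp: indicator_def fun_eq_iff)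
      ultimately show "integrable lebesgue (\<lambda>x. indicator (box a b) x * h x)" by (simp only:)
      show "(\<integral>x. indicator (box a b) x * h x \<partial>lebesgue) = 0"
        using box0[OF box_subset_cbox] .
      show "(\<integral>x. indicator (box c d) x * (indicator (box a b) x * h x) \<partial>lebesgue) = 0" for c d
      proof -
        have "(\<integral>x. indicator (box c d \<inter> box a b) x * h x \<partial>lebesgue) = 0"
          unfolding box_Int_box
          by (rule box0) (use box_subset_cbox[of a b] box_Int_box[of c d a b] in blast)
        then show ?thesis by (simp add: indicator_inter_arith mult.assoc)
      qed
    qed
    \<comment> \<open>The argument reaches only the open box; the faces of the closed one form a
      null set.\<close>
    moreover have "AE x in lebesgue. x \<notin> cbox a b - box a b"
      by (intro AE_not_in) (simp add: negligible_frontier_interval negligible_iff_null_sets[symmetric])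
    ultimately show ?thesis unfolding X by eventually_elim (auto simp: indicator_def split: if_splits)
  qed
  then have "AE x in lebesgue. \<forall>X\<in>\<D>. x \<in> X \<longrightarrow> h x = 0"
    by (subst AE_ball_countable[OF \<D>(1)]) blast
  then have "AE x in lebesgue. x \<in> \<Omega> \<longrightarrow> h x = 0"
    by eventually_elim (use \<D>(4) in blast)
  then show ?thesis using \<Omega> by (subst AE_restrict_space_iff) auto
qed

section \<open>Density of test functions in L2\<close>

lemma test_function_integrable:
  assumes "\<phi> \<in> test_functions S"
  shows "integrable lebesgue \<phi>"
proof -
  let ?K = "closure {x. \<phi> x \<noteq> 0}"
  have "integrable lborel (\<lambda>x. indicator ?K x *\<^sub>R \<phi> x)"
    by (rule borel_integrable_compact[OF test_functionsD(2)[OF assms]])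
      (intro smooth_continuous test_functionsD(1)[OF assms])
  moreover have "(\<lambda>x. indicator ?K x *\<^sub>R \<phi> x) = \<phi>"
  proof
    fix x show "indicator ?K x *\<^sub>R \<phi> x = \<phi> x"
      by (cases "x \<in> ?K") (simp_all add: test_function_outside[of x])
  qed
  ultimately have "integrable lborel \<phi>" by (simp only:)
  then show ?thesis
    using test_function_borel[OF assms] by (simp add: integrable_completion)
qed

lemma test_function_L2:
  assumes "\<phi> \<in> test_functions S"
  shows "\<phi> \<in> L2 lebesgue"
  using test_function_integrable[OF test_functions_mult[OF test_functionsD(1)[OF assms] assms]]
    test_function_lebesgue[OF assms]
  by (simp add: L2_real_iff power2_eq_square)

text \<open>Membership in the L2 closure of the test functions, a class stable under linear
  combinations and L2 limits; density climbs within it from open boxes to Borel sets to simple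
  functions.\<close>

definition approx_by_test :: "('a::euclidean_space \<Rightarrow> real) \<Rightarrow> bool" where
  "approx_by_test f \<longleftrightarrow> f \<in> L2 lebesgue \<and>
     (\<forall>e>0. \<exists>\<phi>\<in>test_functions UNIV. L2_norm lebesgue (\<lambda>x. f x - \<phi> x) < e)"

lemma approx_by_test_limit:
  assumes "f \<in> L2 lebesgue" "\<And>n. approx_by_test (s n)" "L2_tendsto lebesgue s f sequentially"
  shows "approx_by_test f"
  unfolding approx_by_test_def
proof (intro conjI allI impI)
  fix e :: real assume "e > 0"
  then have "\<forall>\<^sub>F n in sequentially. L2_norm lebesgue (\<lambda>x. s n x - f x) < e / 2"
    using order_tendstoD(2)[OF assms(3)[unfolded L2_tendsto_def], of "e / 2"] by simp
  then obtain n where n: "L2_norm lebesgue (\<lambda>x. s n x - f x) < e / 2"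
    by (auto simp: eventually_sequentially)
  obtain \<phi> where \<phi>: "\<phi> \<in> test_functions UNIV" "L2_norm lebesgue (\<lambda>x. s n x - \<phi> x) < e / 2"
    using assms(2)[of n] \<open>e > 0\<close> unfolding approx_by_test_def by (meson half_gt_zero)
  have "L2_norm lebesgue (\<lambda>x. f x - s n x) = L2_norm lebesgue (\<lambda>x. s n x - f x)"
    unfolding L2_norm_def by (simp add: power2_commute)
  moreover have "s n \<in> L2 lebesgue" using assms(2) by (simp add: approx_by_test_def)
  ultimately have "L2_norm lebesgue (\<lambda>x. f x - \<phi> x) < e"
    using L2_norm_triangle[OF assms(1) _ test_function_L2[OF \<phi>(1)], of "s n"] n \<phi>(2) by simp
  with \<phi>(1) show "\<exists>\<phi>\<in>test_functions UNIV. L2_norm lebesgue (\<lambda>x. f x - \<phi> x) < e" by blast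
qed (rule assms(1))

lemma approx_by_test_add:
  assumes "approx_by_test f" "approx_by_test g"
  shows "approx_by_test (\<lambda>x. f x + g x)"
  unfolding approx_by_test_def
proof (intro conjI allI impI)
  have L: "f \<in> L2 lebesgue" "g \<in> L2 lebesgue" using assms by (auto simp: approx_by_test_def)
  then show "(\<lambda>x. f x + g x) \<in> L2 lebesgue" by (rule L2_add)
  fix e :: real assume "e > 0"
  then obtain \<phi> \<psi> where \<phi>: "\<phi> \<in> test_functions UNIV" "L2_norm lebesgue (\<lambda>x. f x - \<phi> x) < e / 2"
    and \<psi>: "\<psi> \<in> test_functions UNIV" "L2_norm lebesgue (\<lambda>x. g x - \<psi> x) < e / 2"
    using assms unfolding approx_by_test_def by (meson half_gt_zero)
  have "L2_norm lebesgue (\<lambda>x. (f x - \<phi> x) + (g x - \<psi> x)) < e"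
    using L2_norm_add[OF L2_diff[OF L(1) test_function_L2[OF \<phi>(1)]] L2_diff[OF L(2) test_function_L2[OF \<psi>(1)]]]
      \<phi>(2) \<psi>(2) by simp
  then have "L2_norm lebesgue (\<lambda>x. f x + g x - (\<phi> x + \<psi> x)) < e"
    by (simp only: add_diff_add)
  then show "\<exists>\<phi>\<in>test_functions UNIV. L2_norm lebesgue (\<lambda>x. f x + g x - \<phi> x) < e"
    using test_functions_add[OF \<phi>(1) \<psi>(1)] by (intro bexI[of _ "\<lambda>x. \<phi> x + \<psi> x"]) simp_all
qed

lemma approx_by_test_test: "\<phi> \<in> test_functions UNIV \<Longrightarrow> approx_by_test \<phi>"
  unfolding approx_by_test_def using test_function_L2 by (auto intro!: bexI[of _ \<phi>] simp: L2_norm_def)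

lemma approx_by_test_cmult:
  assumes "approx_by_test f"
  shows "approx_by_test (\<lambda>x. c * f x)"
  unfolding approx_by_test_def
proof (intro conjI allI impI)
  show "(\<lambda>x. c * f x) \<in> L2 lebesgue" using assms by (simp add: approx_by_test_def L2_cmult)
  fix e :: real assume "e > 0"
  then have "e / (\<bar>c\<bar> + 1) > 0" by (simp add: add_nonneg_pos)
  then obtain \<phi> where \<phi>: "\<phi> \<in> test_functions UNIV" "L2_norm lebesgue (\<lambda>x. f x - \<phi> x) < e / (\<bar>c\<bar> + 1)"
    using assms unfolding approx_by_test_def by meson
  have "L2_norm lebesgue (\<lambda>x. c * f x - c * \<phi> x) = \<bar>c\<bar> * L2_norm lebesgue (\<lambda>x. f x - \<phi> x)"
    by (simp add: L2_norm_cmult[symmetric] right_diff_distrib)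
  also have "\<dots> \<le> (\<bar>c\<bar> + 1) * L2_norm lebesgue (\<lambda>x. f x - \<phi> x)"
    by (intro mult_right_mono) auto
  also have "\<dots> < e" using \<phi>(2) by (simp add: pos_less_divide_eq mult.commute add_nonneg_pos)
  finally show "\<exists>\<phi>\<in>test_functions UNIV. L2_norm lebesgue (\<lambda>x. c * f x - \<phi> x) < e"
    using test_functions_mult[OF smooth_const \<phi>(1), of c] by (intro bexI[of _ "\<lambda>x. c * \<phi> x"])
qed

lemma approx_by_test_sum:
  "(\<And>i. i \<in> I \<Longrightarrow> approx_by_test (f i)) \<Longrightarrow> approx_by_test (\<lambda>x. \<Sum>i\<in>I. f i x)"
  by (induction I rule: infinite_finite_induct)
    (auto intro: approx_by_test_add approx_by_test_test[OF zero_test_function])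

lemma indicator_L2:
  fixes A :: "'a::euclidean_space set"
  assumes "A \<in> sets lebesgue" "A \<subseteq> box a b"
  shows "indicat_real A \<in> L2 lebesgue"
proof -
  have "emeasure lebesgue A \<le> emeasure lebesgue (box a b)"
    by (rule emeasure_mono[OF assms(2)]) auto
  also have "\<dots> < \<infinity>" using emeasure_lborel_box_finite[of a b] by simp
  finally have "integrable lebesgue (indicator A :: 'a \<Rightarrow> real)"
    using assms(1) by (intro integrable_real_indicator) auto
  moreover have "(indicator A x :: real)\<^sup>2 = indicator A x" for x by (simp add: indicator_def)
  ultimately show ?thesis using assms(1) by (simp add: L2_real_iff borel_measurable_indicator)
qed

text \<open>A Dynkin system argument relative to a fixed box: without the intersection, complements
  could have infinite measure and leave L2.\<close>

lemma approx_by_test_borel_Int_box: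
  fixes A :: "'a::euclidean_space set"
  assumes "A \<in> sets borel"
  shows "approx_by_test (indicator (A \<inter> box a b))"
  using Int_stable_box subset_Pow_Union[of "range (\<lambda>(a, b). box a b)", THEN subset_trans, OF Pow_mono[OF subset_UNIV]]
    assms[unfolded sets_borel_box]
proof (induction rule: sigma_sets_induct_disjoint)
  have box: "approx_by_test (indicator (box c d))" for c d :: 'a
  proof (rule approx_by_test_limit[where s = "box_bump c d"])
    show "approx_by_test (box_bump c d n)" for n
      by (intro approx_by_test_test box_bump_test[OF compact_cbox subset_UNIV box_subset_cbox])
    show I: "indicat_real (box c d) \<in> L2 lebesgue" by (rule indicator_L2) auto
    show "L2_tendsto lebesgue (box_bump c d) (indicator (box c d)) sequentially"
    proof (rule L2_dominated_convergence[OF L2_measurable[OF I] I])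
      show "box_bump c d i \<in> borel_measurable lebesgue" for i
        by (rule test_function_lebesgue[OF box_bump_test[OF compact_cbox subset_UNIV box_subset_cbox]])
      show "\<bar>box_bump c d i x\<bar> \<le> indicator (box c d) x" for i x
        using box_bump_bounds[of c d i x] box_bump_outside[of x c d i] by (auto simp: indicator_def)
    qed (simp add: box_bump_tendsto)
  qed
  {
    case (basic A)
    then show ?case using box by (auto simp: box_Int_box)
  next
    case empty
    show ?case using approx_by_test_test[OF zero_test_function] by simp
  next
    case (compl A)
    have "approx_by_test (\<lambda>x. indicator (box a b) x + -1 * indicator (A \<inter> box a b) x)"
      by (intro approx_by_test_add approx_by_test_cmult box compl)
    moreover have "indicator (box a b) x + -1 * indicator (A \<inter> box a b) x = (indicator ((UNIV - A) \<inter> box a b) x :: real)" for x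
      by (auto simp: indicator_def)
    ultimately show ?case by simp
  next
    case (union A)
    then have A: "A i \<in> sets lebesgue" for i by (auto simp: sets_borel_box[symmetric])
    have disj: "(\<Sum>i<n. indicator (A i \<inter> box a b) x :: real) = indicator ((\<Union>i<n. A i) \<inter> box a b) x" for n x
    proof -
      have "(\<Sum>i<n. indicator (A i) x :: real) = indicator (\<Union>i<n. A i) x"
        using union(1) by (intro indicator_UN_disjoint[symmetric]) (auto simp: disjoint_family_on_def)
      then show ?thesis by (simp add: indicator_inter_arith flip: sum_distrib_right)
    qed
    show ?case
    proof (rule approx_by_test_limit[where s = "\<lambda>n x. \<Sum>i<n. indicator (A i \<inter> box a b) x"])
      show "approx_by_test (\<lambda>x. \<Sum>i<n. indicator (A i \<inter> box a b) x)" for n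
        by (intro approx_by_test_sum union)
      have U: "(\<Union>i. A i) \<inter> box a b \<in> sets lebesgue" using A by (intro sets.Int sets.countable_UN) auto
      then show L: "indicat_real ((\<Union>i. A i) \<inter> box a b) \<in> L2 lebesgue" by (rule indicator_L2) auto
      show "L2_tendsto lebesgue (\<lambda>n x. \<Sum>i<n. indicat_real (A i \<inter> box a b) x) (indicator ((\<Union>i. A i) \<inter> box a b)) sequentially"
      proof (rule L2_dominated_convergence[OF L2_measurable[OF L] L])
        show "(\<lambda>x. \<Sum>i<n. indicator (A i \<inter> box a b) x :: real) \<in> borel_measurable lebesgue" for n
          using A by (intro borel_measurable_sum borel_measurable_indicator sets.Int) auto
        show "\<bar>\<Sum>i<n. indicator (A i \<inter> box a b) x :: real\<bar> \<le> indicator ((\<Union>i. A i) \<inter> box a b) x" for n x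
          unfolding disj by (auto simp: indicator_def)
        show "AE x in lebesgue. (\<lambda>n. \<Sum>i<n. indicator (A i \<inter> box a b) x :: real) \<longlonglongrightarrow> indicator ((\<Union>i. A i) \<inter> box a b) x"
        proof (rule AE_I2)
          fix x
          have "(\<lambda>i. indicator (A i) x :: real) sums indicator (\<Union>i. A i) x"
            using indicator_sums[of A x] union(1) by (auto simp: disjoint_family_on_def)
          then have "(\<lambda>i. indicator (A i) x * indicator (box a b) x :: real) sums (indicator (\<Union>i. A i) x * indicator (box a b) x)"
            by (rule sums_mult2)
          then show "(\<lambda>n. \<Sum>i<n. indicator (A i \<inter> box a b) x :: real) \<longlonglongrightarrow> indicator ((\<Union>i. A i) \<inter> box a b) x"
            by (simp add: sums_def indicator_inter_arith)
        qed
      qed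
    qed
  }
qed

text \<open>The cubes (-n, n)^N exhaust the space, and domination by the indicator itself turns
  pointwise into L2 convergence.\<close>

lemma approx_by_test_indicator:
  fixes A :: "'a::euclidean_space set"
  assumes "A \<in> sets borel" "indicat_real A \<in> L2 lebesgue"
  shows "approx_by_test (indicator A)"
proof (rule approx_by_test_limit[OF assms(2)])
  let ?B = "\<lambda>n::nat. box (- (real n *\<^sub>R One)) (real n *\<^sub>R One) :: 'a set"
  show "approx_by_test (indicator (A \<inter> ?B n))" for n
    by (rule approx_by_test_borel_Int_box[OF assms(1)])
  show "L2_tendsto lebesgue (\<lambda>n. indicator (A \<inter> ?B n)) (indicat_real A) sequentially"
  proof (rule L2_dominated_convergence[OF L2_measurable[OF assms(2)] assms(2)])
    show "indicat_real (A \<inter> ?B n) \<in> borel_measurable lebesgue" for n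
      using assms(1) by (intro borel_measurable_indicator sets.Int) auto
    show "\<bar>indicator (A \<inter> ?B n) x\<bar> \<le> (indicator A x :: real)" for n x by (auto simp: indicator_def)
    show "AE x in lebesgue. (\<lambda>n. indicator (A \<inter> ?B n) x :: real) \<longlonglongrightarrow> indicator A x"
    proof (rule AE_I2, rule tendsto_eventually)
      fix x :: 'a
      obtain n where n: "norm x < real n" using reals_Archimedean2 by blast
      have "x \<in> ?B k" if "k \<ge> n" for k
      proof -
        have "\<bar>x \<bullet> i\<bar> < real k" if "i \<in> Basis" for i
          using Basis_le_norm[OF that, of x] n \<open>k \<ge> n\<close> by linarith
        then show ?thesis by (force simp: mem_box)
      qed
      then show "\<forall>\<^sub>F n in sequentially. indicator (A \<inter> ?B n) x = (indicator A x :: real)"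
        unfolding eventually_sequentially by (intro exI[of _ n]) (auto simp: indicator_def)
    qed
  qed
qed

theorem test_functions_dense_L2:
  fixes f :: "'a::euclidean_space \<Rightarrow> real"
  assumes f: "f \<in> L2 lebesgue" and "e > 0"
  obtains \<phi> where "\<phi> \<in> test_functions UNIV" "L2_norm lebesgue (\<lambda>x. f x - \<phi> x) < e"
proof -
  obtain g where g: "g \<in> borel_measurable lborel" and fg: "AE x in lborel. f x = g x"
    using completion_ex_borel_measurable_real[OF L2_measurable[OF f]] by auto
  from fg have "AE x in lborel. g x = f x" by eventually_elim simp
  then have eq: "AE x in lebesgue. g x = f x" by (rule AE_completion)
  have gL: "g \<in> L2 lebesgue"
    by (rule L2_cong_AE[OF f measurable_completion[OF g] eq])
  obtain s where s: "\<And>n. simple_function lborel (s n)" "\<And>x. (\<lambda>n. s n x) \<longlonglongrightarrow> g x"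
    "\<And>n x. \<bar>s n x\<bar> \<le> 2 * \<bar>g x\<bar>"
    using borel_measurable_implies_sequence_metric[OF g, of 0] by (auto simp: dist_real_def)
  have sm: "s n \<in> borel_measurable lebesgue" for n
    using borel_measurable_simple_function[OF s(1)] by (rule measurable_completion)
  have "approx_by_test (s n)" for n
  proof -
    have "s n = (\<lambda>x. \<Sum>y\<in>range (s n). y * indicator (s n -` {y}) x)"
    proof
      fix x
      have "s n x = (\<Sum>y\<in>s n ` space lborel. indicator (s n -` {y} \<inter> space lborel) x *\<^sub>R y)"
        by (rule simple_function_indicator_representation_banach[OF s(1)]) simp
      also have "\<dots> = (\<Sum>y\<in>range (s n). y * indicator (s n -` {y}) x)"
        by (intro sum.cong) (simp_all add: mult.commute)
      finally show "s n x = (\<Sum>y\<in>range (s n). y * indicator (s n -` {y}) x)" .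
    qed
    moreover have "approx_by_test (\<lambda>x. y * indicator (s n -` {y}) x)" if "y \<in> range (s n)" for y
    proof (cases "y = 0")
      case True
      then show ?thesis using approx_by_test_test[OF zero_test_function] by simp
    next
      case False
      have A: "s n -` {y} \<in> sets borel"
        using simple_functionD(2)[OF s(1)[of n], of "{y}"] by simp
      \<comment> \<open>On the level set of y one has |y| <= 2 |g|, so its indicator is dominated by
        2/|y| times |g|, which requires y to be nonzero.\<close>
      have "indicat_real (s n -` {y}) \<in> L2 lebesgue"
      proof (rule L2_dominated[OF L2_cmult[OF gL, of "2 / \<bar>y\<bar>"]])
        show "indicat_real (s n -` {y}) \<in> borel_measurable lebesgue"
          using A by (intro borel_measurable_indicator) auto
        show "AE x in lebesgue. \<bar>indicator (s n -` {y}) x\<bar> \<le> \<bar>2 / \<bar>y\<bar> * g x\<bar>"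
          using s(3)[of n] False by (intro AE_I2) (auto simp: indicator_def abs_mult divide_simps)
      qed
      from approx_by_test_cmult[OF approx_by_test_indicator[OF A this]] show ?thesis .
    qed
    then have "approx_by_test (\<lambda>x. \<Sum>y\<in>range (s n). y * indicator (s n -` {y}) x)"
      by (rule approx_by_test_sum)
    ultimately show ?thesis by (simp only:)
  qed
  moreover have "L2_tendsto lebesgue s g sequentially"
    by (rule L2_dominated_convergence[where h = "\<lambda>x. 2 * \<bar>g x\<bar>"])
      (use s gL sm in \<open>auto simp: L2_real_iff power_mult_distrib\<close>)
  ultimately have "approx_by_test g" by (intro approx_by_test_limit[OF gL])
  then obtain \<phi> where \<phi>: "\<phi> \<in> test_functions UNIV" "L2_norm lebesgue (\<lambda>x. g x - \<phi> x) < e"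
    using \<open>e > 0\<close> by (auto simp: approx_by_test_def)
  moreover have "L2_norm lebesgue (\<lambda>x. f x - \<phi> x) = L2_norm lebesgue (\<lambda>x. g x - \<phi> x)"
    using eq by (intro L2_norm_cong_AE)
      (use L2_diff[OF f test_function_L2[OF \<phi>(1)]] L2_diff[OF gL test_function_L2[OF \<phi>(1)]] L2_measurable in auto)
  ultimately show ?thesis using that by simp
qed

section \<open>Weak derivatives and translations\<close>

text \<open>A translation is the affine map whose scaling factors all equal 1.\<close>

lemma lebesgue_distr_plus: "distr lebesgue lebesgue (\<lambda>x. a + x) = (lebesgue :: 'a::euclidean_space measure)"
  and lebesgue_measurable_plus: "(\<lambda>x. a + x) \<in> lebesgue \<rightarrow>\<^sub>M (lebesgue :: 'a::euclidean_space measure)"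
proof -
  have eq: "(\<lambda>x. a + (\<Sum>j\<in>Basis. (1 * (x \<bullet> j)) *\<^sub>R j)) = (\<lambda>x. a + x)"
    by (simp add: euclidean_representation)
  show "distr lebesgue lebesgue (\<lambda>x. a + x) = (lebesgue :: 'a measure)"
    using lebesgue_affine_euclidean[of "\<lambda>_. 1" a] unfolding eq by (simp add: density_1)
  show "(\<lambda>x. a + x) \<in> lebesgue \<rightarrow>\<^sub>M (lebesgue :: 'a measure)"
    using lebesgue_affine_measurable[of "\<lambda>_. 1" a] unfolding eq by simp
qed

lemma
  fixes f :: "'a::euclidean_space \<Rightarrow> real"
  assumes "f \<in> borel_measurable lebesgue"
  shows lebesgue_integral_shift: "(\<integral>x. f (a + x) \<partial>lebesgue) = (\<integral>x. f x \<partial>lebesgue)"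
    and lebesgue_integrable_shift: "integrable lebesgue (\<lambda>x. f (a + x)) \<longleftrightarrow> integrable lebesgue f"
    and lebesgue_measurable_shift: "(\<lambda>x. f (a + x)) \<in> borel_measurable lebesgue"
proof -
  show "(\<integral>x. f (a + x) \<partial>lebesgue) = (\<integral>x. f x \<partial>lebesgue)"
    using integral_distr[OF lebesgue_measurable_plus assms, of a] by (simp add: lebesgue_distr_plus)
  show "integrable lebesgue (\<lambda>x. f (a + x)) \<longleftrightarrow> integrable lebesgue f"
    using integrable_distr_eq[OF lebesgue_measurable_plus assms, of a] by (simp add: lebesgue_distr_plus)
  show "(\<lambda>x. f (a + x)) \<in> borel_measurable lebesgue"
    by (rule measurable_compose[OF lebesgue_measurable_plus assms])
qed

lemma
  fixes f :: "'a::euclidean_space \<Rightarrow> real"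
  assumes "f \<in> L2 lebesgue"
  shows L2_shift: "(\<lambda>x. f (a + x)) \<in> L2 lebesgue"
    and L2_norm_shift: "L2_norm lebesgue (\<lambda>x. f (a + x)) = L2_norm lebesgue f"
proof -
  have m: "(\<lambda>x. (f x)\<^sup>2) \<in> borel_measurable lebesgue" using L2_measurable[OF assms] by measurable
  show "(\<lambda>x. f (a + x)) \<in> L2 lebesgue"
    using assms lebesgue_integrable_shift[OF m, of a] lebesgue_measurable_shift[of f a] by (simp add: L2_real_iff)
  show "L2_norm lebesgue (\<lambda>x. f (a + x)) = L2_norm lebesgue f"
    using lebesgue_integral_shift[OF m, of a] by (simp add: L2_norm_def)
qed

text \<open>A test function \<psi> near f gives |f|^2 = (f - \<psi>, f) + (f, \<psi>) <= K |f| + e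
  for every e > 0, whence |f| <= K. This is the dual description of the norm with the supremum
  restricted to a dense set.\<close>

lemma L2_norm_le_of_test_bound:
  fixes f :: "'a::euclidean_space \<Rightarrow> real"
  assumes f: "f \<in> L2 lebesgue" and "K \<ge> 0"
    and bound: "\<And>\<psi>. \<psi> \<in> test_functions UNIV \<Longrightarrow> \<bar>L2_inner lebesgue f \<psi>\<bar> \<le> K * L2_norm lebesgue \<psi>"
  shows "L2_norm lebesgue f \<le> K"
proof -
  let ?n = "L2_norm lebesgue f"
  have "?n\<^sup>2 \<le> K * ?n + e" if "e > 0" for e
  proof -
    \<comment> \<open>The total error is the distance of f to \<psi> times |f| + K; the extra 1
      keeps the denominator positive.\<close>
    have "e / (?n + K + 1) > 0" using that \<open>K \<ge> 0\<close> by (simp add: add_nonneg_pos)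
    then obtain \<psi> where \<psi>: "\<psi> \<in> test_functions UNIV" "L2_norm lebesgue (\<lambda>x. f x - \<psi> x) < e / (?n + K + 1)"
      using test_functions_dense_L2[OF f] by metis
    note \<psi>L = test_function_L2[OF \<psi>(1)]
    let ?d = "L2_norm lebesgue (\<lambda>x. f x - \<psi> x)"
    have z: "(\<lambda>x. 0::real) \<in> L2 lebesgue" by (simp add: L2_real_iff)
    have "L2_norm lebesgue (\<lambda>x. \<psi> x - f x) = ?d"
      unfolding L2_norm_def by (simp add: power2_commute)
    then have "L2_norm lebesgue \<psi> \<le> ?n + ?d" using L2_norm_triangle[OF \<psi>L f z] by simp
    then have "K * L2_norm lebesgue \<psi> \<le> K * (?n + ?d)" using \<open>K \<ge> 0\<close> by (rule mult_left_mono)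
    moreover have "?n\<^sup>2 = L2_inner lebesgue (\<lambda>x. f x - \<psi> x) f + L2_inner lebesgue f \<psi>"
      using L2_inner_diff_left[OF f \<psi>L f] by (simp add: L2_inner_same L2_inner_commute[of _ \<psi> f])
    moreover have "L2_inner lebesgue (\<lambda>x. f x - \<psi> x) f \<le> ?d * ?n"
      using L2_Cauchy_Schwarz[OF L2_diff[OF f \<psi>L] f] by linarith
    ultimately have "?n\<^sup>2 \<le> K * ?n + ?d * (?n + K)"
      using bound[OF \<psi>(1)] by (simp add: algebra_simps)
    also have "?d * (?n + K) \<le> ?d * (?n + K + 1)" by (intro mult_left_mono) auto
    also have "\<dots> \<le> e" using \<psi>(2) \<open>K \<ge> 0\<close> by (simp add: pos_less_divide_eq add_nonneg_pos)
    finally show ?thesis by simp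
  qed
  then have "?n\<^sup>2 \<le> K * ?n" by (rule field_le_epsilon)
  then show ?thesis using L2_norm_nonneg[of lebesgue f] \<open>K \<ge> 0\<close>
    by (cases "?n = 0") (simp_all add: power2_eq_square)
qed

text \<open>Uniform boundedness promotes convergence against a dense set to convergence against
  every f: replacing f by a nearby test function costs at most (K + |g|) times the distance,
  uniformly in n.\<close>

lemma L2_weak_convergence:
  fixes s :: "nat \<Rightarrow> 'a::euclidean_space \<Rightarrow> real"
  assumes s: "\<And>n. s n \<in> L2 lebesgue" "\<And>n. L2_norm lebesgue (s n) \<le> K" and g: "g \<in> L2 lebesgue"
    and conv: "\<And>\<psi>. \<psi> \<in> test_functions UNIV \<Longrightarrow> (\<lambda>n. L2_inner lebesgue (s n) \<psi>) \<longlonglongrightarrow> L2_inner lebesgue g \<psi>"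
    and f: "f \<in> L2 lebesgue"
  shows "(\<lambda>n. L2_inner lebesgue (s n) f) \<longlonglongrightarrow> L2_inner lebesgue g f"
proof (rule LIMSEQ_I)
  fix r :: real assume "r > 0"
  let ?K = "K + L2_norm lebesgue g + 1"
  have "K \<ge> 0" using s(2)[of 0] L2_norm_nonneg[of lebesgue "s 0"] by linarith
  then have K: "?K > 0" using L2_norm_nonneg[of lebesgue g] by linarith
  obtain \<psi> where \<psi>: "\<psi> \<in> test_functions UNIV" "L2_norm lebesgue (\<lambda>x. f x - \<psi> x) < r / (2 * ?K)"
    using test_functions_dense_L2[OF f, of "r / (2 * ?K)"] K \<open>r > 0\<close> by auto
  note \<psi>L = test_function_L2[OF \<psi>(1)]
  let ?d = "L2_norm lebesgue (\<lambda>x. f x - \<psi> x)"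
  obtain n0 where n0: "\<And>n. n \<ge> n0 \<Longrightarrow> norm (L2_inner lebesgue (s n) \<psi> - L2_inner lebesgue g \<psi>) < r / 2"
    using LIMSEQ_D[OF conv[OF \<psi>(1)], of "r / 2"] \<open>r > 0\<close> by auto
  have split: "L2_inner lebesgue h f = L2_inner lebesgue h (\<lambda>x. f x - \<psi> x) + L2_inner lebesgue h \<psi>"
    if "h \<in> L2 lebesgue" for h
    using L2_inner_diff_left[OF f \<psi>L that] by (simp add: L2_inner_commute[of _ h])
  have "norm (L2_inner lebesgue (s n) f - L2_inner lebesgue g f) < r" if "n \<ge> n0" for n
  proof -
    have "\<bar>L2_inner lebesgue (s n) (\<lambda>x. f x - \<psi> x)\<bar> \<le> K * ?d"
      using L2_Cauchy_Schwarz[OF s(1) L2_diff[OF f \<psi>L], of n] mult_right_mono[OF s(2)[of n], of ?d] by simp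
    moreover have "\<bar>L2_inner lebesgue g (\<lambda>x. f x - \<psi> x)\<bar> \<le> L2_norm lebesgue g * ?d"
      by (rule L2_Cauchy_Schwarz[OF g L2_diff[OF f \<psi>L]])
    moreover have "(K + L2_norm lebesgue g) * ?d \<le> ?K * ?d" by (intro mult_right_mono) auto
    moreover have "?K * ?d < r / 2" using \<psi>(2) K by (simp add: pos_less_divide_eq) (simp add: algebra_simps)
    moreover have "?d \<ge> 0" by simp
    ultimately show ?thesis
      using n0[OF that] unfolding split[OF s(1)] split[OF g] real_norm_def distrib_right by linarith
  qed
  then show "\<exists>no. \<forall>n\<ge>no. norm (L2_inner lebesgue (s n) f - L2_inner lebesgue g f) < r" by blast
qed

lemma L2_bounded_support_integrable:
  fixes w :: "'a::euclidean_space \<Rightarrow> real"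
  assumes "w \<in> L2 lebesgue" "\<And>x. norm x > R \<Longrightarrow> w x = 0"
  shows "integrable lebesgue w"
proof -
  have "indicat_real (cball (0::'a) R) \<in> L2 lebesgue"
  proof -
    have "integrable lebesgue (indicat_real (cball (0::'a) R))"
      using emeasure_lborel_cball_finite[of "0::'a" R] by (intro integrable_real_indicator) auto
    moreover have "(\<lambda>x. (indicat_real (cball (0::'a) R) x)\<^sup>2) = indicat_real (cball 0 R)"
      by (auto simp: indicator_def)
    ultimately have "integrable lebesgue (\<lambda>x. (indicat_real (cball (0::'a) R) x)\<^sup>2)" by (simp only:)
    then show ?thesis by (simp add: L2_real_iff borel_measurable_indicator)
  qed
  from L2_integrable_mult[OF this assms(1)]
  have "integrable lebesgue (\<lambda>x. indicator (cball 0 R) x * w x)" .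
  moreover have "(\<lambda>x. indicator (cball 0 R) x * w x) = w"
    using assms(2) by (force simp: indicator_def)
  ultimately show ?thesis by (simp only:)
qed

section \<open>Difference quotients and differentiation under the integral sign\<close>

lemma smooth_directional_derivative:
  assumes "smooth \<psi>" "j \<in> Basis"
  shows "((\<lambda>h. \<psi> (x + h *\<^sub>R j)) has_real_derivative partial_deriv j \<psi> (x + s *\<^sub>R j)) (at s)"
proof -
  have "((\<lambda>h. x + h *\<^sub>R j) has_derivative (\<lambda>h. h *\<^sub>R j)) (at s)" by (auto intro!: derivative_eq_intros)
  from has_derivative_compose[OF this smooth_has_derivative_grad[OF assms(1)]]
  have "((\<lambda>h. \<psi> (x + h *\<^sub>R j)) has_derivative (\<lambda>h. partial_deriv j \<psi> (x + s *\<^sub>R j) * h)) (at s)"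
    using assms(2) by (simp add: grad_inner_Basis mult.commute)
  then show ?thesis by (simp add: has_field_derivative_def)
qed

lemma test_difference_quotient_bound:
  assumes "\<psi> \<in> test_functions UNIV" "j \<in> Basis"
  obtains B where "B > 0" "\<And>x h. \<bar>\<psi> (x + h *\<^sub>R j) - \<psi> x\<bar> \<le> B * \<bar>h\<bar>"
proof -
  obtain B where B: "B > 0" "\<And>x. \<bar>partial_deriv j \<psi> x\<bar> \<le> B"
    using test_function_bounded[OF test_functions_partial_deriv[OF assms]] by blast
  have "\<bar>\<psi> (x + h *\<^sub>R j) - \<psi> x\<bar> \<le> B * \<bar>h\<bar>" for x h
    using field_differentiable_bound[of UNIV "\<lambda>h. \<psi> (x + h *\<^sub>R j)" "\<lambda>s. partial_deriv j \<psi> (x + s *\<^sub>R j)" B h 0]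
      smooth_directional_derivative[OF test_functionsD(1)[OF assms(1)] assms(2)] B(2) by simp
  with B(1) show ?thesis using that by blast
qed

text \<open>The mean value theorem bounds the difference quotients of \<psi> by a constant B
  uniformly in x, so B |w| dominates the integrands and the limit passes under the integral.\<close>

lemma shifted_integral_has_derivative:
  fixes w :: "'a::euclidean_space \<Rightarrow> real"
  assumes w: "integrable lebesgue w" and \<psi>: "\<psi> \<in> test_functions UNIV" and j: "j \<in> Basis"
  shows "((\<lambda>h. \<integral>x. w x * \<psi> (x + h *\<^sub>R j) \<partial>lebesgue) has_real_derivative
    (\<integral>x. w x * partial_deriv j \<psi> x \<partial>lebesgue)) (at 0)"
proof -
  obtain B where B: "B > 0" "\<And>x h. \<bar>\<psi> (x + h *\<^sub>R j) - \<psi> x\<bar> \<le> B * \<bar>h\<bar>"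
    using test_difference_quotient_bound[OF \<psi> j] by blast
  have wm: "w \<in> borel_measurable lebesgue" using w by auto
  have \<psi>m: "(\<lambda>x. \<psi> (x + a)) \<in> borel_measurable lebesgue" for a
    by (rule test_function_lebesgue[OF test_functions_shift[OF \<psi>]])
  have int: "integrable lebesgue (\<lambda>x. w x * \<psi> (x + a))" for a
  proof -
    obtain C where C: "\<And>x. \<bar>\<psi> x\<bar> \<le> C" using test_function_bounded[OF \<psi>] by blast
    show ?thesis
    proof (rule Bochner_Integration.integrable_bound)
      show "integrable lebesgue (\<lambda>x. C * w x)" using w by simp
      show "AE x in lebesgue. norm (w x * \<psi> (x + a)) \<le> norm (C * w x)"
      proof (rule AE_I2)
        fix x
        have "\<bar>w x\<bar> * \<bar>\<psi> (x + a)\<bar> \<le> \<bar>w x\<bar> * \<bar>C\<bar>"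
          by (intro mult_left_mono order_trans[OF C abs_ge_self]) simp
        then show "norm (w x * \<psi> (x + a)) \<le> norm (C * w x)" by (simp add: abs_mult mult.commute)
      qed
    qed (intro borel_measurable_times wm \<psi>m)
  qed
  have "((\<lambda>h. ((\<integral>x. w x * \<psi> (x + (0 + h) *\<^sub>R j) \<partial>lebesgue) - (\<integral>x. w x * \<psi> (x + 0 *\<^sub>R j) \<partial>lebesgue)) / h) \<longlongrightarrow>
    (\<integral>x. w x * partial_deriv j \<psi> x \<partial>lebesgue)) (at 0)"
    unfolding tendsto_at_iff_sequentially
  proof (intro allI impI)
    fix X :: "nat \<Rightarrow> real" assume X: "\<forall>i. X i \<in> UNIV - {0}" "X \<longlonglongrightarrow> 0"
    have "(\<lambda>n. \<integral>x. w x * ((\<psi> (x + X n *\<^sub>R j) - \<psi> x) / X n) \<partial>lebesgue) \<longlonglongrightarrow> (\<integral>x. w x * partial_deriv j \<psi> x \<partial>lebesgue)"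
    proof (rule integral_dominated_convergence)
      show "integrable lebesgue (\<lambda>x. B * \<bar>w x\<bar>)" using w by auto
      show "AE x in lebesgue. (\<lambda>n. w x * ((\<psi> (x + X n *\<^sub>R j) - \<psi> x) / X n)) \<longlonglongrightarrow> w x * partial_deriv j \<psi> x"
      proof (intro AE_I2 tendsto_intros)
        fix x
        have "(\<lambda>h. (\<psi> (x + h *\<^sub>R j) - \<psi> x) / h) \<midarrow>0\<rightarrow> partial_deriv j \<psi> x"
          using smooth_directional_derivative[OF test_functionsD(1)[OF \<psi>] j, of x 0]
          by (simp add: has_field_derivative_iff)
        from this[unfolded tendsto_at_iff_sequentially, rule_format, of X] X
        show "(\<lambda>n. (\<psi> (x + X n *\<^sub>R j) - \<psi> x) / X n) \<longlonglongrightarrow> partial_deriv j \<psi> x"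
          by (auto simp: comp_def)
      qed
      show "AE x in lebesgue. norm (w x * ((\<psi> (x + X n *\<^sub>R j) - \<psi> x) / X n)) \<le> B * \<bar>w x\<bar>" for n
      proof (rule AE_I2)
        fix x
        have "\<bar>(\<psi> (x + X n *\<^sub>R j) - \<psi> x) / X n\<bar> \<le> B"
          using B(2)[of x "X n"] X(1) by (simp add: pos_divide_le_eq)
        then show "norm (w x * ((\<psi> (x + X n *\<^sub>R j) - \<psi> x) / X n)) \<le> B * \<bar>w x\<bar>"
          unfolding real_norm_def abs_mult by (metis abs_ge_zero mult.commute mult_right_mono)
      qed
      show "(\<lambda>x. w x * partial_deriv j \<psi> x) \<in> borel_measurable lebesgue"
        by (intro borel_measurable_times wm test_function_lebesgue[OF test_functions_partial_deriv[OF \<psi> j]])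
      show "(\<lambda>x. w x * ((\<psi> (x + X n *\<^sub>R j) - \<psi> x) / X n)) \<in> borel_measurable lebesgue" for n
        by (intro borel_measurable_times borel_measurable_divide borel_measurable_diff wm \<psi>m
            test_function_lebesgue[OF \<psi>] borel_measurable_const)
    qed
    moreover have "(\<integral>x. w x * ((\<psi> (x + X n *\<^sub>R j) - \<psi> x) / X n) \<partial>lebesgue) =
      ((\<integral>x. w x * \<psi> (x + (0 + X n) *\<^sub>R j) \<partial>lebesgue) - (\<integral>x. w x * \<psi> (x + 0 *\<^sub>R j) \<partial>lebesgue)) / X n" for n
    proof -
      have "(\<integral>x. w x * ((\<psi> (x + X n *\<^sub>R j) - \<psi> x) / X n) \<partial>lebesgue) =
        (\<integral>x. (w x * \<psi> (x + X n *\<^sub>R j) - w x * \<psi> (x + 0)) / X n \<partial>lebesgue)"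
        by (intro Bochner_Integration.integral_cong) (auto simp: right_diff_distrib)
      also have "\<dots> = (\<integral>x. w x * \<psi> (x + X n *\<^sub>R j) - w x * \<psi> (x + 0) \<partial>lebesgue) / X n"
        by (rule integral_divide_zero)
      also have "\<dots> = ((\<integral>x. w x * \<psi> (x + X n *\<^sub>R j) \<partial>lebesgue) - (\<integral>x. w x * \<psi> (x + 0) \<partial>lebesgue)) / X n"
        by (simp only: Bochner_Integration.integral_diff[OF int int])
      finally show ?thesis by simp
    qed
    ultimately show "((\<lambda>h. ((\<integral>x. w x * \<psi> (x + (0 + h) *\<^sub>R j) \<partial>lebesgue) - (\<integral>x. w x * \<psi> (x + 0 *\<^sub>R j) \<partial>lebesgue)) / h) \<circ> X)
       \<longlonglongrightarrow> (\<integral>x. w x * partial_deriv j \<psi> x \<partial>lebesgue)"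
      unfolding comp_def by (simp only:)
  qed
  then show ?thesis by (simp add: DERIV_def)
qed

text \<open>Formally, the integral of w^2 = w^2 d_j x_j equals -2 times that of x_j w d_j w. Without
  a product rule for w^2, \<open>\<delta> h\<close> replaces the derivative: translation invariance
  gives an exact identity for each h, with remainder h times the integral of x_j
  (\<open>\<delta> h\<close>)^2. The remainder vanishes because the difference quotients are bounded
  in L2 by |g| and live on a bounded set, and the main term converges because they converge
  weakly.\<close>

theorem integral_square_eq_radial:
  fixes w g :: "'a::euclidean_space \<Rightarrow> real"
  assumes w: "w \<in> L2 lebesgue" and g: "g \<in> L2 lebesgue" and j: "j \<in> Basis"
    and weak: "\<And>\<psi>. \<psi> \<in> test_functions UNIV \<Longrightarrow>
      (\<integral>x. g x * \<psi> x \<partial>lebesgue) = - (\<integral>x. w x * partial_deriv j \<psi> x \<partial>lebesgue)"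
    and supp: "\<And>x. norm x > R \<Longrightarrow> w x = 0"
  shows "(\<integral>x. (w x)\<^sup>2 \<partial>lebesgue) = - 2 * (\<integral>x. g x * (x \<bullet> j) * w x \<partial>lebesgue)"
proof -
  \<comment> \<open>Translating w by -h puts +h on the test function after a change of variables.
    Inner products with \<open>\<delta> h\<close> are then difference quotients of h -> (w, \<psi>(.
    + h j)), so the weak limit is -g.\<close>
  define \<delta> where "\<delta> = (\<lambda>h x. (w (x + (- h) *\<^sub>R j) - w x) / h)"
  have wm: "w \<in> borel_measurable lebesgue" by (rule L2_measurable[OF w])
  have wint: "integrable lebesgue w" by (rule L2_bounded_support_integrable[OF w supp])
  have wsh: "(\<lambda>x. w (x + a)) \<in> L2 lebesgue" for a using L2_shift[OF w, of a] by (simp add: add.commute)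
  have \<delta>L: "\<delta> h \<in> L2 lebesgue" for h
    using L2_cmult[OF L2_diff[OF wsh[of "(- h) *\<^sub>R j"] w], of "1 / h"] by (simp add: \<delta>_def)
  have D: "((\<lambda>h. \<integral>x. w x * \<psi> (x + h *\<^sub>R j) \<partial>lebesgue) has_real_derivative - (\<integral>x. g x * \<psi> (x + s *\<^sub>R j) \<partial>lebesgue)) (at s)"
    if \<psi>: "\<psi> \<in> test_functions UNIV" for \<psi> s
  proof -
    note \<psi>s = test_functions_shift[OF \<psi>, of "s *\<^sub>R j"]
    have "((\<lambda>h. \<integral>x. w x * \<psi> (x + (h + s) *\<^sub>R j) \<partial>lebesgue) has_real_derivative - (\<integral>x. g x * \<psi> (x + s *\<^sub>R j) \<partial>lebesgue)) (at 0)"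
      using shifted_integral_has_derivative[OF wint \<psi>s j] weak[OF \<psi>s] by (simp add: algebra_simps)
    then show ?thesis using DERIV_shift[of _ _ 0 s] by simp
  qed
  have inner_\<delta>: "L2_inner lebesgue (\<delta> h) \<psi> =
      ((\<integral>x. w x * \<psi> (x + h *\<^sub>R j) \<partial>lebesgue) - (\<integral>x. w x * \<psi> (x + 0 *\<^sub>R j) \<partial>lebesgue)) / h"
    if \<psi>: "\<psi> \<in> test_functions UNIV" for \<psi> h
  proof -
    note \<psi>L = test_function_L2[OF \<psi>]
    have "(\<integral>x. w (x + (- h) *\<^sub>R j) * \<psi> x \<partial>lebesgue) = (\<integral>x. w x * \<psi> (x + h *\<^sub>R j) \<partial>lebesgue)"
      using lebesgue_integral_shift[of "\<lambda>x. w x * \<psi> (x + h *\<^sub>R j)" "(- h) *\<^sub>R j"]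
        wm test_function_lebesgue[OF test_functions_shift[OF \<psi>]]
      by (simp add: algebra_simps)
    moreover have "L2_inner lebesgue (\<delta> h) \<psi> =
        ((\<integral>x. w (x + (- h) *\<^sub>R j) * \<psi> x \<partial>lebesgue) - (\<integral>x. w x * \<psi> x \<partial>lebesgue)) / h"
    proof -
      have "L2_inner lebesgue (\<delta> h) \<psi> = (\<integral>x. (w (x + (- h) *\<^sub>R j) * \<psi> x - w x * \<psi> x) / h \<partial>lebesgue)"
        unfolding L2_inner_def \<delta>_def
        by (intro Bochner_Integration.integral_cong) (auto simp: left_diff_distrib)
      also have "\<dots> = (\<integral>x. w (x + (- h) *\<^sub>R j) * \<psi> x - w x * \<psi> x \<partial>lebesgue) / h"
        by (rule integral_divide_zero)
      finally show ?thesis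
        by (simp only: Bochner_Integration.integral_diff[OF L2_integrable_mult[OF wsh \<psi>L] L2_integrable_mult[OF w \<psi>L]])
    qed
    ultimately show ?thesis by simp
  qed
  \<comment> \<open>The mean value theorem in the translation parameter rewrites the inner product
    as -(g, \<psi>(. + s j)) for some s, and translations preserve the norm of \<psi>.\<close>
  have bound: "L2_norm lebesgue (\<delta> h) \<le> L2_norm lebesgue g" if hpos: "h > 0" for h
  proof (rule L2_norm_le_of_test_bound[OF \<delta>L L2_norm_nonneg])
    fix \<psi> :: "'a \<Rightarrow> real" assume \<psi>: "\<psi> \<in> test_functions UNIV"
    note \<psi>L = test_function_L2[OF \<psi>]
    have sh: "(\<lambda>x. \<psi> (x + s *\<^sub>R j)) \<in> L2 lebesgue" "L2_norm lebesgue (\<lambda>x. \<psi> (x + s *\<^sub>R j)) = L2_norm lebesgue \<psi>" for s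
      using L2_shift[OF \<psi>L, of "s *\<^sub>R j"] L2_norm_shift[OF \<psi>L, of "s *\<^sub>R j"] by (simp_all add: add.commute)
    obtain s where "(\<integral>x. w x * \<psi> (x + h *\<^sub>R j) \<partial>lebesgue) - (\<integral>x. w x * \<psi> (x + 0 *\<^sub>R j) \<partial>lebesgue) =
        (h - 0) * (- (\<integral>x. g x * \<psi> (x + s *\<^sub>R j) \<partial>lebesgue))"
      using MVT2[OF hpos D[OF \<psi>]] by blast
    then have "\<bar>L2_inner lebesgue (\<delta> h) \<psi>\<bar> = \<bar>L2_inner lebesgue g (\<lambda>x. \<psi> (x + s *\<^sub>R j))\<bar>"
      using hpos unfolding inner_\<delta>[OF \<psi>] by (simp add: L2_inner_def[of _ g])
    also have "\<dots> \<le> L2_norm lebesgue g * L2_norm lebesgue \<psi>"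
      using L2_Cauchy_Schwarz[OF g sh(1)] by (simp add: sh(2))
    finally show "\<bar>L2_inner lebesgue (\<delta> h) \<psi>\<bar> \<le> L2_norm lebesgue g * L2_norm lebesgue \<psi>" .
  qed
  define e where "e = (\<lambda>n. 1 / real (Suc n))"
  have e: "e n > 0" "e n \<le> 1" for n by (auto simp: e_def)
  have e0: "e \<longlonglongrightarrow> 0" unfolding e_def using LIMSEQ_inverse_real_of_nat by (simp add: inverse_eq_divide)
  define f where "f = (\<lambda>x. (x \<bullet> j) * w x)"
  have coord: "\<bar>x \<bullet> j\<bar> \<le> norm x" for x using Basis_le_norm[OF j] .
  have cm: "(\<lambda>x. x \<bullet> j) \<in> borel_measurable lebesgue"
    by (rule measurable_completion) auto
  have R0: "norm x \<le> R" if "w x \<noteq> 0" for x using supp[of x] that by force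
  have fL: "f \<in> L2 lebesgue"
  proof (rule L2_dominated[OF L2_cmult[OF w, of R]])
    show "AE x in lebesgue. \<bar>f x\<bar> \<le> \<bar>R * w x\<bar>"
    proof (rule AE_I2)
      fix x
      show "\<bar>f x\<bar> \<le> \<bar>R * w x\<bar>"
        using coord[of x] R0[of x] by (cases "w x = 0") (auto simp: f_def abs_mult intro!: mult_right_mono)
    qed
  qed (auto simp: f_def intro!: borel_measurable_times cm wm)
  have lim: "(\<lambda>n. L2_inner lebesgue (\<delta> (e n)) f) \<longlonglongrightarrow> L2_inner lebesgue (\<lambda>x. - g x) f"
  proof (rule L2_weak_convergence[OF \<delta>L bound[OF e(1)] _ _ fL])
    show "(\<lambda>x. - g x) \<in> L2 lebesgue" using L2_cmult[OF g, of "-1"] by simp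
    fix \<psi> :: "'a \<Rightarrow> real" assume \<psi>: "\<psi> \<in> test_functions UNIV"
    have "((\<lambda>h. L2_inner lebesgue (\<delta> h) \<psi>) \<longlongrightarrow> - (\<integral>x. g x * \<psi> x \<partial>lebesgue)) (at 0)"
      using D[OF \<psi>, of 0] unfolding inner_\<delta>[OF \<psi>] by (simp add: has_field_derivative_iff)
    from this[unfolded tendsto_at_iff_sequentially, rule_format, of e]
    show "(\<lambda>n. L2_inner lebesgue (\<delta> (e n)) \<psi>) \<longlonglongrightarrow> L2_inner lebesgue (\<lambda>x. - g x) \<psi>"
      using e(1) e0 by (simp add: comp_def L2_inner_def less_imp_neq[symmetric])
  qed
  define q where "q = (\<lambda>h x. (x \<bullet> j) * (\<delta> h x)\<^sup>2)"
  \<comment> \<open>Both w and its translate by at most 1 vanish outside the ball of radius R +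
    1.\<close>
  have supp_\<delta>: "\<bar>x \<bullet> j\<bar> \<le> R + 1" if "\<delta> h x \<noteq> 0" "0 < h" "h \<le> 1" for h x
  proof (cases "w x = 0")
    case False
    then show ?thesis using R0[of x] coord[of x] by simp
  next
    case True
    then have "w (x + (- h) *\<^sub>R j) \<noteq> 0" using that by (simp add: \<delta>_def)
    then have "norm (x + (- h) *\<^sub>R j) \<le> R" by (rule R0)
    moreover have "norm x \<le> norm (x + (- h) *\<^sub>R j) + norm (h *\<^sub>R j)"
      using norm_triangle_ineq[of "x + (- h) *\<^sub>R j" "h *\<^sub>R j"] by simp
    moreover have "norm (h *\<^sub>R j) \<le> 1" using that j by simp
    ultimately show ?thesis using coord[of x] by linarith
  qed
  have \<delta>m: "\<delta> h \<in> borel_measurable lebesgue" for h by (rule L2_measurable[OF \<delta>L])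
  have q_bound: "\<bar>q h x\<bar> \<le> \<bar>(R + 1) * (\<delta> h x)\<^sup>2\<bar>" if "0 < h" "h \<le> 1" for h x
    using supp_\<delta>[of h x] that
    by (cases "\<delta> h x = 0") (auto simp: q_def abs_mult intro!: mult_right_mono)
  have q_int: "integrable lebesgue (q h)" if "0 < h" "h \<le> 1" for h
  proof (rule Bochner_Integration.integrable_bound)
    show "integrable lebesgue (\<lambda>x. (R + 1) * (\<delta> h x)\<^sup>2)" using \<delta>L[of h] by (simp add: L2_real_iff)
    show "q h \<in> borel_measurable lebesgue"
      unfolding q_def by (intro borel_measurable_times borel_measurable_power cm \<delta>m)
  qed (use q_bound[OF that] in auto)
  have q_le: "\<bar>\<integral>x. q h x \<partial>lebesgue\<bar> \<le> \<bar>R + 1\<bar> * (L2_norm lebesgue g)\<^sup>2" if "0 < h" "h \<le> 1" for h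
  proof -
    have "\<bar>\<integral>x. q h x \<partial>lebesgue\<bar> \<le> (\<integral>x. \<bar>R + 1\<bar> * (\<delta> h x)\<^sup>2 \<partial>lebesgue)"
    proof (rule integral_abs_bound[THEN order_trans], rule integral_mono)
      show "integrable lebesgue (\<lambda>x. \<bar>q h x\<bar>)" using q_int[OF that] by simp
      show "integrable lebesgue (\<lambda>x. \<bar>R + 1\<bar> * (\<delta> h x)\<^sup>2)" using \<delta>L[of h] by (simp add: L2_real_iff)
      show "\<bar>q h x\<bar> \<le> \<bar>R + 1\<bar> * (\<delta> h x)\<^sup>2" for x
        using q_bound[OF that, of x] by (simp add: abs_mult)
    qed
    also have "\<dots> = \<bar>R + 1\<bar> * (L2_norm lebesgue (\<delta> h))\<^sup>2" by (simp add: L2_norm_power2)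
    also have "\<dots> \<le> \<bar>R + 1\<bar> * (L2_norm lebesgue g)\<^sup>2"
      using bound[OF that(1)] by (intro mult_left_mono power_mono) auto
    finally show ?thesis .
  qed
  \<comment> \<open>Shifting \<open>?F\<close> by -h gives x_j w(x - h j)^2 with the same integral.
    Subtracting x_j w^2 leaves h times the integral of w^2 on one side; expanding w(x - h j) = w + h
    \<open>\<delta> h\<close> gives the other.\<close>
  have key: "(\<integral>x. (w x)\<^sup>2 \<partial>lebesgue) = 2 * L2_inner lebesgue (\<delta> h) f + h * (\<integral>x. q h x \<partial>lebesgue)"
    if "0 < h" "h \<le> 1" for h
  proof -
    have w2: "integrable lebesgue (\<lambda>x. (w x)\<^sup>2)" using w by (simp add: L2_real_iff)
    have cw2: "integrable lebesgue (\<lambda>x. (x \<bullet> j) * (w x)\<^sup>2)"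
      using L2_integrable_mult[OF fL w] by (simp add: f_def power2_eq_square mult.assoc)
    let ?F = "\<lambda>x. (x \<bullet> j + h) * (w x)\<^sup>2"
    have Fi: "integrable lebesgue ?F" using cw2 w2 by (simp add: distrib_right)
    have jj: "j \<bullet> j = 1" using j by (simp add: inner_same_Basis)
    have eq: "?F ((- h) *\<^sub>R j + x) = (x \<bullet> j) * (w (x + (- h) *\<^sub>R j))\<^sup>2" for x
      by (simp add: inner_diff_left inner_add_left jj add.commute)
    have sh: "(\<integral>x. (x \<bullet> j) * (w (x + (- h) *\<^sub>R j))\<^sup>2 \<partial>lebesgue) = (\<integral>x. ?F x \<partial>lebesgue)"
      and shi: "integrable lebesgue (\<lambda>x. (x \<bullet> j) * (w (x + (- h) *\<^sub>R j))\<^sup>2)"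
      using lebesgue_integral_shift[of ?F "(- h) *\<^sub>R j"] lebesgue_integrable_shift[of ?F "(- h) *\<^sub>R j"] Fi
      unfolding eq by auto
    have "h * (\<integral>x. (w x)\<^sup>2 \<partial>lebesgue) = (\<integral>x. ?F x \<partial>lebesgue) - (\<integral>x. (x \<bullet> j) * (w x)\<^sup>2 \<partial>lebesgue)"
      using cw2 w2 by (simp add: distrib_right)
    also have "\<dots> = (\<integral>x. (x \<bullet> j) * (w (x + (- h) *\<^sub>R j))\<^sup>2 - (x \<bullet> j) * (w x)\<^sup>2 \<partial>lebesgue)"
      unfolding sh[symmetric] using shi cw2 by simp
    also have "\<dots> = (\<integral>x. 2 * h * (\<delta> h x * f x) + h * h * q h x \<partial>lebesgue)"
    proof (rule Bochner_Integration.integral_cong[OF refl])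
      fix x
      have "w (x + (- h) *\<^sub>R j) = w x + h * \<delta> h x" using that by (simp add: \<delta>_def)
      then show "(x \<bullet> j) * (w (x + (- h) *\<^sub>R j))\<^sup>2 - (x \<bullet> j) * (w x)\<^sup>2 = 2 * h * (\<delta> h x * f x) + h * h * q h x"
        unfolding f_def q_def by (simp add: power2_eq_square algebra_simps)
    qed
    also have "\<dots> = 2 * h * L2_inner lebesgue (\<delta> h) f + h * h * (\<integral>x. q h x \<partial>lebesgue)"
      using L2_integrable_mult[OF \<delta>L fL, of h] q_int[OF that] by (simp add: L2_inner_def)
    also have "\<dots> = h * (2 * L2_inner lebesgue (\<delta> h) f + h * (\<integral>x. q h x \<partial>lebesgue))"
      by (simp add: algebra_simps)
    finally show ?thesis using that(1) by simp
  qed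
  have "(\<lambda>n. e n * (\<integral>x. q (e n) x \<partial>lebesgue)) \<longlonglongrightarrow> 0"
  proof (rule Lim_null_comparison)
    show "(\<lambda>n. e n * (\<bar>R + 1\<bar> * (L2_norm lebesgue g)\<^sup>2)) \<longlonglongrightarrow> 0"
      using tendsto_mult_left_zero[OF e0] by simp
    show "\<forall>\<^sub>F n in sequentially. norm (e n * (\<integral>x. q (e n) x \<partial>lebesgue)) \<le> e n * (\<bar>R + 1\<bar> * (L2_norm lebesgue g)\<^sup>2)"
    proof (rule always_eventually, rule allI)
      fix n
      show "norm (e n * (\<integral>x. q (e n) x \<partial>lebesgue)) \<le> e n * (\<bar>R + 1\<bar> * (L2_norm lebesgue g)\<^sup>2)"
        using mult_left_mono[OF q_le[OF e], of "e n" n] e(1)[of n] by (simp add: abs_mult)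
    qed
  qed
  then have "(\<lambda>n. 2 * L2_inner lebesgue (\<delta> (e n)) f + e n * (\<integral>x. q (e n) x \<partial>lebesgue)) \<longlonglongrightarrow>
      2 * L2_inner lebesgue (\<lambda>x. - g x) f + 0"
    by (intro tendsto_add tendsto_mult tendsto_const lim)
  then have "(\<integral>x. (w x)\<^sup>2 \<partial>lebesgue) = 2 * L2_inner lebesgue (\<lambda>x. - g x) f"
    using LIMSEQ_unique[OF tendsto_const] unfolding key[OF e, symmetric] by simp
  then show ?thesis by (simp add: L2_inner_def f_def mult.assoc)
qed

section \<open>The radial identity\<close>

text \<open>Since \<open>m\<close> ranges over all test functions, the first two conditions say that \<open>U\<close> and \<open>G\<close> are
  locally square integrable.\<close>

definition whole_space_weak_gradient :: "('a::euclidean_space \<Rightarrow> real) \<Rightarrow> ('a \<Rightarrow> 'a) \<Rightarrow> bool" where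
  "whole_space_weak_gradient U G \<longleftrightarrow>
    (\<forall>m\<in>test_functions UNIV. (\<lambda>x. m x * U x) \<in> L2 lebesgue \<and>
      (\<forall>j\<in>Basis. (\<lambda>x. m x * (G x \<bullet> j)) \<in> L2 lebesgue \<and>
        (\<integral>x. (G x \<bullet> j) * m x \<partial>lebesgue) = - (\<integral>x. U x * partial_deriv j m x \<partial>lebesgue)))"

lemma grad_inner: "grad m x \<bullet> y = (\<Sum>j\<in>Basis. partial_deriv j m x * (y \<bullet> j))"
  unfolding grad_def inner_sum_left by (intro sum.cong) (simp_all add: inner_commute)

text \<open>The divergence theorem for the field m^2 U^2 x: the one-coordinate identity is applied
  to w = m U in each of the N directions and summed. The factor m makes w square integrable with
  bounded support.\<close>

lemma radial_identity_test:
  fixes U :: "'a::euclidean_space \<Rightarrow> real"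
  assumes UG: "whole_space_weak_gradient U G" and m: "m \<in> test_functions UNIV"
  shows "(\<integral>x. (U x)\<^sup>2 * (real DIM('a) * (m x)\<^sup>2 + 2 * m x * (grad m x \<bullet> x)) \<partial>lebesgue) =
      - 2 * (\<integral>x. (m x)\<^sup>2 * U x * (G x \<bullet> x) \<partial>lebesgue)"
proof -
  have UL: "(\<lambda>x. n x * U x) \<in> L2 lebesgue" if "n \<in> test_functions UNIV" for n
    using UG that by (auto simp: whole_space_weak_gradient_def)
  have GL: "(\<lambda>x. n x * (G x \<bullet> j)) \<in> L2 lebesgue" if "n \<in> test_functions UNIV" "j \<in> Basis" for n j
    using UG that by (auto simp: whole_space_weak_gradient_def)
  have weak: "(\<integral>x. (G x \<bullet> j) * n x \<partial>lebesgue) = - (\<integral>x. U x * partial_deriv j n x \<partial>lebesgue)"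
    if "n \<in> test_functions UNIV" "j \<in> Basis" for n j
    using UG that by (auto simp: whole_space_weak_gradient_def)
  have ms: "smooth m" using test_functionsD(1)[OF m] .
  have pd: "partial_deriv j m \<in> test_functions UNIV" if "j \<in> Basis" for j
    by (rule test_functions_partial_deriv[OF m that])
  define w where "w = (\<lambda>x. m x * U x)"
  have wL: "w \<in> L2 lebesgue" using UL[OF m] by (simp add: w_def)
  define g where "g = (\<lambda>j x. m x * (G x \<bullet> j) + partial_deriv j m x * U x)"
  have gL: "g j \<in> L2 lebesgue" if "j \<in> Basis" for j
    unfolding g_def by (intro L2_add GL UL m pd that)
  obtain R where R: "\<And>x. norm x > R \<Longrightarrow> w x = 0"
  proof -
    obtain R where "\<And>x. x \<in> closure {x. m x \<noteq> 0} \<Longrightarrow> norm x \<le> R"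
      using compact_imp_bounded[OF test_functionsD(2)[OF m]] by (auto simp: bounded_iff)
    then have "w x = 0" if "norm x > R" for x
      using that test_function_outside[of x m] unfolding w_def by force
    then show ?thesis using that by blast
  qed
  \<comment> \<open>The product rule for m U comes from testing the weak gradient of U with m
    \<psi>.\<close>
  have gweak: "(\<integral>x. g j x * \<psi> x \<partial>lebesgue) = - (\<integral>x. w x * partial_deriv j \<psi> x \<partial>lebesgue)"
    if j: "j \<in> Basis" and \<psi>: "\<psi> \<in> test_functions UNIV" for j \<psi>
  proof -
    note \<psi>s = test_functionsD(1)[OF \<psi>]
    have m\<psi>: "(\<lambda>x. m x * \<psi> x) \<in> test_functions UNIV" by (rule test_functions_mult[OF ms \<psi>])
    have i1: "integrable lebesgue (\<lambda>x. (m x * (G x \<bullet> j)) * \<psi> x)"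
      and i2: "integrable lebesgue (\<lambda>x. (partial_deriv j m x * U x) * \<psi> x)"
      by (intro L2_integrable_mult GL UL m pd test_function_L2[OF \<psi>] j)+
    have i3: "integrable lebesgue (\<lambda>x. w x * partial_deriv j \<psi> x)"
      by (intro L2_integrable_mult wL test_function_L2[OF test_functions_partial_deriv[OF \<psi> j]])
    have "(\<integral>x. g j x * \<psi> x \<partial>lebesgue) =
        (\<integral>x. (m x * (G x \<bullet> j)) * \<psi> x \<partial>lebesgue) + (\<integral>x. (partial_deriv j m x * U x) * \<psi> x \<partial>lebesgue)"
      unfolding g_def distrib_right by (rule Bochner_Integration.integral_add[OF i1 i2])
    also have "(\<integral>x. (m x * (G x \<bullet> j)) * \<psi> x \<partial>lebesgue) = - (\<integral>x. U x * partial_deriv j (\<lambda>x. m x * \<psi> x) x \<partial>lebesgue)"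
      using weak[OF m\<psi> j] by (simp add: mult_ac)
    also have "(\<integral>x. U x * partial_deriv j (\<lambda>x. m x * \<psi> x) x \<partial>lebesgue) =
        (\<integral>x. w x * partial_deriv j \<psi> x + (partial_deriv j m x * U x) * \<psi> x \<partial>lebesgue)"
      unfolding partial_deriv_mult[OF ms \<psi>s] w_def
      by (intro Bochner_Integration.integral_cong) (auto simp: algebra_simps)
    also have "\<dots> = (\<integral>x. w x * partial_deriv j \<psi> x \<partial>lebesgue) + (\<integral>x. (partial_deriv j m x * U x) * \<psi> x \<partial>lebesgue)"
      by (rule Bochner_Integration.integral_add[OF i3 i2])
    finally show ?thesis by simp
  qed
  have main: "(\<integral>x. (w x)\<^sup>2 \<partial>lebesgue) = - 2 * (\<integral>x. g j x * (x \<bullet> j) * w x \<partial>lebesgue)" if "j \<in> Basis" for j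
    by (rule integral_square_eq_radial[OF wL gL[OF that] that gweak[OF that] R])
  have coord: "smooth (\<lambda>x. x \<bullet> j)" for j :: 'a by (rule smooth_inner)
  have xm: "(\<lambda>x. (x \<bullet> j) * n x) \<in> test_functions UNIV" if "n \<in> test_functions UNIV" for j :: 'a and n
    by (rule test_functions_mult[OF coord that])
  have i1: "integrable lebesgue (\<lambda>x. (((x \<bullet> j) * m x) * (G x \<bullet> j)) * w x)"
    and i2: "integrable lebesgue (\<lambda>x. (((x \<bullet> j) * partial_deriv j m x) * U x) * w x)" if "j \<in> Basis" for j
    by (intro L2_integrable_mult GL UL wL xm m pd that)+
  have w2: "integrable lebesgue (\<lambda>x. (w x)\<^sup>2)" using wL by (simp add: L2_real_iff)
  have s1: "(\<Sum>j\<in>Basis. (((x \<bullet> j) * m x) * (G x \<bullet> j)) * w x) = (m x)\<^sup>2 * U x * (G x \<bullet> x)" for x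
    unfolding w_def euclidean_inner[of "G x" x] by (simp add: sum_distrib_left power2_eq_square mult_ac)
  have s2: "(\<Sum>j\<in>Basis. (((x \<bullet> j) * partial_deriv j m x) * U x) * w x) = (U x)\<^sup>2 * (m x * (grad m x \<bullet> x))" for x
    unfolding w_def grad_inner by (simp add: sum_distrib_left power2_eq_square mult_ac)
  have I2: "integrable lebesgue (\<lambda>x. (U x)\<^sup>2 * (m x * (grad m x \<bullet> x)))"
    unfolding s2[symmetric] by (intro Bochner_Integration.integrable_sum i2)
  have "real DIM('a) * (\<integral>x. (w x)\<^sup>2 \<partial>lebesgue) = (\<Sum>j\<in>(Basis::'a set). - 2 * (\<integral>x. g j x * (x \<bullet> j) * w x \<partial>lebesgue))"
    using sum.cong[OF refl main, of "Basis"] by simp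
  also have "\<dots> = - 2 * (\<Sum>j\<in>(Basis::'a set). \<integral>x. g j x * (x \<bullet> j) * w x \<partial>lebesgue)"
    by (simp add: sum_distrib_left)
  also have "(\<Sum>j\<in>(Basis::'a set). \<integral>x. g j x * (x \<bullet> j) * w x \<partial>lebesgue) =
      (\<Sum>j\<in>Basis. (\<integral>x. (((x \<bullet> j) * m x) * (G x \<bullet> j)) * w x \<partial>lebesgue) + (\<integral>x. (((x \<bullet> j) * partial_deriv j m x) * U x) * w x \<partial>lebesgue))"
  proof (intro sum.cong refl)
    fix j :: 'a assume j: "j \<in> Basis"
    have "(\<integral>x. g j x * (x \<bullet> j) * w x \<partial>lebesgue) =
        (\<integral>x. (((x \<bullet> j) * m x) * (G x \<bullet> j)) * w x + (((x \<bullet> j) * partial_deriv j m x) * U x) * w x \<partial>lebesgue)"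
      by (intro Bochner_Integration.integral_cong) (auto simp: g_def algebra_simps)
    then show "(\<integral>x. g j x * (x \<bullet> j) * w x \<partial>lebesgue) =
      (\<integral>x. (((x \<bullet> j) * m x) * (G x \<bullet> j)) * w x \<partial>lebesgue) + (\<integral>x. (((x \<bullet> j) * partial_deriv j m x) * U x) * w x \<partial>lebesgue)"
      by (simp only: Bochner_Integration.integral_add[OF i1[OF j] i2[OF j]])
  qed
  also have "\<dots> = (\<integral>x. (m x)\<^sup>2 * U x * (G x \<bullet> x) \<partial>lebesgue) + (\<integral>x. (U x)\<^sup>2 * (m x * (grad m x \<bullet> x)) \<partial>lebesgue)"
    unfolding sum.distrib s1[symmetric] s2[symmetric]
    by (simp only: Bochner_Integration.integral_sum[OF i1] Bochner_Integration.integral_sum[OF i2])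
  finally have "real DIM('a) * (\<integral>x. (w x)\<^sup>2 \<partial>lebesgue) + 2 * (\<integral>x. (U x)\<^sup>2 * (m x * (grad m x \<bullet> x)) \<partial>lebesgue) =
      - 2 * (\<integral>x. (m x)\<^sup>2 * U x * (G x \<bullet> x) \<partial>lebesgue)" by simp
  moreover have "(\<integral>x. (U x)\<^sup>2 * (real DIM('a) * (m x)\<^sup>2 + 2 * m x * (grad m x \<bullet> x)) \<partial>lebesgue) =
      (\<integral>x. real DIM('a) * (w x)\<^sup>2 + 2 * ((U x)\<^sup>2 * (m x * (grad m x \<bullet> x))) \<partial>lebesgue)"
    by (intro Bochner_Integration.integral_cong) (auto simp: w_def power2_eq_square algebra_simps)
  ultimately show ?thesis using w2 I2 by simp
qed

section \<open>Powers of the bracket and radial cutoffs\<close>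

definition bracket_sq :: "'a::euclidean_space \<Rightarrow> real" where
  "bracket_sq x = 1 + (norm x)\<^sup>2"

lemma bracket_sq_ge_1: "bracket_sq x \<ge> 1" and bracket_sq_pos: "bracket_sq x > 0"
  by (auto simp: bracket_sq_def add_pos_nonneg)

text \<open>The weight <x> is handled through its square, a polynomial bounded below by 1, so that
  every real power is smooth. Exponents are halved throughout: <x>^e is
  \<open>bracket_sq x powr (e / 2)\<close>.\<close>

lemma smooth_bracket_powr: "smooth (\<lambda>x. bracket_sq x powr r)"
  unfolding bracket_sq_def
  by (intro smooth_powr smooth_add smooth_const smooth_norm_square) (simp add: add_pos_nonneg)

lemma norm_square_has_derivative: "((\<lambda>x. (norm x)\<^sup>2) has_derivative (\<lambda>h. 2 * (x \<bullet> h))) (at x)"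
  unfolding power2_norm_eq_inner by (auto intro!: derivative_eq_intros simp: inner_commute)

lemma bracket_powr_has_derivative:
  "((\<lambda>x. bracket_sq x powr r) has_derivative (\<lambda>h. (2 * r * bracket_sq x powr (r - 1)) *\<^sub>R x \<bullet> h)) (at x)"
proof -
  have "((\<lambda>x. bracket_sq x) has_derivative (\<lambda>h. 2 * (x \<bullet> h))) (at x)"
    unfolding bracket_sq_def by (intro has_derivative_add_const[where c = 1, simplified add.commute] norm_square_has_derivative)
  from has_derivative_compose[OF this has_real_derivative_powr[OF bracket_sq_pos, unfolded has_field_derivative_def]]
  show ?thesis by (simp add: mult_ac)
qed

lemma grad_bracket_powr: "grad (\<lambda>x. bracket_sq x powr r) x = (2 * r * bracket_sq x powr (r - 1)) *\<^sub>R x"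
  by (rule grad_eqI[OF bracket_powr_has_derivative])

text \<open>This is exp z >= z^2/2 at z = 1/y. Since \<open>flat 2\<close> is the derivative of
  \<open>flat 0\<close>, it controls the gradient of the cutoff below.\<close>

lemma flat_2_le: "flat 2 y \<le> 2"
proof (cases "y > 0")
  case True
  have "(1 / y)\<^sup>2 / 2 \<le> exp (1 / y)"
    using exp_lower_Taylor_quadratic[of "1 / y"] True by (smt (verit) divide_nonneg_pos)
  then show ?thesis using True by (simp add: flat_def exp_minus divide_simps mult_ac)
qed (simp add: flat_def)

text \<open>A cutoff to the ball of radius n + 1 times <x>^(2r). As \<open>flat 0 1\<close> is exp
  (-1), the factor \<open>exp 1\<close> makes the cutoff tend to 1 as n grows; \<open>Suc n\<close>
  avoids division by 0 at n = 0.\<close>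

definition radial_cutoff :: "real \<Rightarrow> nat \<Rightarrow> 'a::euclidean_space \<Rightarrow> real" where
  "radial_cutoff r n x = exp 1 * flat 0 (1 - (norm x)\<^sup>2 / (real (Suc n))\<^sup>2) * bracket_sq x powr r"

lemma radial_cutoff_test: "radial_cutoff r n \<in> test_functions UNIV"
proof (rule test_functionsI[where K = "cball 0 (real (Suc n))"])
  have "smooth (\<lambda>x. exp 1 * flat 0 (1 + - inverse ((real (Suc n))\<^sup>2) * (norm x)\<^sup>2) * bracket_sq x powr r)"
    by (intro smooth_mult smooth_const smooth_flat smooth_add smooth_norm_square smooth_bracket_powr)
  then show "smooth (radial_cutoff r n)"
    unfolding radial_cutoff_def[abs_def] by (simp add: divide_inverse mult.commute)
  show "radial_cutoff r n x = 0" if "x \<notin> cball 0 (real (Suc n))" for x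
  proof -
    have "(real (Suc n))\<^sup>2 \<le> (norm x)\<^sup>2" using that by (intro power_mono) auto
    then have "1 \<le> (norm x)\<^sup>2 / (real (Suc n))\<^sup>2" by (subst le_divide_eq_1_pos) auto
    then have "\<not> 0 < 1 - (norm x)\<^sup>2 / (real (Suc n))\<^sup>2" by linarith
    then have "flat 0 (1 - (norm x)\<^sup>2 / (real (Suc n))\<^sup>2) = 0" unfolding flat_def by (rule if_not_P)
    then show ?thesis by (simp only: radial_cutoff_def mult_zero_left mult_zero_right)
  qed
qed auto

text \<open>Only x . grad enters the radial identity. That operator is invariant under dilations, so
  the cutoff contributes an expression in s = |x|^2/(n + 1)^2 alone, which admits a bound
  independent of n.\<close>

lemma radial_cutoff_grad:
  fixes x :: "'a::euclidean_space" and n :: nat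
  defines "s \<equiv> (norm x)\<^sup>2 / (real (Suc n))\<^sup>2"
  shows "grad (radial_cutoff r n) x \<bullet> x = exp 1 * bracket_sq x powr r *
    (2 * r * flat 0 (1 - s) * ((norm x)\<^sup>2 / bracket_sq x) - 2 * flat 2 (1 - s) * s)"
proof -
  let ?R = "(real (Suc n))\<^sup>2"
  have D1: "((\<lambda>x. 1 - (norm x)\<^sup>2 / ?R) has_derivative (\<lambda>h. - (2 * (x \<bullet> h) / ?R))) (at x)"
    using has_derivative_diff[OF has_derivative_const[of 1] has_derivative_mult_right[OF norm_square_has_derivative, of "inverse ?R" x]]
    by (simp add: divide_inverse mult_ac)
  have D2: "((\<lambda>x. flat 0 (1 - (norm x)\<^sup>2 / ?R)) has_derivative (\<lambda>h. flat 2 (1 - s) * - (2 * (x \<bullet> h) / ?R))) (at x)"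
    using has_derivative_compose[OF D1 flat_derivative[of 0, unfolded has_field_derivative_def]] by (simp add: s_def numeral_2_eq_2)
  have D3: "(radial_cutoff r n has_derivative (\<lambda>h. exp 1 * flat 0 (1 - s) * ((2 * r * bracket_sq x powr (r - 1)) *\<^sub>R x \<bullet> h) +
      exp 1 * (flat 2 (1 - s) * - (2 * (x \<bullet> h) / ?R)) * bracket_sq x powr r)) (at x)"
    unfolding radial_cutoff_def[abs_def]
    using has_derivative_mult[OF has_derivative_mult_right[OF D2, of "exp 1"] bracket_powr_has_derivative[of r x]]
    by (simp add: s_def)
  have "grad (radial_cutoff r n) x \<bullet> x = exp 1 * flat 0 (1 - s) * ((2 * r * bracket_sq x powr (r - 1)) *\<^sub>R x \<bullet> x) +
      exp 1 * (flat 2 (1 - s) * - (2 * (x \<bullet> x) / ?R)) * bracket_sq x powr r"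
    by (rule fun_cong[OF has_derivative_unique[OF smooth_has_derivative_grad[OF test_functionsD(1)[OF radial_cutoff_test]] D3]])
  also have "bracket_sq x powr (r - 1) = bracket_sq x powr r / bracket_sq x"
    using bracket_sq_pos[of x] by (simp add: powr_diff)
  finally show ?thesis
    by (simp add: s_def power2_norm_eq_inner algebra_simps add_divide_distrib)
qed

text \<open>The limit of \<open>radial_identity_test\<close> along the cutoffs, by dominated
  convergence with the two integrability assumptions. The term with the gradient of the cutoff is
  bounded uniformly in n and carries the factor s, which tends to 0 for fixed x.\<close>

theorem radial_identity:
  fixes U :: "'a::euclidean_space \<Rightarrow> real"
  assumes UG: "whole_space_weak_gradient U G"
    and meas: "U \<in> borel_measurable lebesgue" "(\<lambda>x. G x \<bullet> x) \<in> borel_measurable lebesgue"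
    and I1: "integrable lebesgue (\<lambda>x. bracket_sq x powr r * (U x)\<^sup>2)"
    and I2: "integrable lebesgue (\<lambda>x. bracket_sq x powr r * U x * (G x \<bullet> x))"
  shows "(\<integral>x. bracket_sq x powr r * (U x)\<^sup>2 * (real DIM('a) + 2 * r * ((norm x)\<^sup>2 / bracket_sq x)) \<partial>lebesgue) =
     - 2 * (\<integral>x. bracket_sq x powr r * U x * (G x \<bullet> x) \<partial>lebesgue)"
proof -
  \<comment> \<open>Half the exponent, because m enters squared.\<close>
  let ?m = "\<lambda>n. radial_cutoff (r / 2) n :: 'a \<Rightarrow> real"
  define s :: "nat \<Rightarrow> 'a \<Rightarrow> real" where "s = (\<lambda>n x. (norm x)\<^sup>2 / (real (Suc n))\<^sup>2)"
  define \<zeta> where "\<zeta> = (\<lambda>n x. exp 1 * flat 0 (1 - s n x))"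
  have m_eq: "?m n x = \<zeta> n x * bracket_sq x powr (r / 2)" for n x
    by (simp add: radial_cutoff_def \<zeta>_def s_def)
  have sq: "(bracket_sq x powr (r / 2))\<^sup>2 = bracket_sq x powr r" for x :: 'a
    using bracket_sq_pos[of x] by (simp add: powr_add[symmetric] power2_eq_square)
  have s_lim: "(\<lambda>n. s n x) \<longlonglongrightarrow> 0" for x
  proof -
    have "(\<lambda>n. (norm x)\<^sup>2 * (inverse (real (Suc n)))\<^sup>2) \<longlonglongrightarrow> (norm x)\<^sup>2 * 0\<^sup>2"
      by (intro tendsto_intros LIMSEQ_inverse_real_of_nat)
    then show ?thesis by (simp add: s_def divide_inverse power_inverse)
  qed
  have flat_lim: "(\<lambda>n. flat k (1 - s n x)) \<longlonglongrightarrow> flat k 1" for k x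
  proof -
    have "isCont (flat k) 1" using continuous_flat[of k] by (simp add: continuous_on_eq_continuous_at)
    moreover have "(\<lambda>n. 1 - s n x) \<longlonglongrightarrow> 1" using tendsto_diff[OF tendsto_const s_lim, of 1 x] by simp
    ultimately show ?thesis by (rule isCont_tendsto_compose)
  qed
  have \<zeta>_lim: "(\<lambda>n. \<zeta> n x) \<longlonglongrightarrow> 1" for x
  proof -
    have "(\<lambda>n. \<zeta> n x) \<longlonglongrightarrow> exp 1 * flat 0 1" unfolding \<zeta>_def by (intro tendsto_intros flat_lim)
    then show ?thesis by (simp add: flat_def exp_minus)
  qed
  have s_nonneg: "0 \<le> s n x" for n x by (simp add: s_def)
  have \<zeta>_bounds: "0 \<le> \<zeta> n x" "\<zeta> n x \<le> 1" for n x
  proof -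
    show "0 \<le> \<zeta> n x" by (simp add: \<zeta>_def flat_nonneg)
    have "flat 0 (1 - s n x) \<le> exp (- 1)"
    proof (cases "s n x < 1")
      case True
      then have "1 \<le> 1 / (1 - s n x)" using s_nonneg[of n x] by (simp add: divide_simps)
      then show ?thesis using True by (simp add: flat_def)
    qed (simp add: flat_def)
    then show "\<zeta> n x \<le> 1" by (simp add: \<zeta>_def exp_minus divide_simps mult.commute)
  qed
  have f2s: "0 \<le> flat 2 (1 - s n x) * s n x" "flat 2 (1 - s n x) * s n x \<le> 2" for n x
  proof -
    show "0 \<le> flat 2 (1 - s n x) * s n x" by (simp add: flat_nonneg s_nonneg)
    show "flat 2 (1 - s n x) * s n x \<le> 2"
    proof (cases "s n x < 1")
      case True
      then have "flat 2 (1 - s n x) * s n x \<le> 2 * 1"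
        using s_nonneg[of n x] by (intro mult_mono flat_2_le) auto
      then show ?thesis by simp
    qed (simp add: flat_def)
  qed
  define k :: "'a \<Rightarrow> real" where "k = (\<lambda>x. (norm x)\<^sup>2 / bracket_sq x)"
  have k: "0 \<le> k x" "k x \<le> 1" for x
    using bracket_sq_pos[of x] by (auto simp: k_def bracket_sq_def divide_simps)
  \<comment> \<open>What remains of the coefficient of U^2 once the weight is split off: the
    limiting factor times the squared cutoff, minus the contribution of the gradient of the
    cutoff.\<close>
  define c where "c = (\<lambda>n x. (\<zeta> n x)\<^sup>2 * (real DIM('a) + 2 * r * k x) - 4 * exp 1 * \<zeta> n x * (flat 2 (1 - s n x) * s n x))"
  have coef: "real DIM('a) * (?m n x)\<^sup>2 + 2 * ?m n x * (grad (?m n) x \<bullet> x) = bracket_sq x powr r * c n x" for n x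
  proof -
    have "grad (?m n) x \<bullet> x = bracket_sq x powr (r / 2) * (r * \<zeta> n x * k x - 2 * exp 1 * (flat 2 (1 - s n x) * s n x))"
      unfolding radial_cutoff_grad by (simp add: s_def \<zeta>_def k_def algebra_simps)
    note g = this
    have "real DIM('a) * (?m n x)\<^sup>2 + 2 * ?m n x * (grad (?m n) x \<bullet> x) = (bracket_sq x powr (r / 2))\<^sup>2 * c n x"
      unfolding g m_eq c_def by (simp add: power2_eq_square algebra_simps)
    then show ?thesis by (simp add: sq)
  qed
  have c_lim: "(\<lambda>n. c n x) \<longlonglongrightarrow> real DIM('a) + 2 * r * k x" for x
  proof -
    have "(\<lambda>n. c n x) \<longlonglongrightarrow> 1\<^sup>2 * (real DIM('a) + 2 * r * k x) - 4 * exp 1 * 1 * (flat 2 1 * 0)"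
      unfolding c_def by (intro tendsto_intros \<zeta>_lim flat_lim s_lim)
    then show ?thesis by simp
  qed
  have c_bound: "\<bar>c n x\<bar> \<le> real DIM('a) + 2 * \<bar>r\<bar> + 8 * exp 1" for n x
  proof -
    have "\<bar>r * k x\<bar> \<le> \<bar>r\<bar> * 1" unfolding abs_mult using k[of x] by (intro mult_left_mono) auto
    then have a: "\<bar>real DIM('a) + 2 * r * k x\<bar> \<le> real DIM('a) + 2 * \<bar>r\<bar>" by linarith
    have "(\<zeta> n x)\<^sup>2 \<le> 1" using \<zeta>_bounds[of n x] by (simp add: power_le_one)
    then have "\<bar>(\<zeta> n x)\<^sup>2 * (real DIM('a) + 2 * r * k x)\<bar> \<le> 1 * (real DIM('a) + 2 * \<bar>r\<bar>)"
      unfolding abs_mult by (intro mult_mono a) auto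
    moreover have "\<zeta> n x * (flat 2 (1 - s n x) * s n x) \<le> 1 * 2"
      using \<zeta>_bounds[of n x] f2s[of n x] by (intro mult_mono) auto
    then have "4 * exp 1 * (\<zeta> n x * (flat 2 (1 - s n x) * s n x)) \<le> 4 * exp 1 * (1 * 2)" by (rule mult_left_mono) simp
    moreover have "0 \<le> 4 * exp 1 * (\<zeta> n x * (flat 2 (1 - s n x) * s n x))" using \<zeta>_bounds(1)[of n x] f2s(1)[of n x] by simp
    moreover have "c n x = (\<zeta> n x)\<^sup>2 * (real DIM('a) + 2 * r * k x) - 4 * exp 1 * (\<zeta> n x * (flat 2 (1 - s n x) * s n x))"
      unfolding c_def by (simp only: mult.assoc)
    moreover have "\<bar>A - B\<bar> \<le> a + b" if "\<bar>A\<bar> \<le> a" "B \<le> b" "0 \<le> B" for A B a b :: real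
      using that by linarith
    ultimately have "\<bar>c n x\<bar> \<le> 1 * (real DIM('a) + 2 * \<bar>r\<bar>) + 4 * exp 1 * (1 * 2)" by metis
    then show ?thesis by simp
  qed
  have brm: "(\<lambda>x::'a. bracket_sq x powr p) \<in> borel_measurable lebesgue" for p
    by (rule measurable_completion) (simp add: borel_measurable_continuous_onI smooth_continuous smooth_bracket_powr)
  have mm: "?m n \<in> borel_measurable lebesgue" for n by (rule test_function_lebesgue[OF radial_cutoff_test])
  have gm: "(\<lambda>x. grad (?m n) x \<bullet> x) \<in> borel_measurable lebesgue" for n
    by (rule measurable_completion)
      (auto intro!: borel_measurable_continuous_onI continuous_intros continuous_grad test_functionsD(1)[OF radial_cutoff_test])
  let ?L = "\<lambda>n x. (U x)\<^sup>2 * (real DIM('a) * (?m n x)\<^sup>2 + 2 * ?m n x * (grad (?m n) x \<bullet> x))"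
  have Lm: "?L n \<in> borel_measurable lebesgue" for n
    using meas(1) mm[of n] gm[of n] by measurable
  have L_lim: "(\<lambda>n. \<integral>x. ?L n x \<partial>lebesgue) \<longlonglongrightarrow> (\<integral>x. bracket_sq x powr r * (U x)\<^sup>2 * (real DIM('a) + 2 * r * k x) \<partial>lebesgue)"
  proof (rule integral_dominated_convergence)
    show "integrable lebesgue (\<lambda>x. (real DIM('a) + 2 * \<bar>r\<bar> + 8 * exp 1) * (bracket_sq x powr r * (U x)\<^sup>2))"
      using I1 by simp
    show "AE x in lebesgue. (\<lambda>n. ?L n x) \<longlonglongrightarrow> bracket_sq x powr r * (U x)\<^sup>2 * (real DIM('a) + 2 * r * k x)"
    proof (rule AE_I2)
      fix x
      have "(\<lambda>n. (U x)\<^sup>2 * (bracket_sq x powr r * c n x)) \<longlonglongrightarrow> (U x)\<^sup>2 * (bracket_sq x powr r * (real DIM('a) + 2 * r * k x))"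
        by (intro tendsto_intros c_lim)
      then show "(\<lambda>n. ?L n x) \<longlonglongrightarrow> bracket_sq x powr r * (U x)\<^sup>2 * (real DIM('a) + 2 * r * k x)"
        unfolding coef by (simp add: mult_ac)
    qed
    show "AE x in lebesgue. norm (?L n x) \<le> (real DIM('a) + 2 * \<bar>r\<bar> + 8 * exp 1) * (bracket_sq x powr r * (U x)\<^sup>2)" for n
    proof (rule AE_I2)
      fix x
      have "norm (?L n x) = \<bar>c n x\<bar> * (bracket_sq x powr r * (U x)\<^sup>2)"
        unfolding coef by (simp add: abs_mult)
      also have "\<dots> \<le> (real DIM('a) + 2 * \<bar>r\<bar> + 8 * exp 1) * (bracket_sq x powr r * (U x)\<^sup>2)"
        by (intro mult_right_mono c_bound) simp
      finally show "norm (?L n x) \<le> (real DIM('a) + 2 * \<bar>r\<bar> + 8 * exp 1) * (bracket_sq x powr r * (U x)\<^sup>2)" .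
    qed
    show "(\<lambda>x. bracket_sq x powr r * (U x)\<^sup>2 * (real DIM('a) + 2 * r * k x)) \<in> borel_measurable lebesgue"
    proof -
      have "(\<lambda>x::'a. (norm x)\<^sup>2) \<in> borel_measurable lebesgue" by (rule measurable_completion) simp
      moreover have "(bracket_sq :: 'a \<Rightarrow> real) \<in> borel_measurable lebesgue"
        unfolding bracket_sq_def[abs_def] by (rule measurable_completion) simp
      ultimately show ?thesis unfolding k_def using brm[of r] meas(1) by measurable
    qed
  qed (rule Lm)
  let ?Q = "\<lambda>n x. (?m n x)\<^sup>2 * U x * (G x \<bullet> x)"
  have m2: "(?m n x)\<^sup>2 = (\<zeta> n x)\<^sup>2 * bracket_sq x powr r" for n x
    unfolding m_eq by (simp add: power_mult_distrib sq)
  have Q_lim: "(\<lambda>n. \<integral>x. ?Q n x \<partial>lebesgue) \<longlonglongrightarrow> (\<integral>x. bracket_sq x powr r * U x * (G x \<bullet> x) \<partial>lebesgue)"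
  proof (rule integral_dominated_convergence)
    show "integrable lebesgue (\<lambda>x. \<bar>bracket_sq x powr r * U x * (G x \<bullet> x)\<bar>)" using I2 by (rule integrable_abs)
    show "AE x in lebesgue. (\<lambda>n. ?Q n x) \<longlonglongrightarrow> bracket_sq x powr r * U x * (G x \<bullet> x)"
    proof (rule AE_I2)
      fix x
      have "(\<lambda>n. (\<zeta> n x)\<^sup>2 * bracket_sq x powr r * U x * (G x \<bullet> x)) \<longlonglongrightarrow> 1\<^sup>2 * bracket_sq x powr r * U x * (G x \<bullet> x)"
        by (intro tendsto_intros \<zeta>_lim)
      then show "(\<lambda>n. ?Q n x) \<longlonglongrightarrow> bracket_sq x powr r * U x * (G x \<bullet> x)" unfolding m2 by simp
    qed
    show "AE x in lebesgue. norm (?Q n x) \<le> \<bar>bracket_sq x powr r * U x * (G x \<bullet> x)\<bar>" for n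
    proof (rule AE_I2)
      fix x
      have "(\<zeta> n x)\<^sup>2 \<le> 1" using \<zeta>_bounds[of n x] by (simp add: power_le_one)
      then have "(\<zeta> n x)\<^sup>2 * \<bar>bracket_sq x powr r * U x * (G x \<bullet> x)\<bar> \<le> 1 * \<bar>bracket_sq x powr r * U x * (G x \<bullet> x)\<bar>"
        by (rule mult_right_mono) simp
      then show "norm (?Q n x) \<le> \<bar>bracket_sq x powr r * U x * (G x \<bullet> x)\<bar>"
        unfolding m2 by (simp add: abs_mult mult.assoc)
    qed
    show "?Q n \<in> borel_measurable lebesgue" for n using mm[of n] meas by measurable
  qed (use I2 in auto)
  have "(\<lambda>n. \<integral>x. ?L n x \<partial>lebesgue) = (\<lambda>n. - 2 * (\<integral>x. ?Q n x \<partial>lebesgue))"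
    by (intro ext radial_identity_test[OF UG radial_cutoff_test])
  then have "(\<lambda>n. \<integral>x. ?L n x \<partial>lebesgue) \<longlonglongrightarrow> - 2 * (\<integral>x. bracket_sq x powr r * U x * (G x \<bullet> x) \<partial>lebesgue)"
    using tendsto_mult[OF tendsto_const Q_lim] by (simp only:)
  from LIMSEQ_unique[OF L_lim this] show ?thesis unfolding k_def .
qed

section \<open>Weak gradients of functions vanishing outside the domain\<close>

lemma test_function_bounded_support:
  assumes "m \<in> test_functions S"
  obtains R where "\<And>x. norm x > R \<Longrightarrow> m x = 0"
proof -
  obtain R where R: "\<And>x. x \<in> closure {x. m x \<noteq> 0} \<Longrightarrow> norm x \<le> R"
    using compact_imp_bounded[OF test_functionsD(2)[OF assms]] by (auto simp: bounded_iff)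
  have "m x = 0" if "norm x > R" for x
    using that test_function_outside[of x m] R[of x] by force
  then show ?thesis using that by blast
qed

lemma whole_space_weak_gradientD:
  assumes "whole_space_weak_gradient U G" "m \<in> test_functions UNIV"
  shows "(\<lambda>x. m x * U x) \<in> L2 lebesgue"
    and "j \<in> Basis \<Longrightarrow> (\<lambda>x. m x * (G x \<bullet> j)) \<in> L2 lebesgue"
    and "j \<in> Basis \<Longrightarrow> (\<integral>x. (G x \<bullet> j) * m x \<partial>lebesgue) = - (\<integral>x. U x * partial_deriv j m x \<partial>lebesgue)"
    and "integrable lebesgue (\<lambda>x. m x * U x)"
    and "j \<in> Basis \<Longrightarrow> integrable lebesgue (\<lambda>x. m x * (G x \<bullet> j))"
proof -
  obtain R where R: "\<And>x. norm x > R \<Longrightarrow> m x = 0"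
    using test_function_bounded_support[OF assms(2)] by blast
  show "(\<lambda>x. m x * U x) \<in> L2 lebesgue"
    using assms by (auto simp: whole_space_weak_gradient_def)
  show 2: "(\<lambda>x. m x * (G x \<bullet> j)) \<in> L2 lebesgue" if "j \<in> Basis"
    using assms that by (auto simp: whole_space_weak_gradient_def)
  show "(\<integral>x. (G x \<bullet> j) * m x \<partial>lebesgue) = - (\<integral>x. U x * partial_deriv j m x \<partial>lebesgue)" if "j \<in> Basis"
    using assms that by (auto simp: whole_space_weak_gradient_def)
  show "integrable lebesgue (\<lambda>x. m x * U x)"
    by (rule L2_bounded_support_integrable) (use assms R in \<open>auto simp: whole_space_weak_gradient_def\<close>)
  show "integrable lebesgue (\<lambda>x. m x * (G x \<bullet> j))" if "j \<in> Basis"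
    by (rule L2_bounded_support_integrable[OF 2[OF that]]) (use R in auto)
qed

text \<open>A smooth multiple of a test function is again a test function, whatever the growth of
  \<rho>, so \<rho> can be moved onto m.\<close>

lemma whole_space_weak_gradient_mult:
  assumes UG: "whole_space_weak_gradient U G" and \<rho>: "smooth \<rho>"
  shows "whole_space_weak_gradient (\<lambda>x. \<rho> x * U x) (\<lambda>x. \<rho> x *\<^sub>R G x + U x *\<^sub>R grad \<rho> x)"
  unfolding whole_space_weak_gradient_def
proof (intro ballI conjI)
  fix m :: "'a \<Rightarrow> real" assume m: "m \<in> test_functions UNIV"
  have \<rho>m: "(\<lambda>x. \<rho> x * m x) \<in> test_functions UNIV" by (rule test_functions_mult[OF \<rho> m])
  show "(\<lambda>x. m x * (\<rho> x * U x)) \<in> L2 lebesgue"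
    using whole_space_weak_gradientD(1)[OF UG \<rho>m] by (simp add: mult_ac)
  fix j :: 'a assume j: "j \<in> Basis"
  have d\<rho>m: "(\<lambda>x. partial_deriv j \<rho> x * m x) \<in> test_functions UNIV"
    by (rule test_functions_mult[OF smooth_partial_deriv[OF \<rho> j] m])
  have \<rho>dm: "(\<lambda>x. \<rho> x * partial_deriv j m x) \<in> test_functions UNIV"
    by (rule test_functions_mult[OF \<rho> test_functions_partial_deriv[OF m j]])
  have eq: "(\<rho> x *\<^sub>R G x + U x *\<^sub>R grad \<rho> x) \<bullet> j * m x = (\<rho> x * m x) * (G x \<bullet> j) + (partial_deriv j \<rho> x * m x) * U x" for x
    using j by (simp add: inner_add_left grad_inner_Basis algebra_simps)
  show "(\<lambda>x. m x * ((\<rho> x *\<^sub>R G x + U x *\<^sub>R grad \<rho> x) \<bullet> j)) \<in> L2 lebesgue"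
    using L2_add[OF whole_space_weak_gradientD(2)[OF UG \<rho>m j] whole_space_weak_gradientD(1)[OF UG d\<rho>m]]
    unfolding eq[symmetric] by (simp add: mult.commute)
  note i = whole_space_weak_gradientD(4)[OF UG d\<rho>m] whole_space_weak_gradientD(5)[OF UG \<rho>m j]
    whole_space_weak_gradientD(4)[OF UG \<rho>dm]
  have "(\<integral>x. (\<rho> x *\<^sub>R G x + U x *\<^sub>R grad \<rho> x) \<bullet> j * m x \<partial>lebesgue) =
      (\<integral>x. (\<rho> x * m x) * (G x \<bullet> j) \<partial>lebesgue) + (\<integral>x. (partial_deriv j \<rho> x * m x) * U x \<partial>lebesgue)"
    unfolding eq by (rule Bochner_Integration.integral_add[OF i(2,1)])
  also have "(\<integral>x. (\<rho> x * m x) * (G x \<bullet> j) \<partial>lebesgue) = - (\<integral>x. U x * partial_deriv j (\<lambda>x. \<rho> x * m x) x \<partial>lebesgue)"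
    using whole_space_weak_gradientD(3)[OF UG \<rho>m j] by (simp add: mult.commute)
  also have "(\<integral>x. U x * partial_deriv j (\<lambda>x. \<rho> x * m x) x \<partial>lebesgue) =
      (\<integral>x. (\<rho> x * partial_deriv j m x) * U x + (partial_deriv j \<rho> x * m x) * U x \<partial>lebesgue)"
    unfolding partial_deriv_mult[OF \<rho> test_functionsD(1)[OF m]]
    by (intro Bochner_Integration.integral_cong) (auto simp: algebra_simps)
  also have "\<dots> = (\<integral>x. (\<rho> x * partial_deriv j m x) * U x \<partial>lebesgue) + (\<integral>x. (partial_deriv j \<rho> x * m x) * U x \<partial>lebesgue)"
    by (rule Bochner_Integration.integral_add[OF i(3,1)])
  finally show "(\<integral>x. (\<rho> x *\<^sub>R G x + U x *\<^sub>R grad \<rho> x) \<bullet> j * m x \<partial>lebesgue) = - (\<integral>x. \<rho> x * U x * partial_deriv j m x \<partial>lebesgue)"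
    by (simp add: mult_ac)
qed

text \<open>Each component of g - h integrates to 0 against every test function, so du Bois-Reymond
  applies. Local integrability, used on the support of the test function, allows the two integrals
  to be subtracted.\<close>

lemma weak_gradient_unique:
  fixes u :: "'a::euclidean_space \<Rightarrow> real"
  assumes "open \<Omega>" "has_weak_gradient \<Omega> u g" "has_weak_gradient \<Omega> u h"
  shows "AE x in lebesgue_on \<Omega>. g x = h x"
proof -
  have \<Omega>: "\<Omega> \<in> sets lebesgue" using assms(1) by auto
  have "AE x in lebesgue_on \<Omega>. g x \<bullet> j - h x \<bullet> j = 0" if j: "j \<in> Basis" for j
  proof (rule du_Bois_Reymond[OF assms(1)])
    have li: "integrable (lebesgue_on K) g" "integrable (lebesgue_on K) h" if "compact K" "K \<subseteq> \<Omega>" for K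
      using assms(2,3) that by (auto simp: has_weak_gradient_def locally_integrable_def)
    show "locally_integrable \<Omega> (\<lambda>x. g x \<bullet> j - h x \<bullet> j)"
      unfolding locally_integrable_def using li by auto
    fix \<phi> :: "'a \<Rightarrow> real" assume \<phi>: "\<phi> \<in> test_functions \<Omega>"
    let ?K = "closure {x. \<phi> x \<noteq> 0}"
    note K = test_functionsD(2,3)[OF \<phi>]
    obtain B where B: "\<And>x. \<bar>\<phi> x\<bar> \<le> B" using test_function_bounded[OF \<phi>] by blast
    have int: "integrable (lebesgue_on \<Omega>) (\<lambda>x. (k x \<bullet> j) * \<phi> x)" if k: "integrable (lebesgue_on ?K) k" for k :: "'a \<Rightarrow> 'a"
    proof -
      have ki: "integrable lebesgue (\<lambda>x. indicator ?K x * (k x \<bullet> j))"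
        using integrable_inner_left[OF k, of j] by (subst (asm) integrable_lebesgue_on_eq) auto
      have "integrable lebesgue (\<lambda>x. \<phi> x * (indicator ?K x * (k x \<bullet> j)))"
      proof (rule Bochner_Integration.integrable_bound)
        show "integrable lebesgue (\<lambda>x. B * (indicator ?K x * (k x \<bullet> j)))" using ki by simp
        show "AE x in lebesgue. norm (\<phi> x * (indicator ?K x * (k x \<bullet> j))) \<le> norm (B * (indicator ?K x * (k x \<bullet> j)))"
        proof (rule AE_I2)
          fix x
          show "norm (\<phi> x * (indicator ?K x * (k x \<bullet> j))) \<le> norm (B * (indicator ?K x * (k x \<bullet> j)))"
            unfolding norm_mult using B[of x] by (intro mult_right_mono) auto
        qed
      qed (intro borel_measurable_times test_function_lebesgue[OF \<phi>] borel_measurable_integrable[OF ki])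
      moreover have "(\<lambda>x. \<phi> x * (indicator ?K x * (k x \<bullet> j))) = (\<lambda>x. indicator \<Omega> x * ((k x \<bullet> j) * \<phi> x))"
      proof
        fix x show "\<phi> x * (indicator ?K x * (k x \<bullet> j)) = indicator \<Omega> x * ((k x \<bullet> j) * \<phi> x)"
        proof (cases "x \<in> ?K")
          case True
          then have "x \<in> \<Omega>" using K(2) by blast
          with True show ?thesis by simp
        qed (simp add: test_function_outside[of x])
      qed
      ultimately show ?thesis by (subst integrable_lebesgue_on_eq[OF \<Omega>]) (simp only:)
    qed
    have "(\<integral>x. (g x \<bullet> j) * \<phi> x \<partial>lebesgue_on \<Omega>) = (\<integral>x. (h x \<bullet> j) * \<phi> x \<partial>lebesgue_on \<Omega>)"
      using assms(2,3) \<phi> j by (auto simp: has_weak_gradient_def)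
    then show "(\<integral>x. (g x \<bullet> j - h x \<bullet> j) * \<phi> x \<partial>lebesgue_on \<Omega>) = 0"
      using int[OF li(1)[OF K]] int[OF li(2)[OF K]] by (simp add: left_diff_distrib)
  qed
  then have "AE x in lebesgue_on \<Omega>. \<forall>j\<in>Basis. g x \<bullet> j - h x \<bullet> j = 0"
    by (subst AE_ball_countable) (auto intro: countable_finite)
  then show ?thesis by eventually_elim (auto intro: euclidean_eqI)
qed

section \<open>The form domain and zero extension\<close>

locale weighted_domain =
  fixes \<Omega> :: "'a::euclidean_space set" and D :: "'a \<Rightarrow> real"
  assumes open_domain: "open \<Omega>" and cont: "continuous_on UNIV D" and pos: "\<And>x. D x > 0"
begin

abbreviation \<mu> :: "'a measure" where "\<mu> \<equiv> weighted_measure \<Omega> D"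

lemma domain_lebesgue: "\<Omega> \<in> sets lebesgue"
  using open_domain by auto

lemma weight_measurable: "(\<lambda>x. inverse (D x)) \<in> borel_measurable lebesgue" "(\<lambda>x. inverse (D x)) \<in> borel_measurable (lebesgue_on \<Omega>)"
proof -
  have "(\<lambda>x. inverse (D x)) \<in> borel_measurable borel"
    using cont pos by (intro borel_measurable_continuous_onI continuous_intros) (auto simp: less_imp_neq[symmetric])
  then show "(\<lambda>x. inverse (D x)) \<in> borel_measurable lebesgue"
    by (intro measurable_completion) simp
  then show "(\<lambda>x. inverse (D x)) \<in> borel_measurable (lebesgue_on \<Omega>)"
    by (rule measurable_restrict_space1)
qed

lemma borel_measurable_weighted: "borel_measurable \<mu> = borel_measurable (lebesgue_on \<Omega>)"
  by (intro measurable_cong_sets) (auto simp: weighted_measure_def)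

lemma measurable_extension:
  fixes f :: "'a \<Rightarrow> 'b::real_normed_vector"
  shows "f \<in> borel_measurable (lebesgue_on \<Omega>) \<longleftrightarrow> (\<lambda>x. indicator \<Omega> x *\<^sub>R f x) \<in> borel_measurable lebesgue"
  using domain_lebesgue by (intro borel_measurable_restrict_space_iff) simp

text \<open>Integrals against the weighted measure become Lebesgue integrals of zero extensions, the
  setting of the radial identity.\<close>

lemma
  fixes f :: "'a \<Rightarrow> real"
  assumes "f \<in> borel_measurable (lebesgue_on \<Omega>)"
  shows integrable_weighted: "integrable \<mu> f \<longleftrightarrow> integrable lebesgue (\<lambda>x. indicator \<Omega> x * (inverse (D x) * f x))"
    and integral_weighted: "(\<integral>x. f x \<partial>\<mu>) = (\<integral>x. indicator \<Omega> x * (inverse (D x) * f x) \<partial>lebesgue)"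
proof -
  have "integrable \<mu> f \<longleftrightarrow> integrable (lebesgue_on \<Omega>) (\<lambda>x. inverse (D x) * f x)"
    unfolding weighted_measure_def using assms weight_measurable pos
    by (subst integrable_density) (auto simp: less_imp_le)
  then show "integrable \<mu> f \<longleftrightarrow> integrable lebesgue (\<lambda>x. indicator \<Omega> x * (inverse (D x) * f x))"
    by (simp add: integrable_lebesgue_on_eq[OF domain_lebesgue])
  have "(\<integral>x. f x \<partial>\<mu>) = (\<integral>x. inverse (D x) * f x \<partial>lebesgue_on \<Omega>)"
    unfolding weighted_measure_def using assms weight_measurable pos
    by (subst integral_density) (auto simp: less_imp_le)
  then show "(\<integral>x. f x \<partial>\<mu>) = (\<integral>x. indicator \<Omega> x * (inverse (D x) * f x) \<partial>lebesgue)"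
    by (simp add: integral_lebesgue_on_eq[OF domain_lebesgue])
qed

lemma L2_weighted_iff:
  fixes f :: "'a \<Rightarrow> real"
  shows "f \<in> L2 \<mu> \<longleftrightarrow> f \<in> borel_measurable (lebesgue_on \<Omega>) \<and>
    integrable lebesgue (\<lambda>x. indicator \<Omega> x * (inverse (D x) * (f x)\<^sup>2))"
proof -
  have "(\<lambda>x. (f x)\<^sup>2) \<in> borel_measurable (lebesgue_on \<Omega>)" if "f \<in> borel_measurable (lebesgue_on \<Omega>)"
    using that by measurable
  then show ?thesis unfolding L2_real_iff borel_measurable_weighted using integrable_weighted by blast
qed

text \<open>D is bounded on compact sets, so 1/D is bounded below there, and square integrability
  for the weighted measure implies local square integrability.\<close>

lemma weight_lower_bound_compact:
  assumes "compact K"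
  obtains c where "c > 0" "\<And>x. x \<in> K \<Longrightarrow> c * D x \<le> 1"
proof -
  have "compact (D ` K)"
    using assms cont by (intro compact_continuous_image) (auto intro: continuous_on_subset)
  then obtain B where B: "B > 0" "\<And>x. x \<in> K \<Longrightarrow> \<bar>D x\<bar> \<le> B"
    by (auto dest!: compact_imp_bounded simp: bounded_pos)
  then have "1 / B * D x \<le> 1" if "x \<in> K" for x using that by (force simp: divide_simps)
  with B(1) show ?thesis using that[of "1 / B"] by simp
qed

lemma form_domainD:
  assumes "u \<in> form_domain \<Omega> D"
  shows "u \<in> L2 \<mu>" "has_weak_gradient \<Omega> u (weak_gradient \<Omega> u)" "weak_gradient \<Omega> u \<in> L2 (lebesgue_on \<Omega>)"
    "\<And>\<phi> j. \<phi> \<in> test_functions UNIV \<Longrightarrow> j \<in> Basis \<Longrightarrow>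
      (\<integral>x. (weak_gradient \<Omega> u x \<bullet> j) * \<phi> x \<partial>lebesgue_on \<Omega>) = - (\<integral>x. u x * partial_deriv j \<phi> x \<partial>lebesgue_on \<Omega>)"
proof -
  have "u \<in> L2 \<mu>" "u \<in> H1_dot \<Omega>" using assms unfolding form_domain_def by blast+
  then show "u \<in> L2 \<mu>" "weak_gradient \<Omega> u \<in> L2 (lebesgue_on \<Omega>)" "has_weak_gradient \<Omega> u (weak_gradient \<Omega> u)"
    unfolding H1_dot_def by (simp_all add: weak_gradient_def someI_ex)
  show "(\<integral>x. (weak_gradient \<Omega> u x \<bullet> j) * \<phi> x \<partial>lebesgue_on \<Omega>) = - (\<integral>x. u x * partial_deriv j \<phi> x \<partial>lebesgue_on \<Omega>)"
    if "\<phi> \<in> test_functions UNIV" "j \<in> Basis" for \<phi> j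
    using assms that unfolding form_domain_def by blast
qed

text \<open>The boundary condition in \<open>form_domain\<close> tests against functions that need
  not vanish near the boundary; this is exactly the weak derivative identity for zero extensions on
  the whole space. What remains is local square integrability, where 1/D is bounded below on the
  support of m.\<close>

lemma form_domain_whole_space:
  assumes "u \<in> form_domain \<Omega> D"
  shows "whole_space_weak_gradient (\<lambda>x. indicator \<Omega> x * u x) (\<lambda>x. indicator \<Omega> x *\<^sub>R weak_gradient \<Omega> u x)"
  unfolding whole_space_weak_gradient_def
proof (intro ballI conjI)
  fix m :: "'a \<Rightarrow> real" assume m: "m \<in> test_functions UNIV"
  obtain B where B: "B > 0" "\<And>x. \<bar>m x\<bar> \<le> B" using test_function_bounded[OF m] by blast
  let ?K = "closure {x. m x \<noteq> 0}"
  obtain c where c: "c > 0" "\<And>x. x \<in> ?K \<Longrightarrow> c * D x \<le> 1"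
    using weight_lower_bound_compact[OF test_functionsD(2)[OF m]] by blast
  have uL: "u \<in> borel_measurable (lebesgue_on \<Omega>)" "integrable lebesgue (\<lambda>x. indicator \<Omega> x * (inverse (D x) * (u x)\<^sup>2))"
    using form_domainD(1)[OF assms] by (simp_all add: L2_weighted_iff)
  have Um: "(\<lambda>x. indicator \<Omega> x * u x) \<in> borel_measurable lebesgue" using uL(1) by (simp add: measurable_extension)
  have "integrable lebesgue (\<lambda>x. (m x * (indicator \<Omega> x * u x))\<^sup>2)"
  proof (rule Bochner_Integration.integrable_bound)
    show "integrable lebesgue (\<lambda>x. (B\<^sup>2 / c) * (indicator \<Omega> x * (inverse (D x) * (u x)\<^sup>2)))" using uL(2) by simp
    show "AE x in lebesgue. norm ((m x * (indicator \<Omega> x * u x))\<^sup>2) \<le> norm ((B\<^sup>2 / c) * (indicator \<Omega> x * (inverse (D x) * (u x)\<^sup>2)))"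
    proof (rule AE_I2)
      fix x
      show "norm ((m x * (indicator \<Omega> x * u x))\<^sup>2) \<le> norm ((B\<^sup>2 / c) * (indicator \<Omega> x * (inverse (D x) * (u x)\<^sup>2)))"
      proof (cases "x \<in> ?K")
        case False
        then show ?thesis by (simp add: test_function_outside[of x])
      next
        case True
        have "(m x)\<^sup>2 \<le> B\<^sup>2" using power_mono[OF B(2)[of x] abs_ge_zero, of 2] by simp
        moreover have "1 \<le> inverse (D x) / c" using c pos[of x] True by (simp add: divide_simps mult.commute)
        ultimately have "(m x)\<^sup>2 * 1 \<le> B\<^sup>2 * (inverse (D x) / c)" by (intro mult_mono) auto
        then have "(m x)\<^sup>2 * (u x)\<^sup>2 \<le> B\<^sup>2 * (inverse (D x) / c) * (u x)\<^sup>2" by (intro mult_right_mono) auto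
        then show ?thesis using c(1) pos[of x]
          by (auto simp: indicator_def power_mult_distrib abs_mult mult_ac)
      qed
    qed
    show "(\<lambda>x. (m x * (indicator \<Omega> x * u x))\<^sup>2) \<in> borel_measurable lebesgue"
      by (rule borel_measurable_power[OF borel_measurable_times[OF test_function_lebesgue[OF m] Um]])
  qed
  then show "(\<lambda>x. m x * (indicator \<Omega> x * u x)) \<in> L2 lebesgue"
    using borel_measurable_times[OF test_function_lebesgue[OF m] Um] by (simp add: L2_real_iff)
  fix j :: 'a assume j: "j \<in> Basis"
  let ?g = "weak_gradient \<Omega> u"
  have g: "?g \<in> borel_measurable (lebesgue_on \<Omega>)" "integrable (lebesgue_on \<Omega>) (\<lambda>x. (norm (?g x))\<^sup>2)"
    using form_domainD(3)[OF assms] by (auto simp: L2_def)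
  have Gm: "(\<lambda>x. indicator \<Omega> x *\<^sub>R ?g x) \<in> borel_measurable lebesgue" using g(1) by (simp add: measurable_extension)
  have Gjm: "(\<lambda>x. (indicator \<Omega> x *\<^sub>R ?g x) \<bullet> j) \<in> borel_measurable lebesgue" using Gm by (rule borel_measurable_inner) simp
  have "(\<lambda>x. indicator \<Omega> x * norm (?g x)) \<in> L2 lebesgue"
  proof -
    have "(\<lambda>x. norm (indicator \<Omega> x *\<^sub>R ?g x)) \<in> borel_measurable lebesgue" by (rule measurable_compose[OF Gm]) simp
    moreover have "(\<lambda>x. (indicator \<Omega> x * norm (?g x))\<^sup>2) = (\<lambda>x. indicator \<Omega> x * (norm (?g x))\<^sup>2)"
      by (auto simp: indicator_def fun_eq_iff)
    ultimately show ?thesis using g(2) by (simp add: L2_real_iff integrable_lebesgue_on_eq[OF domain_lebesgue])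
  qed
  then have "(\<lambda>x. (indicator \<Omega> x *\<^sub>R ?g x) \<bullet> j) \<in> L2 lebesgue"
    by (rule L2_dominated[OF _ Gjm])
      (use Basis_le_norm[OF j] in \<open>auto simp: indicator_def\<close>)
  then show "(\<lambda>x. m x * ((indicator \<Omega> x *\<^sub>R ?g x) \<bullet> j)) \<in> L2 lebesgue"
    using B(2) by (intro L2_bounded_mult[OF _ test_function_lebesgue[OF m]])
  show "(\<integral>x. (indicator \<Omega> x *\<^sub>R ?g x) \<bullet> j * m x \<partial>lebesgue) = - (\<integral>x. indicator \<Omega> x * u x * partial_deriv j m x \<partial>lebesgue)"
    using form_domainD(4)[OF assms m j] by (simp add: integral_lebesgue_on_eq[OF domain_lebesgue] mult.assoc)
qed

text \<open>The way back into the form domain, used to admit <x>^(-2s) u as a test function of the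
  form. \<open>weak_gradient\<close> is a choice; uniqueness identifies it with h almost everywhere,
  and it inherits measurability and integrability from h.\<close>

lemma form_domainI:
  assumes uL: "u \<in> L2 \<mu>" and hL: "h \<in> L2 (lebesgue_on \<Omega>)"
    and UH: "whole_space_weak_gradient (\<lambda>x. indicator \<Omega> x * u x) (\<lambda>x. indicator \<Omega> x *\<^sub>R h x)"
  shows "u \<in> form_domain \<Omega> D" and "AE x in lebesgue_on \<Omega>. weak_gradient \<Omega> u x = h x"
proof -
  have um: "u \<in> borel_measurable (lebesgue_on \<Omega>)" and ui: "integrable lebesgue (\<lambda>x. indicator \<Omega> x * (inverse (D x) * (u x)\<^sup>2))"
    using uL by (simp_all add: L2_weighted_iff)
  have hm: "h \<in> borel_measurable (lebesgue_on \<Omega>)" and hi: "integrable (lebesgue_on \<Omega>) (\<lambda>x. (norm (h x))\<^sup>2)"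
    using hL by (auto simp: L2_def)
  have weak: "(\<integral>x. (h x \<bullet> j) * \<phi> x \<partial>lebesgue_on \<Omega>) = - (\<integral>x. u x * partial_deriv j \<phi> x \<partial>lebesgue_on \<Omega>)"
    if "\<phi> \<in> test_functions UNIV" "j \<in> Basis" for \<phi> j
    using whole_space_weak_gradientD(3)[OF UH that] by (simp add: integral_lebesgue_on_eq[OF domain_lebesgue] mult.assoc)
  have lh: "locally_integrable \<Omega> h" and lu: "locally_integrable \<Omega> u"
    unfolding locally_integrable_def
  proof (safe)
    fix K :: "'a set" assume K: "compact K" "K \<subseteq> \<Omega>"
    have KL: "K \<in> sets lebesgue" using K(1) by (simp add: lmeasurable_compact fmeasurableD)
    have mK: "f \<in> borel_measurable (lebesgue_on K)" if "f \<in> borel_measurable (lebesgue_on \<Omega>)" for f :: "'a \<Rightarrow> 'b::real_normed_vector"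
      using measurable_restrict_mono[OF that K(2)] .
    have one: "integrable (lebesgue_on K) (\<lambda>x. 1::real)"
    proof -
      have "integrable lebesgue (indicat_real K)"
        using K(1) emeasure_compact_finite[of K] KL by (intro integrable_real_indicator) (auto simp: compact_imp_closed)
      then show ?thesis using KL by (simp add: integrable_lebesgue_on_eq)
    qed
    have sub: "integrable (lebesgue_on K) f" if f: "integrable (lebesgue_on \<Omega>) f" for f :: "'a \<Rightarrow> real"
    proof -
      have "integrable lebesgue (\<lambda>x. indicator K x *\<^sub>R (indicator \<Omega> x * f x))"
        using f KL by (intro integrable_mult_indicator) (simp_all add: integrable_lebesgue_on_eq[OF domain_lebesgue])
      moreover have "(\<lambda>x. indicator K x *\<^sub>R (indicator \<Omega> x * f x)) = (\<lambda>x. indicator K x * f x)"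
        using K(2) by (auto simp: indicator_def fun_eq_iff)
      ultimately show ?thesis by (subst integrable_lebesgue_on_eq[OF KL]) (simp only:)
    qed
    \<comment> \<open>Constants are integrable on compact sets, so this passes from square
      integrability to integrability.\<close>
    have le: "t \<le> 1 + t\<^sup>2" for t :: real
      using zero_le_power2[of "t - 1"] zero_le_power2[of t] by (simp add: power2_diff) (smt (verit) zero_le_power2)
    show "integrable (lebesgue_on K) h"
    proof (rule Bochner_Integration.integrable_bound)
      show "integrable (lebesgue_on K) (\<lambda>x. 1 + (norm (h x))\<^sup>2)" using one sub[OF hi] by simp
      show "AE x in lebesgue_on K. norm (h x) \<le> norm (1 + (norm (h x))\<^sup>2)"
        using le by (intro AE_I2) (simp add: abs_of_nonneg add_nonneg_nonneg)
    qed (rule mK[OF hm])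
    obtain c where c: "c > 0" "\<And>x. x \<in> K \<Longrightarrow> c * D x \<le> 1" using weight_lower_bound_compact[OF K(1)] by blast
    have ui': "integrable (lebesgue_on \<Omega>) (\<lambda>x. inverse (D x) * (u x)\<^sup>2)"
      using ui by (simp add: integrable_lebesgue_on_eq[OF domain_lebesgue])
    show "integrable (lebesgue_on K) u"
    proof (rule Bochner_Integration.integrable_bound)
      show "integrable (lebesgue_on K) (\<lambda>x. 1 + (inverse (D x) * (u x)\<^sup>2) / c)" using one sub[OF ui'] by simp
      show "AE x in lebesgue_on K. norm (u x) \<le> norm (1 + (inverse (D x) * (u x)\<^sup>2) / c)"
      proof (rule AE_I2)
        fix x assume "x \<in> space (lebesgue_on K)"
        then have "c * D x \<le> 1" using c(2) by simp
        then have "1 * (u x)\<^sup>2 \<le> (inverse (D x) / c) * (u x)\<^sup>2"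
          using c(1) pos[of x] by (intro mult_right_mono) (auto simp: divide_simps mult.commute)
        then show "norm (u x) \<le> norm (1 + (inverse (D x) * (u x)\<^sup>2) / c)"
          using le[of "\<bar>u x\<bar>"] by simp
      qed
    qed (rule mK[OF um])
  qed
  have hwg: "has_weak_gradient \<Omega> u h"
    unfolding has_weak_gradient_def using lh lu weak test_functions_mono[of \<Omega> UNIV] by blast
  then have gw: "has_weak_gradient \<Omega> u (weak_gradient \<Omega> u)" unfolding weak_gradient_def by (rule someI[of "has_weak_gradient \<Omega> u"])
  show AE: "AE x in lebesgue_on \<Omega>. weak_gradient \<Omega> u x = h x"
    by (rule weak_gradient_unique[OF open_domain gw hwg])
  have gm: "weak_gradient \<Omega> u \<in> borel_measurable (lebesgue_on \<Omega>)"
  proof -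
    have "AE x in lebesgue. x \<in> \<Omega> \<longrightarrow> weak_gradient \<Omega> u x = h x"
      using AE domain_lebesgue by (subst (asm) AE_restrict_space_iff) auto
    then have "AE x in lebesgue. indicator \<Omega> x *\<^sub>R h x = indicator \<Omega> x *\<^sub>R weak_gradient \<Omega> u x"
      by eventually_elim (auto simp: indicator_def)
    from borel_measurable_AE[OF _ this] show ?thesis using hm by (simp add: measurable_extension)
  qed
  have "integrable (lebesgue_on \<Omega>) (\<lambda>x. (norm (weak_gradient \<Omega> u x))\<^sup>2)"
    using hi by (rule integrable_cong_AE_imp) (use AE gm in auto)
  with gm have gL: "weak_gradient \<Omega> u \<in> L2 (lebesgue_on \<Omega>)" by (simp add: L2_def)
  have "(\<integral>x. (weak_gradient \<Omega> u x \<bullet> j) * \<phi> x \<partial>lebesgue_on \<Omega>) = - (\<integral>x. u x * partial_deriv j \<phi> x \<partial>lebesgue_on \<Omega>)"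
    if \<phi>: "\<phi> \<in> test_functions UNIV" and "j \<in> Basis" for \<phi> j
  proof -
    have "\<phi> \<in> borel_measurable (lebesgue_on \<Omega>)"
      by (rule measurable_restrict_space1[OF test_function_lebesgue[OF \<phi>]])
    then have "(\<integral>x. (weak_gradient \<Omega> u x \<bullet> j) * \<phi> x \<partial>lebesgue_on \<Omega>) = (\<integral>x. (h x \<bullet> j) * \<phi> x \<partial>lebesgue_on \<Omega>)"
      using AE gm hm by (intro integral_cong_AE) auto
    with weak[OF that] show ?thesis by simp
  qed
  then show "u \<in> form_domain \<Omega> D"
    unfolding form_domain_def H1_dot_def using uL hwg gL by blast
qed

end

section \<open>Weighted energy and Hardy inequalities\<close>

lemma bracket_powr_le_1: "p \<le> 0 \<Longrightarrow> bracket_sq x powr p \<le> 1"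
  using bracket_sq_ge_1[of x] powr_mono[of p 0 "bracket_sq x"] bracket_sq_pos[of x] by simp

lemma bracket_powr_mono: "p \<le> p' \<Longrightarrow> bracket_sq x powr p \<le> bracket_sq x powr p'"
  using bracket_sq_ge_1[of x] by (rule powr_mono[rotated])

lemma bracket_powr_square: "(bracket_sq x powr p)\<^sup>2 = bracket_sq x powr (2 * p)"
  using bracket_sq_pos[of x] by (simp add: power2_eq_square flip: powr_add)

lemma bracket_powr_add: "p + p' = r \<Longrightarrow> bracket_sq x powr p * bracket_sq x powr p' = bracket_sq x powr r"
  by (simp add: powr_add[symmetric])

lemma norm_le_sqrt_bracket: "norm x \<le> bracket_sq x powr (1 / 2)"
  using bracket_sq_pos[of x] by (simp add: powr_half_sqrt bracket_sq_def real_le_rsqrt)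

lemma norm_square_div_bracket: "0 \<le> (norm x)\<^sup>2 / bracket_sq x" "(norm x)\<^sup>2 / bracket_sq x \<le> 1"
  using bracket_sq_pos[of x] by (auto simp: bracket_sq_def divide_simps)

lemma bracket_powr_measurable: "(\<lambda>x. bracket_sq x powr p) \<in> borel_measurable lebesgue"
  by (rule measurable_completion) (simp add: borel_measurable_continuous_onI smooth_continuous smooth_bracket_powr)

text \<open>The behaviour of D at infinity enters the estimates only through a two-sided comparison
  of 1/D with <x>^(-\<alpha>).\<close>

locale growth_domain = weighted_domain +
  fixes \<alpha> c\<^sub>1 c\<^sub>2 :: real
  assumes \<alpha>_less_2: "\<alpha> < 2" and \<alpha>_less_dim: "\<alpha> < real DIM('a)" and dim_ge_2: "DIM('a) \<ge> 2"
    and c\<^sub>1_pos: "c\<^sub>1 > 0" and c\<^sub>2_pos: "c\<^sub>2 > 0"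
    and weight_lower: "\<And>x. c\<^sub>1 * bracket_sq x powr (- \<alpha> / 2) \<le> inverse (D x)"
    and weight_upper: "\<And>x. inverse (D x) \<le> c\<^sub>2 * bracket_sq x powr (- \<alpha> / 2)"
begin

text \<open>The norm of X_s, with <x>^(-s) expressed through \<open>bracket_sq\<close>.\<close>

definition wnorm :: "real \<Rightarrow> ('a \<Rightarrow> real) \<Rightarrow> real" where
  "wnorm s f = L2_norm \<mu> (\<lambda>x. bracket_sq x powr (- s / 2) * f x)"

text \<open>The extra exponent -\<alpha>/4 accounts for dmu: after squaring it is <x>^(-\<alpha>),
  which is comparable to 1/D. The L2 norm on the whole space is thus equivalent to
  \<open>wnorm s f\<close>.\<close>

definition zext :: "real \<Rightarrow> ('a \<Rightarrow> real) \<Rightarrow> 'a \<Rightarrow> real" where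
  "zext s f x = bracket_sq x powr (- s / 2 - \<alpha> / 4) * (indicator \<Omega> x * f x)"

lemma wnorm_nonneg [simp]: "0 \<le> wnorm s f"
  by (simp add: wnorm_def)

lemma wnorm_L2:
  assumes "f \<in> L2 \<mu>" "s \<ge> 0"
  shows "(\<lambda>x. bracket_sq x powr (- s / 2) * f x) \<in> L2 \<mu>"
proof (rule L2_bounded_mult[OF assms(1), where B = 1])
  show "(\<lambda>x. bracket_sq x powr (- s / 2)) \<in> borel_measurable \<mu>"
    unfolding borel_measurable_weighted by (rule measurable_restrict_space1[OF bracket_powr_measurable])
  show "\<bar>bracket_sq x powr (- s / 2)\<bar> \<le> 1" for x
    using bracket_powr_le_1[of "- s / 2" x] assms(2) by simp
qed

lemma
  assumes "f \<in> L2 \<mu>" "s \<ge> 0"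
  shows zext_L2: "zext s f \<in> L2 lebesgue"
    and zext_le_wnorm: "c\<^sub>1 * (L2_norm lebesgue (zext s f))\<^sup>2 \<le> (wnorm s f)\<^sup>2"
    and wnorm_le_zext: "(wnorm s f)\<^sup>2 \<le> c\<^sub>2 * (L2_norm lebesgue (zext s f))\<^sup>2"
proof -
  have fm: "f \<in> borel_measurable (lebesgue_on \<Omega>)" using assms(1) by (simp add: L2_weighted_iff)
  have m: "zext s f \<in> borel_measurable lebesgue"
    unfolding zext_def[abs_def] using fm
    by (intro borel_measurable_times[OF bracket_powr_measurable]) (simp add: measurable_extension)
  let ?W = "\<lambda>x. indicator \<Omega> x * (inverse (D x) * (bracket_sq x powr (- s / 2) * f x)\<^sup>2)"
  have Wi: "integrable lebesgue ?W" using wnorm_L2[OF assms] by (simp add: L2_weighted_iff)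
  have W: "(wnorm s f)\<^sup>2 = (\<integral>x. ?W x \<partial>lebesgue)"
    unfolding wnorm_def L2_norm_power2
    using wnorm_L2[OF assms] by (subst integral_weighted) (auto simp: L2_weighted_iff)
  have sq: "(zext s f x)\<^sup>2 = bracket_sq x powr (- \<alpha> / 2) * (indicator \<Omega> x * (bracket_sq x powr (- s / 2) * f x)\<^sup>2)" for x
  proof -
    have "(zext s f x)\<^sup>2 = bracket_sq x powr (2 * (- s / 2 - \<alpha> / 4)) * (indicator \<Omega> x * (f x)\<^sup>2)"
      by (simp add: zext_def power_mult_distrib bracket_powr_square) (simp add: indicator_def)
    also have "bracket_sq x powr (2 * (- s / 2 - \<alpha> / 4)) = bracket_sq x powr (- \<alpha> / 2) * bracket_sq x powr (2 * (- s / 2))"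
      by (rule bracket_powr_add[symmetric]) simp
    finally show ?thesis by (simp add: power_mult_distrib bracket_powr_square mult_ac)
  qed
  have lo: "c\<^sub>1 * (zext s f x)\<^sup>2 \<le> ?W x" for x
    unfolding sq using mult_right_mono[OF weight_lower[of x], of "indicator \<Omega> x * (bracket_sq x powr (- s / 2) * f x)\<^sup>2"]
    by (simp add: mult_ac)
  have up: "?W x \<le> c\<^sub>2 * (zext s f x)\<^sup>2" for x
    unfolding sq using mult_right_mono[OF weight_upper[of x], of "indicator \<Omega> x * (bracket_sq x powr (- s / 2) * f x)\<^sup>2"]
    by (simp add: mult_ac)
  have zi: "integrable lebesgue (\<lambda>x. (zext s f x)\<^sup>2)"
  proof (rule Bochner_Integration.integrable_bound)
    show "integrable lebesgue (\<lambda>x. ?W x / c\<^sub>1)" using Wi by simp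
    show "AE x in lebesgue. norm ((zext s f x)\<^sup>2) \<le> norm (?W x / c\<^sub>1)"
    proof (rule AE_I2)
      fix x
      have "(zext s f x)\<^sup>2 \<le> ?W x / c\<^sub>1" using lo[of x] c\<^sub>1_pos by (simp add: pos_le_divide_eq mult.commute)
      then show "norm ((zext s f x)\<^sup>2) \<le> norm (?W x / c\<^sub>1)" by (metis abs_ge_self norm_power order_trans power2_abs real_norm_def)
    qed
  qed (use m in measurable)
  with m show "zext s f \<in> L2 lebesgue" by (simp add: L2_real_iff)
  have "(\<integral>x. c\<^sub>1 * (zext s f x)\<^sup>2 \<partial>lebesgue) \<le> (\<integral>x. ?W x \<partial>lebesgue)"
    by (intro integral_mono Wi lo) (use zi in simp)
  then show "c\<^sub>1 * (L2_norm lebesgue (zext s f))\<^sup>2 \<le> (wnorm s f)\<^sup>2" by (simp add: W L2_norm_power2)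
  have "(\<integral>x. ?W x \<partial>lebesgue) \<le> (\<integral>x. c\<^sub>2 * (zext s f x)\<^sup>2 \<partial>lebesgue)"
    by (intro integral_mono Wi up) (use zi in simp)
  then show "(wnorm s f)\<^sup>2 \<le> c\<^sub>2 * (L2_norm lebesgue (zext s f))\<^sup>2" by (simp add: W L2_norm_power2)
qed

definition grad_ext :: "real \<Rightarrow> ('a \<Rightarrow> real) \<Rightarrow> 'a \<Rightarrow> real" where
  "grad_ext s u x = bracket_sq x powr (- s / 2) * (indicator \<Omega> x * norm (weak_gradient \<Omega> u x))"

lemma form_domain_measurable:
  assumes "u \<in> form_domain \<Omega> D"
  shows "(\<lambda>x. indicator \<Omega> x * u x) \<in> borel_measurable lebesgue"
    and "(\<lambda>x. indicator \<Omega> x *\<^sub>R weak_gradient \<Omega> u x) \<in> borel_measurable lebesgue"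
    and "(\<lambda>x. (indicator \<Omega> x *\<^sub>R weak_gradient \<Omega> u x) \<bullet> x) \<in> borel_measurable lebesgue"
proof -
  show "(\<lambda>x. indicator \<Omega> x * u x) \<in> borel_measurable lebesgue"
    using form_domainD(1)[OF assms] by (simp add: L2_weighted_iff measurable_extension)
  show G: "(\<lambda>x. indicator \<Omega> x *\<^sub>R weak_gradient \<Omega> u x) \<in> borel_measurable lebesgue"
    using form_domainD(3)[OF assms] by (simp add: L2_def measurable_extension)
  show "(\<lambda>x. (indicator \<Omega> x *\<^sub>R weak_gradient \<Omega> u x) \<bullet> x) \<in> borel_measurable lebesgue"
    by (rule borel_measurable_inner[OF G]) (rule measurable_completion, simp)
qed

lemma grad_ext_L2:
  assumes "u \<in> form_domain \<Omega> D" "s \<ge> 0"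
  shows "grad_ext s u \<in> L2 lebesgue"
proof -
  have g: "integrable lebesgue (\<lambda>x. indicator \<Omega> x * (norm (weak_gradient \<Omega> u x))\<^sup>2)"
    using form_domainD(3)[OF assms(1)] by (simp add: L2_def integrable_lebesgue_on_eq[OF domain_lebesgue])
  have eq: "(\<lambda>x. norm (indicator \<Omega> x *\<^sub>R weak_gradient \<Omega> u x)) = (\<lambda>x. indicator \<Omega> x * norm (weak_gradient \<Omega> u x))"
    by (auto simp: fun_eq_iff)
  have "(\<lambda>x. norm (indicator \<Omega> x *\<^sub>R weak_gradient \<Omega> u x)) \<in> borel_measurable lebesgue"
    by (rule measurable_compose[OF form_domain_measurable(2)[OF assms(1)]]) simp
  moreover have "(\<lambda>x. indicator \<Omega> x * (norm (weak_gradient \<Omega> u x))\<^sup>2) = (\<lambda>x. (indicator \<Omega> x * norm (weak_gradient \<Omega> u x))\<^sup>2)"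
    by (auto simp: indicator_def fun_eq_iff)
  ultimately have "(\<lambda>x. indicator \<Omega> x * norm (weak_gradient \<Omega> u x)) \<in> L2 lebesgue"
    using g unfolding eq by (simp only: L2_real_iff)
  then show ?thesis
    unfolding grad_ext_def[abs_def]
    by (rule L2_bounded_mult[OF _ bracket_powr_measurable, where B = 1])
      (use bracket_powr_le_1[of "- s / 2"] assms(2) in simp)
qed

text \<open>The radial identity with r = -\<sigma> - \<alpha>/2, whose weight is the square of the
  one in \<open>zext \<sigma>\<close>. Its coefficient N + 2r |x|^2/<x>^2 runs from N at the origin
  to N - 2\<sigma> - \<alpha> at infinity, so \<kappa> below both bounds it from below. On the right
  |x| <= <x> adds one power, and the relation between the exponents shares the total out between the
  gradient and u.\<close>

lemma weighted_Hardy: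
  assumes u: "u \<in> form_domain \<Omega> D"
    and nonneg: "s \<ge> 0" "\<sigma>' \<ge> 0" "\<sigma> \<ge> 0" and \<sigma>: "2 * \<sigma> = s + \<sigma>' + 1 - \<alpha> / 2"
    and \<kappa>: "\<kappa> \<le> real DIM('a)" "\<kappa> \<le> real DIM('a) - 2 * \<sigma> - \<alpha>"
  shows "\<kappa> * (L2_norm lebesgue (zext \<sigma> u))\<^sup>2 \<le> 2 * (L2_norm lebesgue (grad_ext s u) * L2_norm lebesgue (zext \<sigma>' u))"
proof -
  let ?U = "\<lambda>x. indicator \<Omega> x * u x" and ?G = "\<lambda>x. indicator \<Omega> x *\<^sub>R weak_gradient \<Omega> u x"
  note uL = form_domainD(1)[OF u]
  define r where "r = - \<sigma> - \<alpha> / 2"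
  have zsq: "(zext \<sigma> u x)\<^sup>2 = bracket_sq x powr r * (?U x)\<^sup>2" for x
    by (simp add: zext_def power_mult_distrib bracket_powr_square r_def)
  have i1: "integrable lebesgue (\<lambda>x. bracket_sq x powr r * (?U x)\<^sup>2)"
    using zext_L2[OF uL nonneg(3)] by (simp add: L2_real_iff zsq)
  have bnd: "\<bar>bracket_sq x powr r * ?U x * (?G x \<bullet> x)\<bar> \<le> \<bar>grad_ext s u x\<bar> * \<bar>zext \<sigma>' u x\<bar>" for x
  proof -
    have "\<bar>?G x \<bullet> x\<bar> \<le> norm (?G x) * norm x" by (rule Cauchy_Schwarz_ineq2)
    also have "\<dots> \<le> norm (?G x) * bracket_sq x powr (1 / 2)" by (intro mult_left_mono norm_le_sqrt_bracket) simp
    finally have "bracket_sq x powr r * \<bar>?U x\<bar> * \<bar>?G x \<bullet> x\<bar> \<le> bracket_sq x powr r * \<bar>?U x\<bar> * (norm (?G x) * bracket_sq x powr (1 / 2))"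
      by (intro mult_left_mono) auto
    also have "\<dots> = (bracket_sq x powr r * bracket_sq x powr (1 / 2)) * (\<bar>?U x\<bar> * norm (?G x))" by (simp add: mult_ac)
    also have "bracket_sq x powr r * bracket_sq x powr (1 / 2) = bracket_sq x powr (- s / 2) * bracket_sq x powr (- \<sigma>' / 2 - \<alpha> / 4)"
      using \<sigma> unfolding powr_add[symmetric] r_def by (intro arg_cong[where f = "\<lambda>p. bracket_sq x powr p"]) (simp add: field_simps)
    finally show ?thesis
      by (simp add: grad_ext_def zext_def abs_mult mult_ac)
  qed
  have ig: "integrable lebesgue (\<lambda>x. \<bar>grad_ext s u x\<bar> * \<bar>zext \<sigma>' u x\<bar>)"
    using integrable_abs[OF L2_integrable_mult[OF grad_ext_L2[OF u nonneg(1)] zext_L2[OF uL nonneg(2)]]]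
    by (simp add: abs_mult)
  have i2: "integrable lebesgue (\<lambda>x. bracket_sq x powr r * ?U x * (?G x \<bullet> x))"
  proof (rule Bochner_Integration.integrable_bound[OF ig])
    show "(\<lambda>x. bracket_sq x powr r * ?U x * (?G x \<bullet> x)) \<in> borel_measurable lebesgue"
      by (rule borel_measurable_times[OF borel_measurable_times[OF bracket_powr_measurable form_domain_measurable(1)[OF u]]
            form_domain_measurable(3)[OF u]])
  qed (use bnd in auto)
  have "\<kappa> * (L2_norm lebesgue (zext \<sigma> u))\<^sup>2 = (\<integral>x. \<kappa> * (bracket_sq x powr r * (?U x)\<^sup>2) \<partial>lebesgue)"
    by (simp add: L2_norm_power2 zsq)
  also have "\<dots> \<le> (\<integral>x. bracket_sq x powr r * (?U x)\<^sup>2 * (real DIM('a) + 2 * r * ((norm x)\<^sup>2 / bracket_sq x)) \<partial>lebesgue)"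
  proof (rule integral_mono)
    show "integrable lebesgue (\<lambda>x. \<kappa> * (bracket_sq x powr r * (?U x)\<^sup>2))" using i1 by simp
    have km: "(\<lambda>x::'a. (norm x)\<^sup>2 / bracket_sq x) \<in> borel_measurable lebesgue"
      unfolding bracket_sq_def by (rule measurable_completion) simp
    have kb: "\<bar>real DIM('a) + 2 * r * ((norm x)\<^sup>2 / bracket_sq x)\<bar> \<le> real DIM('a) + 2 * \<bar>r\<bar>" for x :: 'a
    proof -
      have "\<bar>r * ((norm x)\<^sup>2 / bracket_sq x)\<bar> \<le> \<bar>r\<bar> * 1"
        unfolding abs_mult using norm_square_div_bracket[of x] by (intro mult_left_mono) (auto simp del: abs_divide)
      then show ?thesis by linarith
    qed
    show "integrable lebesgue (\<lambda>x. bracket_sq x powr r * (?U x)\<^sup>2 * (real DIM('a) + 2 * r * ((norm x)\<^sup>2 / bracket_sq x)))"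
    proof (rule Bochner_Integration.integrable_bound)
      show "integrable lebesgue (\<lambda>x. (bracket_sq x powr r * (?U x)\<^sup>2) * (real DIM('a) + 2 * \<bar>r\<bar>))" using i1 by simp
      show "AE x in lebesgue. norm (bracket_sq x powr r * (?U x)\<^sup>2 * (real DIM('a) + 2 * r * ((norm x)\<^sup>2 / bracket_sq x)))
        \<le> norm ((bracket_sq x powr r * (?U x)\<^sup>2) * (real DIM('a) + 2 * \<bar>r\<bar>))"
      proof (rule AE_I2)
        fix x show "norm (bracket_sq x powr r * (?U x)\<^sup>2 * (real DIM('a) + 2 * r * ((norm x)\<^sup>2 / bracket_sq x)))
          \<le> norm ((bracket_sq x powr r * (?U x)\<^sup>2) * (real DIM('a) + 2 * \<bar>r\<bar>))"
          unfolding norm_mult[of "bracket_sq x powr r * (?U x)\<^sup>2"] using kb[of x] by (intro mult_left_mono) auto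
      qed
      show "(\<lambda>x. bracket_sq x powr r * (?U x)\<^sup>2 * (real DIM('a) + 2 * r * ((norm x)\<^sup>2 / bracket_sq x))) \<in> borel_measurable lebesgue"
        by (intro borel_measurable_times[OF borel_measurable_integrable[OF i1]] borel_measurable_add borel_measurable_const
            borel_measurable_times[OF borel_measurable_const km])
    qed
    show "\<kappa> * (bracket_sq x powr r * (?U x)\<^sup>2) \<le> bracket_sq x powr r * (?U x)\<^sup>2 * (real DIM('a) + 2 * r * ((norm x)\<^sup>2 / bracket_sq x))" for x
    proof -
      let ?k = "(norm x)\<^sup>2 / bracket_sq x"
      \<comment> \<open>The coefficient is a convex combination of its two extreme values with
        parameter |x|^2/<x>^2.\<close>
      have "\<kappa> = \<kappa> * (1 - ?k) + \<kappa> * ?k" by (simp add: algebra_simps)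
      also have "\<dots> \<le> real DIM('a) * (1 - ?k) + (real DIM('a) + 2 * r) * ?k"
        using \<kappa> norm_square_div_bracket[of x] by (intro add_mono mult_right_mono) (auto simp: r_def)
      also have "\<dots> = real DIM('a) + 2 * r * ?k" by (simp only: right_diff_distrib distrib_right)
      finally have "(bracket_sq x powr r * (?U x)\<^sup>2) * \<kappa> \<le> (bracket_sq x powr r * (?U x)\<^sup>2) * (real DIM('a) + 2 * r * ?k)"
        by (intro mult_left_mono) auto
      then show ?thesis by (simp only: mult.commute)
    qed
  qed
  also have "\<dots> = - 2 * (\<integral>x. bracket_sq x powr r * ?U x * (?G x \<bullet> x) \<partial>lebesgue)"
    by (rule radial_identity[OF form_domain_whole_space[OF u] form_domain_measurable(1,3)[OF u] i1 i2])
  also have "\<dots> \<le> 2 * \<bar>\<integral>x. bracket_sq x powr r * ?U x * (?G x \<bullet> x) \<partial>lebesgue\<bar>" by linarith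
  also have "\<bar>\<integral>x. bracket_sq x powr r * ?U x * (?G x \<bullet> x) \<partial>lebesgue\<bar> \<le> (\<integral>x. \<bar>grad_ext s u x\<bar> * \<bar>zext \<sigma>' u x\<bar> \<partial>lebesgue)"
    by (rule integral_abs_bound[THEN order_trans], rule integral_mono[OF integrable_abs[OF i2] ig bnd])
  also have "\<dots> \<le> L2_norm lebesgue (grad_ext s u) * L2_norm lebesgue (zext \<sigma>' u)"
    by (rule L2_Cauchy_Schwarz_abs[OF grad_ext_L2[OF u nonneg(1)] zext_L2[OF uL nonneg(2)]])
  finally show ?thesis by simp
qed

text \<open>Testing with \<rho> u, where \<rho> = <x>^(-2s), produces the weighted gradient norm and
  a cross term, -2s times the integral of <x>^(-2s-2) u x . grad u. By the radial identity with r =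
  -s - 1 the cross term is s times the integral of <x>^(-2s-2) u^2 (N - 2(s + 1)|x|^2/<x>^2),
  nonnegative when 2s <= N - 2. This is superharmonicity of the weight in integrated form.\<close>

lemma weighted_energy:
  assumes u: "u \<in> form_domain \<Omega> D" and f: "f \<in> L2 \<mu>"
    and eq: "\<And>v. v \<in> form_domain \<Omega> D \<Longrightarrow> dirichlet_form \<Omega> u v = L2_inner \<mu> f v"
    and s: "s \<ge> 0" "2 * s \<le> real DIM('a) - 2"
  shows "(L2_norm lebesgue (grad_ext s u))\<^sup>2 \<le> wnorm s f * wnorm s u"
proof -
  let ?U = "\<lambda>x. indicator \<Omega> x * u x" and ?g = "weak_gradient \<Omega> u"
  let ?G = "\<lambda>x. indicator \<Omega> x *\<^sub>R ?g x"
  let ?\<rho> = "\<lambda>x. bracket_sq x powr (- s)"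
  define h where "h = (\<lambda>x. ?\<rho> x *\<^sub>R ?g x + u x *\<^sub>R grad ?\<rho> x)"
  note uL = form_domainD(1)[OF u]
  have UL: "zext 0 u \<in> L2 lebesgue" by (rule zext_L2[OF uL]) simp
  have \<rho>1: "0 \<le> ?\<rho> x" "?\<rho> x \<le> 1" for x :: 'a using bracket_powr_le_1[of "- s" x] s(1) by auto
  have grho: "grad ?\<rho> x = (- 2 * s * bracket_sq x powr (- s - 1)) *\<^sub>R x" for x :: 'a
    using grad_bracket_powr[of "- s" x] by simp
  \<comment> \<open>The gradient of \<rho> decays like <x>^(-2s-1), faster than <x>^(-\<alpha>/2)
    because \<alpha> < 2. Since <x>^(-\<alpha>/2) u is square integrable, so is the second term of
    \<open>h\<close>.\<close>
  have ngrho: "norm (grad ?\<rho> x) \<le> 2 * s * bracket_sq x powr (- \<alpha> / 4)" for x :: 'a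
  proof -
    have "norm (grad ?\<rho> x) = 2 * s * (bracket_sq x powr (- s - 1) * norm x)" unfolding grho using s(1) by (simp add: abs_mult)
    also have "\<dots> \<le> 2 * s * (bracket_sq x powr (- s - 1) * bracket_sq x powr (1 / 2))"
      using s(1) by (intro mult_left_mono norm_le_sqrt_bracket) auto
    also have "\<dots> = 2 * s * bracket_sq x powr (- s - 1 / 2)" by (subst bracket_powr_add[where r = "- s - 1 / 2"]) auto
    also have "\<dots> \<le> 2 * s * bracket_sq x powr (- \<alpha> / 4)"
      using s(1) \<alpha>_less_2 by (intro mult_left_mono bracket_powr_mono) auto
    finally show ?thesis .
  qed
  have \<rho>uL: "(\<lambda>x. ?\<rho> x * u x) \<in> L2 \<mu>" using wnorm_L2[OF uL, of "2 * s"] s(1) by simp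
  have Gm: "?G \<in> borel_measurable lebesgue" by (rule form_domain_measurable(2)[OF u])
  have \<rho>m: "?\<rho> \<in> borel_measurable lebesgue" by (rule bracket_powr_measurable)
  have grm: "grad ?\<rho> \<in> borel_measurable lebesgue"
    by (rule measurable_completion) (simp add: borel_measurable_continuous_onI continuous_grad smooth_bracket_powr)
  have hext: "indicator \<Omega> x *\<^sub>R h x = ?\<rho> x *\<^sub>R ?G x + ?U x *\<^sub>R grad ?\<rho> x" for x
    by (simp add: h_def scaleR_add_right mult.commute)
  have hm: "(\<lambda>x. indicator \<Omega> x *\<^sub>R h x) \<in> borel_measurable lebesgue"
    unfolding hext
    by (intro borel_measurable_add borel_measurable_scaleR[OF \<rho>m Gm] borel_measurable_scaleR[OF form_domain_measurable(1)[OF u] grm])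
  have hb: "norm (indicator \<Omega> x *\<^sub>R h x) \<le> \<bar>grad_ext 0 u x\<bar> + 2 * s * \<bar>zext 0 u x\<bar>" for x
  proof -
    have "norm (indicator \<Omega> x *\<^sub>R h x) \<le> ?\<rho> x * norm (?G x) + \<bar>?U x\<bar> * norm (grad ?\<rho> x)"
      unfolding hext by (rule order_trans[OF norm_triangle_ineq]) simp
    also have "\<dots> \<le> 1 * norm (?G x) + \<bar>?U x\<bar> * (2 * s * bracket_sq x powr (- \<alpha> / 4))"
      by (intro add_mono mult_right_mono mult_left_mono \<rho>1 ngrho) auto
    finally show ?thesis using bracket_sq_pos[of x] by (simp add: grad_ext_def zext_def abs_mult mult_ac)
  qed
  have hL: "h \<in> L2 (lebesgue_on \<Omega>)"
  proof -
    have L: "(\<lambda>x. \<bar>grad_ext 0 u x\<bar> + 2 * s * \<bar>zext 0 u x\<bar>) \<in> L2 lebesgue"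
    proof (rule L2_add[OF _ L2_cmult])
      show "(\<lambda>x. \<bar>grad_ext 0 u x\<bar>) \<in> L2 lebesgue" "(\<lambda>x. \<bar>zext 0 u x\<bar>) \<in> L2 lebesgue"
        using grad_ext_L2[OF u, of 0] UL by (auto simp: L2_real_iff)
    qed
    have nm: "(\<lambda>x. norm (indicator \<Omega> x *\<^sub>R h x)) \<in> borel_measurable lebesgue" by (rule measurable_compose[OF hm]) simp
    have "(\<lambda>x. norm (indicator \<Omega> x *\<^sub>R h x)) \<in> L2 lebesgue"
    proof (rule L2_dominated[OF L nm], rule AE_I2)
      fix x
      have "\<bar>norm (indicator \<Omega> x *\<^sub>R h x)\<bar> \<le> \<bar>grad_ext 0 u x\<bar> + 2 * s * \<bar>zext 0 u x\<bar>" using hb[of x] by (simp only: abs_norm_cancel)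
      also have "\<dots> \<le> \<bar>\<bar>grad_ext 0 u x\<bar> + 2 * s * \<bar>zext 0 u x\<bar>\<bar>" by (rule abs_ge_self)
      finally show "\<bar>norm (indicator \<Omega> x *\<^sub>R h x)\<bar> \<le> \<bar>\<bar>grad_ext 0 u x\<bar> + 2 * s * \<bar>zext 0 u x\<bar>\<bar>" .
    qed
    then have "integrable lebesgue (\<lambda>x. (norm (indicator \<Omega> x *\<^sub>R h x))\<^sup>2)" by (simp only: L2_real_iff)
    moreover have "(\<lambda>x. (norm (indicator \<Omega> x *\<^sub>R h x))\<^sup>2) = (\<lambda>x. indicator \<Omega> x * (norm (h x))\<^sup>2)"
      by (auto simp: indicator_def fun_eq_iff)
    ultimately show ?thesis using hm by (simp add: L2_def measurable_extension integrable_lebesgue_on_eq[OF domain_lebesgue])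
  qed
  have ws: "whole_space_weak_gradient (\<lambda>x. indicator \<Omega> x * (?\<rho> x * u x)) (\<lambda>x. indicator \<Omega> x *\<^sub>R h x)"
    using whole_space_weak_gradient_mult[OF form_domain_whole_space[OF u] smooth_bracket_powr[of "- s"]]
    unfolding hext by (simp add: mult.left_commute)
  note v = form_domainI[OF \<rho>uL hL ws]
  let ?r = "- s - 1"
  have i1: "integrable lebesgue (\<lambda>x. bracket_sq x powr ?r * (?U x)\<^sup>2)"
  proof (rule Bochner_Integration.integrable_bound)
    show "integrable lebesgue (\<lambda>x. (zext 0 u x)\<^sup>2)" using UL by (simp add: L2_real_iff)
    show "AE x in lebesgue. norm (bracket_sq x powr ?r * (?U x)\<^sup>2) \<le> norm ((zext 0 u x)\<^sup>2)"
    proof (rule AE_I2)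
      fix x
      have "bracket_sq x powr ?r * (?U x)\<^sup>2 \<le> bracket_sq x powr (2 * (- \<alpha> / 4)) * (?U x)\<^sup>2"
        using s(1) \<alpha>_less_2 by (intro mult_right_mono bracket_powr_mono) auto
      then show "norm (bracket_sq x powr ?r * (?U x)\<^sup>2) \<le> norm ((zext 0 u x)\<^sup>2)"
        by (simp add: zext_def power_mult_distrib bracket_powr_square)
    qed
    show "(\<lambda>x. bracket_sq x powr ?r * (?U x)\<^sup>2) \<in> borel_measurable lebesgue"
      by (intro borel_measurable_times[OF bracket_powr_measurable] borel_measurable_power form_domain_measurable(1)[OF u])
  qed
  have bnd: "\<bar>bracket_sq x powr ?r * ?U x * (?G x \<bullet> x)\<bar> \<le> \<bar>grad_ext 0 u x\<bar> * \<bar>zext 0 u x\<bar>" for x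
  proof -
    have "\<bar>?G x \<bullet> x\<bar> \<le> norm (?G x) * norm x" by (rule Cauchy_Schwarz_ineq2)
    also have "\<dots> \<le> norm (?G x) * bracket_sq x powr (1 / 2)" by (intro mult_left_mono norm_le_sqrt_bracket) simp
    finally have "bracket_sq x powr ?r * \<bar>?U x\<bar> * \<bar>?G x \<bullet> x\<bar> \<le> bracket_sq x powr ?r * \<bar>?U x\<bar> * (norm (?G x) * bracket_sq x powr (1 / 2))"
      by (intro mult_left_mono) auto
    also have "\<dots> = (bracket_sq x powr ?r * bracket_sq x powr (1 / 2)) * (\<bar>?U x\<bar> * norm (?G x))" by (simp add: mult_ac)
    also have "\<dots> = bracket_sq x powr (- s - 1 / 2) * (\<bar>?U x\<bar> * norm (?G x))"
      by (subst bracket_powr_add[where r = "- s - 1 / 2"]) auto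
    also have "\<dots> \<le> bracket_sq x powr (- \<alpha> / 4) * (\<bar>?U x\<bar> * norm (?G x))"
      using s(1) \<alpha>_less_2 by (intro mult_right_mono bracket_powr_mono) auto
    finally show ?thesis by (simp add: grad_ext_def zext_def abs_mult mult_ac)
  qed
  have ig: "integrable lebesgue (\<lambda>x. \<bar>grad_ext 0 u x\<bar> * \<bar>zext 0 u x\<bar>)"
    using integrable_abs[OF L2_integrable_mult[OF grad_ext_L2[OF u order_refl] UL]]
    by (simp add: abs_mult)
  have i2: "integrable lebesgue (\<lambda>x. bracket_sq x powr ?r * ?U x * (?G x \<bullet> x))"
  proof (rule Bochner_Integration.integrable_bound[OF ig])
    show "(\<lambda>x. bracket_sq x powr ?r * ?U x * (?G x \<bullet> x)) \<in> borel_measurable lebesgue"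
      by (rule borel_measurable_times[OF borel_measurable_times[OF bracket_powr_measurable form_domain_measurable(1)[OF u]]
            form_domain_measurable(3)[OF u]])
  qed (use bnd in auto)
  have "0 \<le> (\<integral>x. bracket_sq x powr ?r * (?U x)\<^sup>2 * (real DIM('a) + 2 * ?r * ((norm x)\<^sup>2 / bracket_sq x)) \<partial>lebesgue)"
  proof (rule Bochner_Integration.integral_nonneg)
    fix x :: 'a
    let ?k = "(norm x)\<^sup>2 / bracket_sq x"
    have "0 \<le> real DIM('a) + 2 * ?r * k" if "k \<le> 1" for k
    proof -
      have "2 * (s + 1) * k \<le> 2 * (s + 1) * 1" using that s(1) by (intro mult_left_mono) auto
      then show ?thesis using s(2) by (simp add: algebra_simps)
    qed
    from this[OF norm_square_div_bracket(2)] have "0 \<le> real DIM('a) + 2 * ?r * ?k" .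
    then show "0 \<le> bracket_sq x powr ?r * (?U x)\<^sup>2 * (real DIM('a) + 2 * ?r * ?k)" by (intro mult_nonneg_nonneg) auto
  qed
  also have "\<dots> = - 2 * (\<integral>x. bracket_sq x powr ?r * ?U x * (?G x \<bullet> x) \<partial>lebesgue)"
    by (rule radial_identity[OF form_domain_whole_space[OF u] form_domain_measurable(1,3)[OF u] i1 i2])
  finally have cross: "0 \<le> - 2 * s * (\<integral>x. bracket_sq x powr ?r * ?U x * (?G x \<bullet> x) \<partial>lebesgue)"
    using s(1) by (simp add: mult_nonneg_nonpos)
  have ge: "integrable lebesgue (\<lambda>x. (grad_ext s u x)\<^sup>2)" using grad_ext_L2[OF u s(1)] by (simp add: L2_real_iff)
  \<comment> \<open>The form is defined with the chosen weak gradient of \<rho> u, which is replaced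
    here by the explicit \<open>h\<close>.\<close>
  have "dirichlet_form \<Omega> u (\<lambda>x. ?\<rho> x * u x) = (\<integral>x. ?g x \<bullet> h x \<partial>lebesgue_on \<Omega>)"
    unfolding dirichlet_form_def
  proof (rule integral_cong_AE)
    have gm: "?g \<in> borel_measurable (lebesgue_on \<Omega>)" "weak_gradient \<Omega> (\<lambda>x. ?\<rho> x * u x) \<in> borel_measurable (lebesgue_on \<Omega>)"
      "h \<in> borel_measurable (lebesgue_on \<Omega>)"
      using form_domainD(3)[OF u] form_domainD(3)[OF v(1)] hL by (auto simp: L2_def)
    then show "(\<lambda>x. ?g x \<bullet> weak_gradient \<Omega> (\<lambda>x. ?\<rho> x * u x) x) \<in> borel_measurable (lebesgue_on \<Omega>)"
      "(\<lambda>x. ?g x \<bullet> h x) \<in> borel_measurable (lebesgue_on \<Omega>)" by (auto intro: borel_measurable_inner)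
    show "AE x in lebesgue_on \<Omega>. ?g x \<bullet> weak_gradient \<Omega> (\<lambda>x. ?\<rho> x * u x) x = ?g x \<bullet> h x"
      using v(2) by eventually_elim simp
  qed
  also have "\<dots> = (\<integral>x. (grad_ext s u x)\<^sup>2 + - 2 * s * (bracket_sq x powr ?r * ?U x * (?G x \<bullet> x)) \<partial>lebesgue)"
    unfolding integral_lebesgue_on_eq[OF domain_lebesgue]
  proof (rule Bochner_Integration.integral_cong[OF refl])
    fix x
    have "(grad_ext s u x)\<^sup>2 = indicator \<Omega> x * (?\<rho> x * (?g x \<bullet> ?g x))"
      by (simp add: grad_ext_def power_mult_distrib bracket_powr_square power2_norm_eq_inner) (simp add: indicator_def)
    then show "indicator \<Omega> x * (?g x \<bullet> h x) = (grad_ext s u x)\<^sup>2 + - 2 * s * (bracket_sq x powr ?r * ?U x * (?G x \<bullet> x))"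
      by (simp add: h_def grho inner_add_right inner_diff_right indicator_def)
  qed
  also have "\<dots> = (L2_norm lebesgue (grad_ext s u))\<^sup>2 + - 2 * s * (\<integral>x. bracket_sq x powr ?r * ?U x * (?G x \<bullet> x) \<partial>lebesgue)"
    using Bochner_Integration.integral_add[OF ge integrable_mult_right[OF i2, of "- 2 * s"]] by (simp add: L2_norm_power2)
  finally have "(L2_norm lebesgue (grad_ext s u))\<^sup>2 \<le> dirichlet_form \<Omega> u (\<lambda>x. ?\<rho> x * u x)" using cross by linarith
  also have "\<dots> = L2_inner \<mu> f (\<lambda>x. ?\<rho> x * u x)" by (rule eq[OF v(1)])
  \<comment> \<open>The weight <x>^(-2s) is shared equally between f and u before
    Cauchy-Schwarz.\<close>
  also have "\<dots> = L2_inner \<mu> (\<lambda>x. bracket_sq x powr (- s / 2) * f x) (\<lambda>x. bracket_sq x powr (- s / 2) * u x)"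
    unfolding L2_inner_def
  proof (rule Bochner_Integration.integral_cong[OF refl])
    fix x :: 'a
    have "?\<rho> x = bracket_sq x powr (- s / 2) * bracket_sq x powr (- s / 2)" by (simp add: powr_add[symmetric])
    then show "f x * (?\<rho> x * u x) = bracket_sq x powr (- s / 2) * f x * (bracket_sq x powr (- s / 2) * u x)"
      by (simp add: mult_ac)
  qed
  also have "\<dots> \<le> wnorm s f * wnorm s u"
    using L2_Cauchy_Schwarz[OF wnorm_L2[OF f s(1)] wnorm_L2[OF uL s(1)]] by (simp add: wnorm_def)
  finally show ?thesis .
qed

text \<open>The energy bound inserted into the Hardy bound. Subcriticality 2\<sigma> < N - \<alpha>
  makes \<kappa> positive; \<open>c\<^sub>1\<close> and \<open>c\<^sub>2\<close> convert between
  \<open>zext\<close> and \<open>wnorm\<close>.\<close>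

lemma wnorm_interpolation:
  assumes s: "s \<ge> 0" "2 * s \<le> real DIM('a) - 2" and \<sigma>': "\<sigma>' \<ge> 0"
    and \<sigma>: "2 * \<sigma> = s + \<sigma>' + 1 - \<alpha> / 2" "2 * \<sigma> < real DIM('a) - \<alpha>"
  obtains C where "C > 0" "\<And>u f. u \<in> form_domain \<Omega> D \<Longrightarrow> f \<in> L2 \<mu> \<Longrightarrow>
    (\<And>v. v \<in> form_domain \<Omega> D \<Longrightarrow> dirichlet_form \<Omega> u v = L2_inner \<mu> f v) \<Longrightarrow>
    (wnorm \<sigma> u)\<^sup>2 \<le> C * (sqrt (wnorm s f * wnorm s u) * wnorm \<sigma>' u)"
proof -
  define \<kappa> where "\<kappa> = min (real DIM('a)) (real DIM('a) - 2 * \<sigma> - \<alpha>)"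
  have \<kappa>: "\<kappa> > 0" "\<kappa> \<le> real DIM('a)" "\<kappa> \<le> real DIM('a) - 2 * \<sigma> - \<alpha>" using \<sigma>(2) by (auto simp: \<kappa>_def)
  have \<sigma>0: "\<sigma> \<ge> 0" using \<sigma>(1) s(1) \<sigma>' \<alpha>_less_2 by linarith
  define C where "C = c\<^sub>2 * (2 / \<kappa>) * (1 / sqrt c\<^sub>1)"
  have "C > 0" using \<kappa>(1) c\<^sub>1_pos c\<^sub>2_pos by (simp add: C_def)
  moreover have "(wnorm \<sigma> u)\<^sup>2 \<le> C * (sqrt (wnorm s f * wnorm s u) * wnorm \<sigma>' u)"
    if u: "u \<in> form_domain \<Omega> D" and f: "f \<in> L2 \<mu>"
      and eq: "\<And>v. v \<in> form_domain \<Omega> D \<Longrightarrow> dirichlet_form \<Omega> u v = L2_inner \<mu> f v" for u f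
  proof -
    note uL = form_domainD(1)[OF u]
    let ?g = "L2_norm lebesgue (grad_ext s u)" and ?z = "L2_norm lebesgue (zext \<sigma>' u)"
    have g: "?g \<le> sqrt (wnorm s f * wnorm s u)"
      using weighted_energy[OF u f eq s] by (rule real_le_rsqrt)
    have "sqrt c\<^sub>1 * ?z \<le> wnorm \<sigma>' u"
      using zext_le_wnorm[OF uL \<sigma>'] c\<^sub>1_pos
      by (intro power2_le_imp_le[OF _ wnorm_nonneg]) (simp add: power_mult_distrib)
    then have z: "?z \<le> 1 / sqrt c\<^sub>1 * wnorm \<sigma>' u" using c\<^sub>1_pos by (simp add: field_simps)
    have "(L2_norm lebesgue (zext \<sigma> u))\<^sup>2 \<le> 2 / \<kappa> * (?g * ?z)"
      using weighted_Hardy[OF u s(1) \<sigma>' \<sigma>0 \<sigma>(1) \<kappa>(2,3)] \<kappa>(1) by (simp add: field_simps)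
    also have "\<dots> \<le> 2 / \<kappa> * (sqrt (wnorm s f * wnorm s u) * (1 / sqrt c\<^sub>1 * wnorm \<sigma>' u))"
      using \<kappa>(1) by (intro mult_left_mono mult_mono g z) auto
    finally have "c\<^sub>2 * (L2_norm lebesgue (zext \<sigma> u))\<^sup>2 \<le> c\<^sub>2 * (2 / \<kappa> * (sqrt (wnorm s f * wnorm s u) * (1 / sqrt c\<^sub>1 * wnorm \<sigma>' u)))"
      using c\<^sub>2_pos by (intro mult_left_mono) auto
    with wnorm_le_zext[OF uL \<sigma>0] show ?thesis by (simp add: C_def mult_ac)
  qed
  ultimately show ?thesis using that by blast
qed

end

section \<open>Symmetric analytic semigroups\<close>

text \<open>Serves the complexified semigroup, whose values are complex functions.\<close>

lemma L2_diff_banach: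
  fixes f g :: "'x \<Rightarrow> 'b::{banach,second_countable_topology}"
  assumes "f \<in> L2 M" "g \<in> L2 M"
  shows "(\<lambda>x. f x - g x) \<in> L2 M"
proof -
  have m: "(\<lambda>x. f x - g x) \<in> borel_measurable M" using assms by (auto simp: L2_def)
  have "integrable M (\<lambda>x. (norm (f x - g x))\<^sup>2)"
  proof (rule Bochner_Integration.integrable_bound)
    show "integrable M (\<lambda>x. 2 * (norm (f x))\<^sup>2 + 2 * (norm (g x))\<^sup>2)" using assms by (auto simp: L2_def)
    show "AE x in M. norm ((norm (f x - g x))\<^sup>2) \<le> norm (2 * (norm (f x))\<^sup>2 + 2 * (norm (g x))\<^sup>2)"
    proof (rule AE_I2)
      fix x
      have "(norm (f x - g x))\<^sup>2 \<le> (norm (f x) + norm (g x))\<^sup>2" by (intro power_mono norm_triangle_ineq4) simp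
      also have "\<dots> \<le> 2 * (norm (f x))\<^sup>2 + 2 * (norm (g x))\<^sup>2"
        using sum_squares_bound[of "norm (f x)" "norm (g x)"] by (simp add: power2_sum)
      finally show "norm ((norm (f x - g x))\<^sup>2) \<le> norm (2 * (norm (f x))\<^sup>2 + 2 * (norm (g x))\<^sup>2)" by simp
    qed
  qed (use m in measurable)
  with m show ?thesis by (simp add: L2_def)
qed

section \<open>Differentiable curves in L2\<close>

lemma L2_tendsto_filter: "L2_tendsto M F f \<F> \<Longrightarrow> filterlim h \<F> \<G> \<Longrightarrow> L2_tendsto M (\<lambda>i. F (h i)) f \<G>"
  unfolding L2_tendsto_def by (rule filterlim_compose)

lemma L2_tendsto_mono: "L2_tendsto M F f \<F> \<Longrightarrow> \<G> \<le> \<F> \<Longrightarrow> L2_tendsto M F f \<G>"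
  unfolding L2_tendsto_def by (rule tendsto_mono)

text \<open>Membership in L2 is asked only near t, since \<open>T t f\<close> is known to lie in L2
  for nonnegative times only.\<close>

definition L2_deriv :: "'x measure \<Rightarrow> (real \<Rightarrow> 'x \<Rightarrow> real) \<Rightarrow> ('x \<Rightarrow> real) \<Rightarrow> real \<Rightarrow> bool" where
  "L2_deriv M U u' t \<longleftrightarrow> U t \<in> L2 M \<and> u' \<in> L2 M \<and> (\<forall>\<^sub>F h in at 0. U (t + h) \<in> L2 M) \<and>
     L2_tendsto M (\<lambda>h x. (U (t + h) x - U t x) / h) u' (at 0)"

lemma L2_quotient: "f \<in> L2 M \<Longrightarrow> g \<in> L2 M \<Longrightarrow> (\<lambda>x. (f x - g x) / (h::real)) \<in> L2 M"
  using L2_cmult[OF L2_diff, of f M g "1 / h"] by simp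

lemma L2_deriv_continuous:
  assumes "L2_deriv M U u' t"
  shows "L2_tendsto M (\<lambda>h. U (t + h)) (U t) (at 0)"
proof -
  have L: "U t \<in> L2 M" "u' \<in> L2 M" "\<forall>\<^sub>F h in at 0. U (t + h) \<in> L2 M"
    and q: "L2_tendsto M (\<lambda>h x. (U (t + h) x - U t x) / h) u' (at 0)"
    using assms by (auto simp: L2_deriv_def)
  have "\<forall>\<^sub>F h in at 0. (\<lambda>x. (U (t + h) x - U t x) / h) \<in> L2 M"
    using L(3) by eventually_elim (use L(1) L2_quotient in blast)
  from L2_tendsto_norm[OF q L(2) this]
  have "((\<lambda>h. \<bar>h\<bar> * L2_norm M (\<lambda>x. (U (t + h) x - U t x) / h)) \<longlongrightarrow> \<bar>0\<bar> * L2_norm M u') (at 0)"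
    by (intro tendsto_mult tendsto_rabs tendsto_ident_at)
  moreover have "\<forall>\<^sub>F h in at 0. \<bar>h\<bar> * L2_norm M (\<lambda>x. (U (t + h) x - U t x) / h) = L2_norm M (\<lambda>x. U (t + h) x - U t x)"
    by (auto simp: eventually_at_filter L2_norm_cmult[symmetric])
  ultimately show ?thesis unfolding L2_tendsto_def
    by (auto intro: Lim_transform_eventually)
qed

lemma L2_inner_DERIV:
  assumes U: "L2_deriv M U u' t" and V: "L2_deriv M V v' t"
  shows "((\<lambda>t. L2_inner M (U t) (V t)) has_real_derivative (L2_inner M u' (V t) + L2_inner M (U t) v')) (at t)"
proof -
  have L: "U t \<in> L2 M" "u' \<in> L2 M" "V t \<in> L2 M" "v' \<in> L2 M"
    and e: "\<forall>\<^sub>F h in at 0. U (t + h) \<in> L2 M" "\<forall>\<^sub>F h in at 0. V (t + h) \<in> L2 M"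
    and q: "L2_tendsto M (\<lambda>h x. (U (t + h) x - U t x) / h) u' (at 0)" "L2_tendsto M (\<lambda>h x. (V (t + h) x - V t x) / h) v' (at 0)"
    using assms by (auto simp: L2_deriv_def)
  have qe: "\<forall>\<^sub>F h in at 0. (\<lambda>x. (U (t + h) x - U t x) / h) \<in> L2 M" "\<forall>\<^sub>F h in at 0. (\<lambda>x. (V (t + h) x - V t x) / h) \<in> L2 M"
    using e(1) by (eventually_elim, use L(1) L2_quotient in blast) (use e(2) in eventually_elim, use L(3) L2_quotient in blast)
  have "((\<lambda>h. L2_inner M (\<lambda>x. (U (t + h) x - U t x) / h) (V (t + h)) + L2_inner M (U t) (\<lambda>x. (V (t + h) x - V t x) / h))
      \<longlongrightarrow> L2_inner M u' (V t) + L2_inner M (U t) v') (at 0)"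
    by (intro tendsto_add L2_inner_tendsto q L2_deriv_continuous[OF V] L2_tendsto_const L e qe always_eventually allI)
  moreover have "\<forall>\<^sub>F h in at 0. L2_inner M (\<lambda>x. (U (t + h) x - U t x) / h) (V (t + h)) + L2_inner M (U t) (\<lambda>x. (V (t + h) x - V t x) / h)
      = (L2_inner M (U (t + h)) (V (t + h)) - L2_inner M (U t) (V t)) / h"
    using e
  proof eventually_elim
    case (elim h)
    have "L2_inner M (\<lambda>x. (U (t + h) x - U t x) / h) (V (t + h)) = (L2_inner M (U (t + h)) (V (t + h)) - L2_inner M (U t) (V (t + h))) / h"
      using L2_inner_cmult_left[of M "1 / h" "\<lambda>x. U (t + h) x - U t x" "V (t + h)"] L2_inner_diff_left[OF elim(1) L(1) elim(2)]
      by simp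
    moreover have "L2_inner M (\<lambda>x. (V (t + h) x - V t x) / h) (U t) = (L2_inner M (V (t + h)) (U t) - L2_inner M (V t) (U t)) / h"
      using L2_inner_cmult_left[of M "1 / h" "\<lambda>x. V (t + h) x - V t x" "U t"] L2_inner_diff_left[OF elim(2) L(3) L(1)]
      by simp
    ultimately show ?case
      by (simp add: L2_inner_commute[of M "V (t + h)" "U t"] L2_inner_commute[of M "V t" "U t"]
          L2_inner_commute[of M "\<lambda>x. (V (t + h) x - V t x) / h" "U t"] add_divide_distrib[symmetric])
  qed
  ultimately show ?thesis unfolding DERIV_def by (rule Lim_transform_eventually)
qed

text \<open>The Dirichlet form enters the abstract theory only through the symmetry and the sign of
  the generator.\<close>

locale symmetric_semigroup =
  fixes M :: "'x measure" and T :: "real \<Rightarrow> ('x \<Rightarrow> real) \<Rightarrow> 'x \<Rightarrow> real"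
  assumes analytic: "analytic_semigroup M T"
    and sym: "\<And>u w u' w'. (u, w) \<in> generator M T \<Longrightarrow> (u', w') \<in> generator M T \<Longrightarrow> L2_inner M w u' = L2_inner M u w'"
    and diss: "\<And>u w. (u, w) \<in> generator M T \<Longrightarrow> L2_inner M w u \<le> 0"
begin

lemma C0: "C0_semigroup M T"
  using analytic by (simp add: analytic_semigroup_def)

lemma T_L2: "t \<ge> 0 \<Longrightarrow> f \<in> L2 M \<Longrightarrow> T t f \<in> L2 M"
  using C0 by (simp add: C0_semigroup_def L2_operator_def)

lemma T_measurable: "t \<ge> 0 \<Longrightarrow> f \<in> L2 M \<Longrightarrow> T t f \<in> borel_measurable M"
  using T_L2 L2_measurable by blast

lemma T_bounded:
  assumes "t \<ge> 0"
  obtains K where "\<And>f. f \<in> L2 M \<Longrightarrow> L2_norm M (T t f) \<le> K * L2_norm M f"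
proof -
  have "L2_operator M (T t)" using C0 assms by (simp add: C0_semigroup_def)
  then show ?thesis using that unfolding L2_operator_def by blast
qed

lemma T_linear:
  "t \<ge> 0 \<Longrightarrow> f \<in> L2 M \<Longrightarrow> g \<in> L2 M \<Longrightarrow> AE x in M. T t (\<lambda>x. a * f x + b * g x) x = a * T t f x + b * T t g x"
  using C0 by (auto simp: C0_semigroup_def L2_operator_def)

lemma T_0: "f \<in> L2 M \<Longrightarrow> AE x in M. T 0 f x = f x"
  using C0 by (simp add: C0_semigroup_def)

lemma T_add: "s \<ge> 0 \<Longrightarrow> t \<ge> 0 \<Longrightarrow> f \<in> L2 M \<Longrightarrow> AE x in M. T (s + t) f x = T s (T t f) x"
  using C0 by (simp add: C0_semigroup_def)

lemma T_initial: "f \<in> L2 M \<Longrightarrow> L2_tendsto M (\<lambda>t. T t f) f (at_right 0)"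
  using C0 by (simp add: C0_semigroup_def)

lemma T_tendsto:
  assumes t: "t \<ge> 0" and F: "L2_tendsto M F f \<F>" "f \<in> L2 M" "\<forall>\<^sub>F i in \<F>. F i \<in> L2 M"
  shows "L2_tendsto M (\<lambda>i. T t (F i)) (T t f) \<F>"
proof -
  obtain K where K: "\<And>f. f \<in> L2 M \<Longrightarrow> L2_norm M (T t f) \<le> K * L2_norm M f" using T_bounded[OF t] by blast
  have "((\<lambda>i. K * L2_norm M (\<lambda>x. F i x - f x)) \<longlongrightarrow> K * 0) \<F>"
    using F(1) unfolding L2_tendsto_def by (intro tendsto_mult tendsto_const)
  then have lim: "((\<lambda>i. K * L2_norm M (\<lambda>x. F i x - f x)) \<longlongrightarrow> 0) \<F>" by simp
  show ?thesis unfolding L2_tendsto_def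
  proof (rule Lim_null_comparison[OF _ lim])
    show "\<forall>\<^sub>F i in \<F>. norm (L2_norm M (\<lambda>x. T t (F i) x - T t f x)) \<le> K * L2_norm M (\<lambda>x. F i x - f x)"
      using F(3)
    proof eventually_elim
      case (elim i)
      have "AE x in M. T t (\<lambda>x. F i x - f x) x = T t (F i) x - T t f x"
        using T_linear[OF t elim F(2), of 1 "-1"] by simp
      then have "L2_norm M (\<lambda>x. T t (F i) x - T t f x) = L2_norm M (T t (\<lambda>x. F i x - f x))"
        using T_measurable[OF t elim] T_measurable[OF t F(2)] T_measurable[OF t L2_diff[OF elim F(2)]]
        by (intro L2_norm_cong_AE) auto
      then show ?case using K[OF L2_diff[OF elim F(2)]] by simp
    qed
  qed
qed

text \<open>A generator describes right difference quotients at 0 only; two-sided derivatives come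
  from the holomorphic extension S. Its complex derivative is restricted to real increments, and
  taking real parts does not increase the norm.\<close>

lemma T_differentiable:
  assumes "t > 0" and f: "f \<in> L2 M"
  shows "\<exists>w. L2_deriv M (\<lambda>t. T t f) w t"
proof -
  obtain \<theta> S where \<theta>: "0 < \<theta>" and SL: "\<forall>z\<in>sector \<theta>. L2_operator M (S z)"
    and ST: "\<forall>t>0. \<forall>f\<in>L2 M. AE x in M. S (complex_of_real t) (\<lambda>y. complex_of_real (f y)) x = complex_of_real (T t f x)"
    and SD: "\<forall>z\<in>sector \<theta>. \<forall>f\<in>L2 M. \<exists>g\<in>L2 M. L2_tendsto M (\<lambda>w x. (S w f x - S z f x) / (w - z)) g (at z)"
    using analytic unfolding analytic_semigroup_def by blast
  define F where "F = (\<lambda>y. complex_of_real (f y))"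
  have FL: "F \<in> L2 M" using f by (auto simp: L2_def F_def)
  have sec: "complex_of_real s \<in> sector \<theta>" if "s > 0" for s
    using that \<theta> by (simp add: sector_def Arg_of_real)
  obtain g where g: "g \<in> L2 M" and lim: "L2_tendsto M (\<lambda>w x. (S w F x - S (complex_of_real t) F x) / (w - complex_of_real t)) g (at (complex_of_real t))"
    using SD sec[OF assms(1)] FL by blast
  have SF: "S (complex_of_real s) F \<in> L2 M" if "s > 0" for s
    using SL sec[OF that] FL by (auto simp: L2_operator_def)
  have fl: "filterlim (\<lambda>h. complex_of_real (t + h)) (at (complex_of_real t)) (at 0)"
    unfolding filterlim_at
  proof
    have "((\<lambda>h. complex_of_real (t + h)) \<longlongrightarrow> complex_of_real (t + 0)) (at 0)" by (intro tendsto_intros)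
    then show "((\<lambda>h. complex_of_real (t + h)) \<longlongrightarrow> complex_of_real t) (at 0)" by simp
    show "\<forall>\<^sub>F h in at 0. complex_of_real (t + h) \<in> UNIV \<and> complex_of_real (t + h) \<noteq> complex_of_real t"
      by (auto simp: eventually_at_filter)
  qed
  note lim' = L2_tendsto_filter[OF lim fl]
  have near: "\<forall>\<^sub>F h in at (0::real). t + h > 0 \<and> h \<noteq> 0"
    unfolding eventually_at using assms(1) by (intro exI[of _ t]) (auto simp: dist_real_def)
  define w where "w = (\<lambda>x. Re (g x))"
  have wm: "w \<in> borel_measurable M" using g by (auto simp: w_def L2_def)
  have wL: "w \<in> L2 M"
  proof -
    have "integrable M (\<lambda>x. (w x)\<^sup>2)"
    proof (rule Bochner_Integration.integrable_bound)
      show "integrable M (\<lambda>x. (norm (g x))\<^sup>2)" using g by (simp add: L2_def)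
      show "AE x in M. norm ((w x)\<^sup>2) \<le> norm ((norm (g x))\<^sup>2)"
        by (intro AE_I2) (simp add: w_def cmod_power2)
    qed (use wm in measurable)
    with wm show ?thesis by (simp add: L2_real_iff)
  qed
  have "L2_tendsto M (\<lambda>h x. (T (t + h) f x - T t f x) / h) w (at 0)"
    unfolding L2_tendsto_def
  proof (rule Lim_null_comparison[OF _ lim'[unfolded L2_tendsto_def]])
    show "\<forall>\<^sub>F h in at 0. norm (L2_norm M (\<lambda>x. (T (t + h) f x - T t f x) / h - w x))
      \<le> L2_norm M (\<lambda>x. (S (complex_of_real (t + h)) F x - S (complex_of_real t) F x) / (complex_of_real (t + h) - complex_of_real t) - g x)"
      using near
    proof eventually_elim
      case (elim h)
      let ?c = "\<lambda>x. (S (complex_of_real (t + h)) F x - S (complex_of_real t) F x) / (complex_of_real (t + h) - complex_of_real t) - g x"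
      let ?r = "\<lambda>x. (T (t + h) f x - T t f x) / h - w x"
      have qL: "(\<lambda>x. (S (complex_of_real (t + h)) F x - S (complex_of_real t) F x) / (complex_of_real (t + h) - complex_of_real t)) \<in> L2 M"
        using L2_diff_banach[OF SF SF, of "t + h" t] elim assms(1)
        by (auto simp: L2_def norm_divide power_divide)
      have cL: "?c \<in> L2 M" by (rule L2_diff_banach[OF qL g])
      have rm: "?r \<in> borel_measurable M"
        using T_measurable[OF _ f, of "t + h"] T_measurable[OF _ f, of t] elim assms(1) wm by auto
      have ae: "AE x in M. \<bar>?r x\<bar> \<le> norm (?c x)"
        using ST[rule_format, of "t + h" f] ST[rule_format, of t f] elim assms(1) f
      proof (simp, elim AE_mp, intro AE_I2 impI)
        fix x assume 1: "S (complex_of_real t + complex_of_real h) (\<lambda>y. complex_of_real (f y)) x = complex_of_real (T (t + h) f x)"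
          and 2: "S (complex_of_real t) (\<lambda>y. complex_of_real (f y)) x = complex_of_real (T t f x)"
        have "?c x = complex_of_real ((T (t + h) f x - T t f x) / h) - g x"
          using 1 2 by (simp add: F_def)
        then have "Re (?c x) = ?r x" by (simp only: w_def minus_complex.sel Re_complex_of_real)
        then show "\<bar>(T (t + h) f x - T t f x) / h - w x\<bar> \<le> cmod ((S (complex_of_real t + complex_of_real h) F x - S (complex_of_real t) F x) / complex_of_real h - g x)"
          using abs_Re_le_cmod[of "?c x"] by simp
      qed
      have "(\<integral>x. (norm (?r x))\<^sup>2 \<partial>M) \<le> (\<integral>x. (norm (?c x))\<^sup>2 \<partial>M)"
      proof (rule integral_mono_AE)
        show c2: "integrable M (\<lambda>x. (norm (?c x))\<^sup>2)" using cL by (simp add: L2_def)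
        show le: "AE x in M. (norm (?r x))\<^sup>2 \<le> (norm (?c x))\<^sup>2"
          using ae by eventually_elim (simp only: real_norm_def power_mono abs_ge_zero)
        show "integrable M (\<lambda>x. (norm (?r x))\<^sup>2)"
          by (rule Bochner_Integration.integrable_bound[OF c2]) (use rm le in auto)
      qed
      then have "L2_norm M ?r \<le> L2_norm M ?c" unfolding L2_norm_def by (rule real_sqrt_le_mono)
      then show ?case by (simp only: real_norm_def abs_of_nonneg[OF L2_norm_nonneg])
    qed
  qed
  moreover have "\<forall>\<^sub>F h in at 0. T (t + h) f \<in> L2 M"
    using near by eventually_elim (use T_L2 f in auto)
  ultimately show ?thesis using T_L2[OF _ f, of t] assms(1) wL unfolding L2_deriv_def by auto
qed

text \<open>The time derivative of \<open>T t f\<close>; by \<open>vel_generator\<close> it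
  represents L T(t) f.\<close>

definition vel :: "real \<Rightarrow> ('x \<Rightarrow> real) \<Rightarrow> 'x \<Rightarrow> real" where
  "vel t f = (SOME w. L2_deriv M (\<lambda>t. T t f) w t)"

lemma vel: "t > 0 \<Longrightarrow> f \<in> L2 M \<Longrightarrow> L2_deriv M (\<lambda>t. T t f) (vel t f) t"
  unfolding vel_def using T_differentiable by (rule someI_ex)

lemma vel_L2: "t > 0 \<Longrightarrow> f \<in> L2 M \<Longrightarrow> vel t f \<in> L2 M"
  using vel by (auto simp: L2_deriv_def)

lemma eventually_at_right_pos: "\<forall>\<^sub>F h in at_right (0::real). h > 0"
  by (simp add: eventually_at_filter)

text \<open>The semigroup law rewrites the right difference quotient of the orbit at t as the one at
  time 0 of the orbit of \<open>T t f\<close>. Hence T(t) maps L2 into the domain of the generator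
  for t > 0.\<close>

lemma vel_generator:
  assumes t: "t > 0" and f: "f \<in> L2 M"
  shows "(T t f, vel t f) \<in> generator M T"
proof -
  have u: "T t f \<in> L2 M" using T_L2 t f by simp
  have w: "vel t f \<in> L2 M" by (rule vel_L2[OF assms])
  have "L2_tendsto M (\<lambda>h x. (T (t + h) f x - T t f x) / h) (vel t f) (at_right 0)"
    using vel[OF assms] by (auto simp: L2_deriv_def intro: L2_tendsto_mono at_le)
  then have "L2_tendsto M (\<lambda>h x. (T h (T t f) x - T t f x) / h) (vel t f) (at_right 0)"
  proof (rule L2_tendsto_cong_AE)
    show "\<forall>\<^sub>F h in at_right 0. AE x in M. (T (t + h) f x - T t f x) / h = (T h (T t f) x - T t f x) / h"
      using eventually_at_right_pos
    proof eventually_elim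
      case (elim h)
      show ?case using T_add[of h t f] elim t f by (auto simp: add.commute elim!: AE_mp)
    qed
    show "\<forall>\<^sub>F h in at_right 0. (\<lambda>x. (T (t + h) f x - T t f x) / h) \<in> borel_measurable M"
      using eventually_at_right_pos by eventually_elim (intro L2_measurable[OF L2_quotient] T_L2, use t f in auto)
    show "\<forall>\<^sub>F h in at_right 0. (\<lambda>x. (T h (T t f) x - T t f x) / h) \<in> borel_measurable M"
      using eventually_at_right_pos by eventually_elim (intro L2_measurable[OF L2_quotient] T_L2, use t f in auto)
  qed (rule L2_measurable[OF w])
  with u w show ?thesis by (simp add: generator_def)
qed

lemma norm_square_DERIV:
  assumes "t > 0" "f \<in> L2 M"
  shows "((\<lambda>t. (L2_norm M (T t f))\<^sup>2) has_real_derivative 2 * L2_inner M (vel t f) (T t f)) (at t)"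
  using L2_inner_DERIV[OF vel[OF assms] vel[OF assms]]
  by (simp add: L2_inner_same L2_inner_commute[of M "T t f" "vel t f"])

lemma norm_decreasing:
  assumes "0 < s" "s \<le> t" "f \<in> L2 M"
  shows "(L2_norm M (T t f))\<^sup>2 \<le> (L2_norm M (T s f))\<^sup>2"
proof (rule DERIV_nonpos_imp_nonincreasing[OF assms(2)])
  fix x assume "s \<le> x" "x \<le> t"
  then have x: "x > 0" using assms(1) by simp
  have "2 * L2_inner M (vel x f) (T x f) \<le> 0" using diss[OF vel_generator[OF x assms(3)]] by simp
  with norm_square_DERIV[OF x assms(3)]
  show "\<exists>y. ((\<lambda>t. (L2_norm M (T t f))\<^sup>2) has_real_derivative y) (at x) \<and> y \<le> 0" by blast
qed

text \<open>For positive times the squared norm is nonincreasing by dissipativity; strong continuity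
  at 0 extends the comparison to the initial datum, where the orbit need not be
  differentiable.\<close>

lemma contraction:
  assumes t: "t \<ge> 0" and f: "f \<in> L2 M"
  shows "L2_norm M (T t f) \<le> L2_norm M f"
proof (cases "t = 0")
  case True
  then show ?thesis
    using L2_norm_cong_AE[OF T_measurable[OF _ f] L2_measurable[OF f] T_0[OF f]] by simp
next
  case False
  have ev: "\<forall>\<^sub>F h in at_right 0. T h f \<in> L2 M"
    using eventually_at_right_pos by eventually_elim (use T_L2 f in auto)
  have lim: "((\<lambda>s. L2_norm M (T s f)) \<longlongrightarrow> L2_norm M f) (at_right 0)"
    by (rule L2_tendsto_norm[OF T_initial[OF f] f ev])
  have "\<forall>\<^sub>F s in at_right 0. s < t" using False t by (simp add: eventually_at_right_less order_tendstoD(2)[OF tendsto_ident_at])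
  with eventually_at_right_pos have "\<forall>\<^sub>F s in at_right 0. L2_norm M (T t f) \<le> L2_norm M (T s f)"
    by eventually_elim (use norm_decreasing[OF _ _ f] in \<open>auto intro: power2_le_imp_le\<close>)
  then show ?thesis by (rule tendsto_lowerbound[OF lim]) simp
qed

text \<open>By symmetry of the generator the derivative of s -> (T(s) f, T(t - s) g) vanishes on (0,
  t). Comparing s = t/2 with the limit s -> 0 gives the symmetry of the semigroup in the form that
  duality requires.\<close>

lemma symmetric_half:
  assumes t: "t > 0" and f: "f \<in> L2 M" and g: "g \<in> L2 M"
  shows "L2_inner M (T (t / 2) f) (T (t / 2) g) = L2_inner M f (T t g)"
proof -
  let ?A = "\<lambda>s. L2_inner M (T s f) (T (t - s) g)"
  have rev: "L2_deriv M (\<lambda>s. T (t - s) g) (\<lambda>x. - vel (t - s) g x) s" if "0 < s" "s < t" for s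
  proof -
    have r: "t - s > 0" using that by simp
    have V: "vel (t - s) g \<in> L2 M" "T (t - s) g \<in> L2 M" "\<forall>\<^sub>F h in at 0. T (t - s + h) g \<in> L2 M"
      "L2_tendsto M (\<lambda>h x. (T (t - s + h) g x - T (t - s) g x) / h) (vel (t - s) g) (at 0)"
      using vel[OF r g] by (auto simp: L2_deriv_def)
    have fl: "filterlim uminus (at 0) (at (0::real))"
      unfolding filterlim_at using tendsto_minus[OF tendsto_ident_at, of "0::real" UNIV] by (auto simp: eventually_at_filter)
    have e: "\<forall>\<^sub>F h in at 0. T (t - (s + h)) g \<in> L2 M"
      using filterlim_iff[THEN iffD1, OF fl, rule_format, OF V(3)] by (simp add: algebra_simps)
    have "((\<lambda>h. L2_norm M (\<lambda>x. (T (t - s + - h) g x - T (t - s) g x) / (- h) - vel (t - s) g x)) \<longlongrightarrow> 0) (at 0)"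
      using L2_tendsto_filter[OF V(4) fl] unfolding L2_tendsto_def .
    moreover have "L2_norm M (\<lambda>x. (T (t - s + - h) g x - T (t - s) g x) / (- h) - vel (t - s) g x) =
        L2_norm M (\<lambda>x. (T (t - (s + h)) g x - T (t - s) g x) / h - - vel (t - s) g x)" for h
    proof -
      have "(a / (- h) - b)\<^sup>2 = (a / h - - b)\<^sup>2" for a b :: real
        by (simp add: power2_eq_square algebra_simps)
      moreover have "t - s + - h = t - (s + h)" by simp
      ultimately show ?thesis by (simp only: L2_norm_def real_norm_def power2_abs)
    qed
    ultimately have "L2_tendsto M (\<lambda>h x. (T (t - (s + h)) g x - T (t - s) g x) / h) (\<lambda>x. - vel (t - s) g x) (at 0)"
      unfolding L2_tendsto_def by (simp only:)
    then show ?thesis using V e L2_cmult[OF V(1), of "-1"] unfolding L2_deriv_def by simp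
  qed
  have "(?A has_real_derivative 0) (at s within {0<..<t})" if "s \<in> {0<..<t}" for s
  proof -
    from that have s: "0 < s" "s < t" by auto
    have "L2_inner M (vel s f) (T (t - s) g) = L2_inner M (T s f) (vel (t - s) g)"
      by (rule sym) (use vel_generator s f g in auto)
    moreover have "L2_inner M (T s f) (\<lambda>x. - vel (t - s) g x) = - L2_inner M (T s f) (vel (t - s) g)"
      by (simp add: L2_inner_def)
    ultimately have "(?A has_real_derivative 0) (at s)"
      using L2_inner_DERIV[OF vel[OF s(1) f] rev[OF s]] by simp
    then show ?thesis by (rule has_field_derivative_at_within)
  qed
  then obtain c where c: "\<And>s. s \<in> {0<..<t} \<Longrightarrow> ?A s = c"
    using has_field_derivative_zero_constant[of "{0<..<t}" ?A] by auto
  have near: "\<forall>\<^sub>F s in at_right 0. 0 < s \<and> s < t"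
    using t eventually_at_right_pos by (simp add: eventually_conj_iff order_tendstoD(2)[OF tendsto_ident_at])
  have "(?A \<longlongrightarrow> L2_inner M f (T t g)) (at_right 0)"
  proof (rule L2_inner_tendsto[OF T_initial[OF f] _ f])
    show "T t g \<in> L2 M" using T_L2 t g by simp
    have fl: "filterlim uminus (at 0) (at_right (0::real))"
      unfolding filterlim_at using tendsto_minus[OF tendsto_ident_at, of "0::real" "{0<..}"] by (auto simp: eventually_at_filter)
    show "L2_tendsto M (\<lambda>s. T (t - s) g) (T t g) (at_right 0)"
      using L2_tendsto_filter[OF L2_deriv_continuous[OF vel[OF t g]] fl] by simp
    show "\<forall>\<^sub>F s in at_right 0. T s f \<in> L2 M" "\<forall>\<^sub>F s in at_right 0. T (t - s) g \<in> L2 M"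
      using near by (eventually_elim, use T_L2 f in auto) (use near in eventually_elim, use T_L2 g in auto)
  qed
  moreover have "(?A \<longlongrightarrow> c) (at_right 0)"
    by (rule tendsto_eventually) (use near c in \<open>auto elim!: eventually_mono\<close>)
  ultimately have "L2_inner M f (T t g) = c" using tendsto_unique[OF trivial_limit_at_right_real] by blast
  moreover have "?A (t / 2) = c" using c[of "t / 2"] t by simp
  ultimately show ?thesis by (simp add: field_simps)
qed

lemma T_symmetric_square:
  assumes "t > 0" "f \<in> L2 M"
  shows "(L2_norm M (T t f))\<^sup>2 = L2_inner M f (T (2 * t) f)"
  using symmetric_half[of "2 * t" f f] assms by (simp add: L2_inner_same)

text \<open>The bounded operator T(t - s) carries difference quotients at s to those at t.
  Velocities thereby become orbits of the semigroup themselves, to which contraction, decay and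
  differentiability apply.\<close>

lemma vel_shift:
  assumes s: "0 < s" "s < t" and f: "f \<in> L2 M"
  shows "AE x in M. vel t f x = T (t - s) (vel s f) x"
proof -
  have V: "vel s f \<in> L2 M" "T s f \<in> L2 M" "\<forall>\<^sub>F h in at 0. T (s + h) f \<in> L2 M"
      "L2_tendsto M (\<lambda>h x. (T (s + h) f x - T s f x) / h) (vel s f) (at 0)"
    using vel[OF s(1) f] by (auto simp: L2_deriv_def)
  have r: "t - s \<ge> 0" using s by simp
  have near: "\<forall>\<^sub>F h in at (0::real). s + h > 0"
    unfolding eventually_at using s by (intro exI[of _ s]) (auto simp: dist_real_def)
  have qe: "\<forall>\<^sub>F h in at 0. (\<lambda>x. (T (s + h) f x - T s f x) / h) \<in> L2 M"
    using V(3) by eventually_elim (use V(2) L2_quotient in blast)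
  have "L2_tendsto M (\<lambda>h. T (t - s) (\<lambda>x. (T (s + h) f x - T s f x) / h)) (T (t - s) (vel s f)) (at 0)"
    by (rule T_tendsto[OF r V(4,1) qe])
  then have 1: "L2_tendsto M (\<lambda>h x. (T (t + h) f x - T t f x) / h) (T (t - s) (vel s f)) (at 0)"
  proof (rule L2_tendsto_cong_AE)
    show "\<forall>\<^sub>F h in at 0. AE x in M. T (t - s) (\<lambda>x. (T (s + h) f x - T s f x) / h) x = (T (t + h) f x - T t f x) / h"
      using near V(3)
    proof eventually_elim
      case (elim h)
      have "AE x in M. T (t - s) (\<lambda>x. (1 / h) * T (s + h) f x + (- 1 / h) * T s f x) x =
          (1 / h) * T (t - s) (T (s + h) f) x + (- 1 / h) * T (t - s) (T s f) x"
        by (rule T_linear[OF r elim(2) V(2)])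
      moreover have "AE x in M. T (t - s + (s + h)) f x = T (t - s) (T (s + h) f) x"
        by (rule T_add) (use r elim f in auto)
      moreover have "AE x in M. T (t - s + s) f x = T (t - s) (T s f) x"
        by (rule T_add) (use r s f in auto)
      ultimately show ?case
        by eventually_elim (simp add: diff_divide_distrib)
    qed
    show "\<forall>\<^sub>F h in at 0. T (t - s) (\<lambda>x. (T (s + h) f x - T s f x) / h) \<in> borel_measurable M"
      using qe by eventually_elim (rule T_measurable[OF r])
    show "\<forall>\<^sub>F h in at 0. (\<lambda>x. (T (t + h) f x - T t f x) / h) \<in> borel_measurable M"
      using near by eventually_elim (intro L2_measurable[OF L2_quotient] T_L2, use s f in auto)
  qed (rule T_measurable[OF r V(1)])
  have 2: "L2_tendsto M (\<lambda>h x. (T (t + h) f x - T t f x) / h) (vel t f) (at 0)"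
    and L: "\<forall>\<^sub>F h in at 0. T (t + h) f \<in> L2 M" "T t f \<in> L2 M"
    using vel[of t f] s f by (auto simp: L2_deriv_def)
  have "\<forall>\<^sub>F h in at 0. (\<lambda>x. (T (t + h) f x - T t f x) / h) \<in> L2 M"
    using L(1) by eventually_elim (use L(2) L2_quotient in blast)
  then show ?thesis
    by (intro L2_tendsto_unique_AE[OF 2 1] T_L2[OF r V(1)] vel_L2) (use s f in auto)
qed

lemma vel_norm_decreasing:
  assumes "0 < s" "s \<le> t" "f \<in> L2 M"
  shows "L2_norm M (vel t f) \<le> L2_norm M (vel s f)"
proof (cases "s = t")
  case False
  then have st: "s < t" using assms(2) by simp
  have "L2_norm M (vel t f) = L2_norm M (T (t - s) (vel s f))"
    by (rule L2_norm_cong_AE[OF _ _ vel_shift[OF assms(1) st assms(3)]];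
        intro L2_measurable vel_L2 T_L2) (use assms st in auto)
  also have "\<dots> \<le> L2_norm M (vel s f)"
    by (rule contraction) (use st assms vel_L2 in auto)
  finally show ?thesis .
qed simp

text \<open>Near t the velocity is the orbit, started at time t/2, of the velocity at t/2, hence
  differentiable. In the product rule symmetry of the generator moves the derivative over, and both
  terms equal |vel t f|^2.\<close>

lemma energy_DERIV:
  assumes t: "t > 0" and f: "f \<in> L2 M"
  shows "((\<lambda>t. L2_inner M (vel t f) (T t f)) has_real_derivative 2 * (L2_norm M (vel t f))\<^sup>2) (at t)"
proof -
  let ?s = "t / 2" let ?w = "vel (t / 2) f"
  have s: "?s > 0" "?s < t" using t by auto
  have w: "?w \<in> L2 M" by (rule vel_L2[OF s(1) f])
  have m: "vel r f \<in> borel_measurable M" if "r > 0" for r using vel_L2[OF that f] L2_measurable by blast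
  have sh: "L2_deriv M (\<lambda>r. T (r - ?s) ?w) (vel ?s ?w) t"
    using vel[OF s(1) w] by (simp add: L2_deriv_def algebra_simps)
  have wt: "AE x in M. T (t - ?s) ?w x = vel t f x" using vel_shift[OF s f] by (auto elim!: AE_mp)
  have "L2_inner M (vel ?s ?w) (T t f) = L2_inner M (T ?s ?w) (vel t f)"
    by (rule sym[OF vel_generator[OF s(1) w] vel_generator[OF t f]])
  moreover have "L2_inner M (T (t - ?s) ?w) (vel t f) = (L2_norm M (vel t f))\<^sup>2"
    using L2_inner_cong_AE[OF _ m[OF t] wt m[OF t]] T_measurable[OF _ w, of "t - ?s"] s by (simp add: L2_inner_same)
  ultimately have D: "((\<lambda>r. L2_inner M (T (r - ?s) ?w) (T r f)) has_real_derivative 2 * (L2_norm M (vel t f))\<^sup>2) (at t)"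
    using L2_inner_DERIV[OF sh vel[OF t f]] by (simp add: field_simps)
  show ?thesis
  proof (rule has_field_derivative_transform_within_open[OF D, where S = "{t / 2<..}"])
    fix r assume "r \<in> {?s<..}"
    then have r: "?s < r" "r > 0" using s by auto
    have "AE x in M. T (r - ?s) ?w x = vel r f x" using vel_shift[OF s(1) r(1) f] by (auto elim!: AE_mp)
    then show "L2_inner M (T (r - ?s) ?w) (T r f) = L2_inner M (vel r f) (T r f)"
      by (rule L2_inner_cong_AE[rotated 2]) (use T_measurable w f m r in auto)
  qed (use s in auto)
qed

text \<open>Let E be the squared norm of T(t) f and e = E'/2, so that e <= 0 and e' = 2 |vel|^2 >=
  0. The mean value theorem on [t/4, t/2] and monotonicity of e bound -e(t/2) by (2/t) |f|^2; on
  [t/2, t], with |vel| nonincreasing, it bounds t |vel t f|^2 by -e(t/2). This yields the constant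
  sqrt 2, rounded up to 2. The first interval starts at t/4 because differentiability is available
  at positive times only.\<close>

lemma smoothing:
  assumes t: "t > 0" and f: "f \<in> L2 M"
  shows "L2_norm M (vel t f) \<le> 2 / t * L2_norm M f"
proof -
  let ?e = "\<lambda>t. L2_inner M (vel t f) (T t f)" and ?E = "\<lambda>t. (L2_norm M (T t f))\<^sup>2"
  have e0: "?e r \<le> 0" if "r > 0" for r by (rule diss[OF vel_generator[OF that f]])
  obtain z where z: "t / 4 < z" "z < t / 2" "?E (t / 2) - ?E (t / 4) = (t / 2 - t / 4) * (2 * ?e z)"
    using MVT2[of "t / 4" "t / 2" ?E "\<lambda>t. 2 * ?e t"] norm_square_DERIV[OF _ f] t by force
  obtain y where y: "t / 2 < y" "y < t" "?e t - ?e (t / 2) = (t - t / 2) * (2 * (L2_norm M (vel y f))\<^sup>2)"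
    using MVT2[of "t / 2" t ?e "\<lambda>t. 2 * (L2_norm M (vel t f))\<^sup>2"] energy_DERIV[OF _ f] t by force
  have "?e z \<le> ?e (t / 2)"
  proof (rule DERIV_nonneg_imp_nondecreasing[of z "t / 2" ?e])
    show "\<exists>d. (?e has_real_derivative d) (at x) \<and> d \<ge> 0" if "z \<le> x" "x \<le> t / 2" for x
      using energy_DERIV[OF _ f, of x] that z(1) t by (intro exI[of _ "2 * (L2_norm M (vel x f))\<^sup>2"]) auto
  qed (use z in simp)
  moreover have "- (t / 2 * ?e z) \<le> ?E (t / 4)"
  proof -
    have "(t / 2 - t / 4) * (2 * ?e z) = t / 2 * ?e z" by (simp add: field_simps)
    with z(3) zero_le_power2[of "L2_norm M (T (t / 2) f)"] show ?thesis by linarith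
  qed
  moreover have "?E (t / 4) \<le> (L2_norm M f)\<^sup>2"
    using contraction[OF _ f, of "t / 4"] t by (intro power_mono) auto
  moreover have "t / 2 * ?e z \<le> t / 2 * ?e (t / 2)" using calculation(1) t by (intro mult_left_mono) auto
  ultimately have a: "- (t / 2 * ?e (t / 2)) \<le> (L2_norm M f)\<^sup>2" by linarith
  have "(L2_norm M (vel t f))\<^sup>2 \<le> (L2_norm M (vel y f))\<^sup>2"
    using vel_norm_decreasing[of y t f] y t f by (intro power_mono) auto
  then have "t * (L2_norm M (vel t f))\<^sup>2 \<le> t * (L2_norm M (vel y f))\<^sup>2" using t by (intro mult_left_mono) auto
  also have "\<dots> \<le> - ?e (t / 2)" using y(3) e0[OF t] by (simp add: field_simps)
  finally have "t / 2 * (t * (L2_norm M (vel t f))\<^sup>2) \<le> t / 2 * (- ?e (t / 2))" using t by (intro mult_left_mono) auto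
  with a have "t / 2 * (t * (L2_norm M (vel t f))\<^sup>2) \<le> (L2_norm M f)\<^sup>2" by simp
  moreover have "(t * L2_norm M (vel t f))\<^sup>2 = 2 * (t / 2 * (t * (L2_norm M (vel t f))\<^sup>2))"
    by (simp add: power2_eq_square)
  moreover have "(2 * L2_norm M f)\<^sup>2 = 4 * (L2_norm M f)\<^sup>2" by (simp add: power_mult_distrib)
  ultimately have "(t * L2_norm M (vel t f))\<^sup>2 \<le> (2 * L2_norm M f)\<^sup>2"
    using zero_le_power2[of "L2_norm M f"] by linarith
  then have "t * L2_norm M (vel t f) \<le> 2 * L2_norm M f" by (rule power2_le_imp_le) simp
  then show ?thesis using t by (simp add: field_simps)
qed

end

section \<open>Decay estimates\<close>

lemma (in weighted_domain) dirichlet_operator_elim: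
  assumes "(u, w) \<in> dirichlet_operator \<Omega> D"
  obtains "u \<in> form_domain \<Omega> D" "(\<lambda>x. - w x) \<in> L2 \<mu>"
    "\<And>v. v \<in> form_domain \<Omega> D \<Longrightarrow> dirichlet_form \<Omega> u v = L2_inner \<mu> (\<lambda>x. - w x) v"
proof -
  obtain f where f: "w = (\<lambda>x. - f x)" "u \<in> form_domain \<Omega> D" "f \<in> L2 \<mu>"
    "\<And>v. v \<in> form_domain \<Omega> D \<Longrightarrow> dirichlet_form \<Omega> u v = L2_inner \<mu> f v"
    using assms unfolding dirichlet_operator_def by blast
  have "(\<lambda>x. - w x) = f" using f(1) by simp
  with f show ?thesis using that by simp
qed

locale decay_setting = growth_domain +
  fixes T :: "real \<Rightarrow> ('a \<Rightarrow> real) \<Rightarrow> 'a \<Rightarrow> real"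
  assumes T_analytic: "analytic_semigroup (weighted_measure \<Omega> D) T"
    and T_generator: "generator (weighted_measure \<Omega> D) T = dirichlet_operator \<Omega> D"

sublocale decay_setting \<subseteq> symmetric_semigroup "weighted_measure \<Omega> D" T
proof
  show "analytic_semigroup \<mu> T" by (rule T_analytic)
  have inner: "L2_inner \<mu> w v = - dirichlet_form \<Omega> u v" if "(u, w) \<in> generator \<mu> T" "v \<in> form_domain \<Omega> D" for u v w
    using that(1) unfolding T_generator
  proof (rule dirichlet_operator_elim)
    assume "\<And>v. v \<in> form_domain \<Omega> D \<Longrightarrow> dirichlet_form \<Omega> u v = L2_inner \<mu> (\<lambda>x. - w x) v"
    from this[OF that(2)] show ?thesis by (simp add: L2_inner_def)
  qed
  have dom: "u \<in> form_domain \<Omega> D" if "(u, w) \<in> generator \<mu> T" for u w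
    using that unfolding T_generator by (rule dirichlet_operator_elim)
  show "L2_inner \<mu> w u' = L2_inner \<mu> u w'" if "(u, w) \<in> generator \<mu> T" "(u', w') \<in> generator \<mu> T" for u w u' w'
    using inner[OF that(1) dom[OF that(2)]] inner[OF that(2) dom[OF that(1)]]
    by (simp add: L2_inner_commute[of _ u w'] dirichlet_form_def inner_commute)
  show "L2_inner \<mu> w u \<le> 0" if "(u, w) \<in> generator \<mu> T" for u w
    using inner[OF that dom[OF that]] by (simp add: dirichlet_form_def)
qed

context decay_setting
begin

text \<open>The rate is that of the scaling |x|^(2-\<alpha>) ~ t of the equation far out, where D
  behaves like |x|^\<alpha>.\<close>

definition decay :: "real \<Rightarrow> bool" where
  "decay \<sigma> \<longleftrightarrow> (\<exists>C\<ge>0. \<forall>f\<in>L2 \<mu>. \<forall>t>0. wnorm \<sigma> (T t f) \<le> C * t powr (- \<sigma> / (2 - \<alpha>)) * L2_norm \<mu> f)"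

lemma wnorm_0: "wnorm 0 f = L2_norm \<mu> f"
proof -
  have "bracket_sq x powr (- 0 / 2) * f x = f x" for x using bracket_sq_pos[of x] by simp
  then show ?thesis by (simp only: wnorm_def)
qed

lemma decay_0: "decay 0"
  unfolding decay_def using contraction by (intro exI[of _ 1]) (auto simp: wnorm_0)

lemma wnorm_le_norm:
  assumes "f \<in> L2 \<mu>" "s \<ge> 0"
  shows "wnorm s f \<le> L2_norm \<mu> f"
  unfolding wnorm_def
proof (rule L2_norm_mono_AE[OF assms(1) L2_measurable[OF wnorm_L2[OF assms]]])
  show "AE x in \<mu>. \<bar>bracket_sq x powr (- s / 2) * f x\<bar> \<le> \<bar>f x\<bar>"
  proof (rule AE_I2)
    fix x
    have "bracket_sq x powr (- s / 2) * \<bar>f x\<bar> \<le> 1 * \<bar>f x\<bar>"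
      using bracket_powr_le_1[of "- s / 2" x] assms(2) by (intro mult_right_mono) auto
    then show "\<bar>bracket_sq x powr (- s / 2) * f x\<bar> \<le> \<bar>f x\<bar>" by (simp add: abs_mult)
  qed
qed

lemma wnorm_cong_AE:
  assumes "f \<in> L2 \<mu>" "g \<in> L2 \<mu>" "s \<ge> 0" "AE x in \<mu>. f x = g x"
  shows "wnorm s f = wnorm s g"
  unfolding wnorm_def
  by (rule L2_norm_cong_AE[OF L2_measurable[OF wnorm_L2[OF assms(1,3)]] L2_measurable[OF wnorm_L2[OF assms(2,3)]]])
    (use assms(4) in auto)

text \<open>Where <x>^2 <= R the norm with weight \<sigma> takes over, elsewhere the plain norm; R
  is free and is later matched to t.\<close>

lemma wnorm_split:
  assumes f: "f \<in> L2 \<mu>" and s: "0 \<le> \<sigma>'" "\<sigma>' \<le> \<sigma>" and "R > 0"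
  shows "(wnorm \<sigma>' f)\<^sup>2 \<le> R powr (\<sigma> - \<sigma>') * (wnorm \<sigma> f)\<^sup>2 + R powr (- \<sigma>') * (L2_norm \<mu> f)\<^sup>2"
proof -
  have sq: "(bracket_sq x powr (- p / 2) * f x)\<^sup>2 = bracket_sq x powr (- p) * (f x)\<^sup>2" for p x
    by (simp add: power_mult_distrib bracket_powr_square)
  have i: "integrable \<mu> (\<lambda>x. bracket_sq x powr (- p) * (f x)\<^sup>2)" if "p \<ge> 0" for p
    using wnorm_L2[OF f that] unfolding L2_real_iff sq by blast
  have i0: "integrable \<mu> (\<lambda>x. (f x)\<^sup>2)" using f by (simp add: L2_real_iff)
  have pw: "bracket_sq x powr (- \<sigma>') \<le> R powr (\<sigma> - \<sigma>') * bracket_sq x powr (- \<sigma>) + R powr (- \<sigma>')" for x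
  proof (cases "bracket_sq x \<le> R")
    case True
    have "bracket_sq x powr (- \<sigma>') = bracket_sq x powr (\<sigma> - \<sigma>') * bracket_sq x powr (- \<sigma>)"
      by (rule bracket_powr_add[symmetric]) simp
    also have "\<dots> \<le> R powr (\<sigma> - \<sigma>') * bracket_sq x powr (- \<sigma>)"
      using True s bracket_sq_pos[of x] by (intro mult_right_mono powr_mono2) auto
    finally show ?thesis using powr_ge_zero[of R "- \<sigma>'"] by linarith
  next
    case False
    then have "bracket_sq x powr (- \<sigma>') \<le> R powr (- \<sigma>')"
      using s \<open>R > 0\<close> by (intro powr_mono2') auto
    moreover have "0 \<le> R powr (\<sigma> - \<sigma>') * bracket_sq x powr (- \<sigma>)" by simp
    ultimately show ?thesis by linarith
  qed
  have "(wnorm \<sigma>' f)\<^sup>2 = (\<integral>x. bracket_sq x powr (- \<sigma>') * (f x)\<^sup>2 \<partial>\<mu>)"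
    unfolding wnorm_def L2_norm_power2 real_norm_def power2_abs sq ..
  also have "\<dots> \<le> (\<integral>x. R powr (\<sigma> - \<sigma>') * (bracket_sq x powr (- \<sigma>) * (f x)\<^sup>2) + R powr (- \<sigma>') * (f x)\<^sup>2 \<partial>\<mu>)"
  proof (rule integral_mono)
    fix x
    show "bracket_sq x powr (- \<sigma>') * (f x)\<^sup>2 \<le> R powr (\<sigma> - \<sigma>') * (bracket_sq x powr (- \<sigma>) * (f x)\<^sup>2) + R powr (- \<sigma>') * (f x)\<^sup>2"
      using mult_right_mono[OF pw[of x], of "(f x)\<^sup>2"] by (simp add: distrib_right mult.assoc)
  qed (use i i0 s in auto)
  also have "\<dots> = R powr (\<sigma> - \<sigma>') * (\<integral>x. bracket_sq x powr (- \<sigma>) * (f x)\<^sup>2 \<partial>\<mu>) + R powr (- \<sigma>') * (\<integral>x. (f x)\<^sup>2 \<partial>\<mu>)"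
    using i[of \<sigma>] i0 s by simp
  finally show ?thesis unfolding wnorm_def L2_norm_power2 real_norm_def power2_abs sq .
qed

text \<open>Interpolation between decay with weight \<sigma> and contraction.\<close>

lemma decay_mono:
  assumes d: "decay \<sigma>" and s: "0 \<le> \<sigma>'" "\<sigma>' \<le> \<sigma>"
  shows "decay \<sigma>'"
proof -
  define a where "a = 1 / (2 - \<alpha>)"
  have e: "- p / (2 - \<alpha>) = - (p * a)" for p by (simp add: a_def)
  obtain C where C: "C \<ge> 0" "\<And>f t. f \<in> L2 \<mu> \<Longrightarrow> t > 0 \<Longrightarrow> wnorm \<sigma> (T t f) \<le> C * t powr (- \<sigma> / (2 - \<alpha>)) * L2_norm \<mu> f"
    using d unfolding decay_def by blast
  have "wnorm \<sigma>' (T t f) \<le> sqrt (C\<^sup>2 + 1) * t powr (- \<sigma>' / (2 - \<alpha>)) * L2_norm \<mu> f" if f: "f \<in> L2 \<mu>" and t: "t > 0" for f t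
  proof (rule power2_le_imp_le)
    \<comment> \<open>R is the square of the length scale t^(1/(2-\<alpha>)); with it both parts of
      the split are of size t^(-2\<sigma>'/(2-\<alpha>)).\<close>
    let ?n = "L2_norm \<mu> f" let ?R = "t powr (2 * a)"
    have R: "?R > 0" using t by simp
    have u: "T t f \<in> L2 \<mu>" using T_L2 f t by simp
    have t2: "(t powr p)\<^sup>2 = t powr (2 * p)" for p using t by (simp add: power2_eq_square powr_add[symmetric])
    have "(wnorm \<sigma>' (T t f))\<^sup>2 \<le> ?R powr (\<sigma> - \<sigma>') * (wnorm \<sigma> (T t f))\<^sup>2 + ?R powr (- \<sigma>') * (L2_norm \<mu> (T t f))\<^sup>2"
      by (rule wnorm_split[OF u s R])
    also have "\<dots> \<le> ?R powr (\<sigma> - \<sigma>') * (C * t powr (- (\<sigma> * a)) * ?n)\<^sup>2 + ?R powr (- \<sigma>') * ?n\<^sup>2"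
      using C(2)[OF f t, unfolded e] contraction[OF _ f, of t] t by (intro add_mono mult_left_mono power_mono) auto
    also have "?R powr (\<sigma> - \<sigma>') * (C * t powr (- (\<sigma> * a)) * ?n)\<^sup>2 = C\<^sup>2 * ?n\<^sup>2 * (?R powr (\<sigma> - \<sigma>') * t powr (2 * - (\<sigma> * a)))"
      by (simp only: power_mult_distrib t2 mult_ac)
    also have "?R powr (\<sigma> - \<sigma>') * t powr (2 * - (\<sigma> * a)) = t powr (2 * - (\<sigma>' * a))"
      unfolding powr_powr powr_add[symmetric] by (rule arg_cong[where f = "\<lambda>p. t powr p"]) (simp add: algebra_simps)
    also have "?R powr (- \<sigma>') = t powr (2 * - (\<sigma>' * a))"
      unfolding powr_powr by (rule arg_cong[where f = "\<lambda>p. t powr p"]) (simp add: algebra_simps)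
    also have "C\<^sup>2 * ?n\<^sup>2 * t powr (2 * - (\<sigma>' * a)) + t powr (2 * - (\<sigma>' * a)) * ?n\<^sup>2 = (sqrt (C\<^sup>2 + 1) * t powr (- (\<sigma>' * a)) * ?n)\<^sup>2"
      by (simp only: power_mult_distrib t2) (simp add: algebra_simps)
    finally show "(wnorm \<sigma>' (T t f))\<^sup>2 \<le> (sqrt (C\<^sup>2 + 1) * t powr (- \<sigma>' / (2 - \<alpha>)) * ?n)\<^sup>2" by (simp only: e)
  qed simp
  then show ?thesis unfolding decay_def by (intro exI[of _ "sqrt (C\<^sup>2 + 1)"]) auto
qed

text \<open>The interpolation inequality for u = T(t) f calls for decay of L u in X_s. As L T(t) f =
  T(t/2) L T(t/2) f, one half of the time supplies the decay from \<open>ds\<close> and the other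
  the factor 1/t from smoothing. The square root turns 1/t into t^(-1/2), the rate belonging to the
  term 1 - \<alpha>/2 in 2\<sigma>.\<close>

lemma decay_step:
  assumes ds: "decay s" and s: "s \<ge> 0" "2 * s \<le> real DIM('a) - 2"
    and d\<sigma>': "decay \<sigma>'" and \<sigma>': "\<sigma>' \<ge> 0"
    and \<sigma>: "2 * \<sigma> = s + \<sigma>' + 1 - \<alpha> / 2" "2 * \<sigma> < real DIM('a) - \<alpha>"
  shows "decay \<sigma>"
proof -
  define a where "a = 1 / (2 - \<alpha>)"
  have e: "- p / (2 - \<alpha>) = - (p * a)" for p by (simp add: a_def)
  have a2: "a * (1 - \<alpha> / 2) = 1 / 2" using \<alpha>_less_2 by (simp add: a_def field_simps)
  obtain K where K: "K > 0" "\<And>u f. u \<in> form_domain \<Omega> D \<Longrightarrow> f \<in> L2 \<mu> \<Longrightarrow>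
    (\<And>v. v \<in> form_domain \<Omega> D \<Longrightarrow> dirichlet_form \<Omega> u v = L2_inner \<mu> f v) \<Longrightarrow>
    (wnorm \<sigma> u)\<^sup>2 \<le> K * (sqrt (wnorm s f * wnorm s u) * wnorm \<sigma>' u)"
    using wnorm_interpolation[OF s \<sigma>' \<sigma>] by blast
  obtain A where A: "A \<ge> 0" "\<And>f t. f \<in> L2 \<mu> \<Longrightarrow> t > 0 \<Longrightarrow> wnorm s (T t f) \<le> A * t powr (- (s * a)) * L2_norm \<mu> f"
    using ds unfolding decay_def e by blast
  obtain B where B: "B \<ge> 0" "\<And>f t. f \<in> L2 \<mu> \<Longrightarrow> t > 0 \<Longrightarrow> wnorm \<sigma>' (T t f) \<le> B * t powr (- (\<sigma>' * a)) * L2_norm \<mu> f"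
    using d\<sigma>' unfolding decay_def e by blast
  \<comment> \<open>The first A and 2^(s a) come from decay over the time t/2, and 4 = 2/(1/2) from
    smoothing at t/2; the last A belongs to u itself.\<close>
  define P where "P = A * 2 powr (s * a) * 4 * A"
  have P: "P \<ge> 0" using A(1) by (simp add: P_def)
  define C where "C = sqrt (K * (sqrt P * B))"
  have C: "C \<ge> 0" using K(1) P B(1) by (simp add: C_def)
  have "wnorm \<sigma> (T t f) \<le> C * t powr (- (\<sigma> * a)) * L2_norm \<mu> f" if f: "f \<in> L2 \<mu>" and t: "t > 0" for f t
  proof (rule power2_le_imp_le)
    let ?n = "L2_norm \<mu> f" let ?u = "T t f" let ?v = "vel t f"
    have t2: "t / 2 > 0" "t / 2 < t" using t by auto
    have v2: "vel (t / 2) f \<in> L2 \<mu>" and vL: "?v \<in> L2 \<mu>" using vel_L2 f t by auto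
    have T2: "T (t - t / 2) (vel (t / 2) f) \<in> L2 \<mu>" using T_L2 v2 t by simp
    have "wnorm s ?v = wnorm s (T (t - t / 2) (vel (t / 2) f))"
      by (rule wnorm_cong_AE[OF vL T2 s(1) vel_shift[OF t2 f]])
    also have "\<dots> \<le> A * (t - t / 2) powr (- (s * a)) * L2_norm \<mu> (vel (t / 2) f)"
      using A(2)[OF v2, of "t - t / 2"] t by simp
    also have "\<dots> \<le> A * (t - t / 2) powr (- (s * a)) * (2 / (t / 2) * ?n)"
      using A(1) by (intro mult_left_mono smoothing t2 f) auto
    also have "(t - t / 2) powr (- (s * a)) = t powr (- (s * a)) * 2 powr (s * a)"
    proof -
      have "t - t / 2 = t / 2" by simp
      moreover have "(t / 2) powr (- (s * a)) = t powr (- (s * a)) / 2 powr (- (s * a))" by (rule powr_divide)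
      moreover have "2 powr (- (s * a)) = inverse (2 powr (s * a))" by (rule powr_minus)
      moreover have "x / inverse y = x * y" for x y :: real by (simp only: divide_inverse inverse_inverse_eq)
      ultimately show ?thesis by (simp only:)
    qed
    also have "2 / (t / 2) = 4 * t powr (- 1)" using t by (simp add: powr_minus_divide)
    finally have v: "wnorm s ?v \<le> (A * 2 powr (s * a) * 4) * (t powr (- (s * a)) * t powr (- 1)) * ?n"
      by (simp add: mult_ac)
    have wm: "wnorm s (\<lambda>x. - ?v x) = wnorm s ?v" by (simp add: wnorm_def L2_norm_def)
    have "wnorm s ?v * wnorm s ?u \<le> ((A * 2 powr (s * a) * 4) * (t powr (- (s * a)) * t powr (- 1)) * ?n) * (A * t powr (- (s * a)) * ?n)"
      using A(1) by (intro mult_mono v A(2) f t) auto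
    also have "\<dots> = P * (t powr (- (s * a)) * t powr (- (s * a)) * t powr (- 1)) * ?n\<^sup>2"
      by (simp add: P_def power2_eq_square mult_ac)
    also have "t powr (- (s * a)) * t powr (- (s * a)) * t powr (- 1) = (t powr (- (s * a) - 1 / 2))\<^sup>2"
      unfolding power2_eq_square powr_add[symmetric] by (rule arg_cong[where f = "\<lambda>p. t powr p"]) simp
    finally have "sqrt (wnorm s ?v * wnorm s ?u) \<le> sqrt (P * (t powr (- (s * a) - 1 / 2))\<^sup>2 * ?n\<^sup>2)"
      by (rule real_sqrt_le_mono)
    also have "\<dots> = sqrt P * t powr (- (s * a) - 1 / 2) * ?n" by (simp add: real_sqrt_mult)
    finally have q: "sqrt (wnorm s ?v * wnorm s ?u) \<le> sqrt P * t powr (- (s * a) - 1 / 2) * ?n" .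
    have "(wnorm \<sigma> ?u)\<^sup>2 \<le> K * (sqrt (wnorm s (\<lambda>x. - ?v x) * wnorm s ?u) * wnorm \<sigma>' ?u)"
    proof (rule dirichlet_operator_elim)
      show "(?u, ?v) \<in> dirichlet_operator \<Omega> D" using vel_generator[OF t f] by (simp add: T_generator)
    qed (rule K(2))
    also have "\<dots> \<le> K * ((sqrt P * t powr (- (s * a) - 1 / 2) * ?n) * (B * t powr (- (\<sigma>' * a)) * ?n))"
      unfolding wm using K(1) P by (intro mult_left_mono mult_mono q B(2) f t) auto
    also have "\<dots> = K * (sqrt P * B) * (t powr (- (s * a) - 1 / 2) * t powr (- (\<sigma>' * a))) * ?n\<^sup>2"
      by (simp add: power2_eq_square mult_ac)
    also have "t powr (- (s * a) - 1 / 2) * t powr (- (\<sigma>' * a)) = (t powr (- (\<sigma> * a)))\<^sup>2"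
    proof -
      have "2 * (\<sigma> * a) = (s + \<sigma>' + 1 - \<alpha> / 2) * a" using \<sigma>(1) by (simp flip: mult.assoc)
      also have "\<dots> = s * a + \<sigma>' * a + a * (1 - \<alpha> / 2)" by (simp add: algebra_simps)
      finally have "- (s * a) - 1 / 2 + - (\<sigma>' * a) = - (\<sigma> * a) + - (\<sigma> * a)" unfolding a2 by linarith
      then show ?thesis unfolding power2_eq_square powr_add[symmetric] by (rule arg_cong[where f = "\<lambda>p. t powr p"])
    qed
    also have "K * (sqrt P * B) * (t powr (- (\<sigma> * a)))\<^sup>2 * ?n\<^sup>2 = (C * t powr (- (\<sigma> * a)) * ?n)\<^sup>2"
      using K(1) P B(1) by (simp add: C_def power_mult_distrib)
    finally show "(wnorm \<sigma> ?u)\<^sup>2 \<le> (C * t powr (- (\<sigma> * a)) * ?n)\<^sup>2" .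
  qed (use C in simp)
  then show ?thesis using C unfolding decay_def e by blast
qed

text \<open>By \<open>decay_mono\<close> the exponents with decay form an interval starting at 0. If
  its supremum S stayed below the critical value, a step from exponents just under S would pass S.
  The supremum replaces a count of iterations.\<close>

theorem decay_subcritical:
  assumes "\<sigma> \<ge> 0" "2 * \<sigma> < real DIM('a) - \<alpha>"
  shows "decay \<sigma>"
proof (rule ccontr)
  assume not: "\<not> decay \<sigma>"
  define A where "A = {s. 0 \<le> s \<and> 2 * s < real DIM('a) - \<alpha> \<and> decay s}"
  have A0: "0 \<in> A" using decay_0 \<alpha>_less_dim by (simp add: A_def)
  have ub: "s \<le> \<sigma>" if "s \<in> A" for s
    using that not decay_mono[of s \<sigma>] assms(1) unfolding A_def by (cases "s \<le> \<sigma>") auto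
  have bdd: "bdd_above A" using ub by (auto simp: bdd_above_def)
  define S where "S = Sup A"
  have S: "0 \<le> S" "S \<le> \<sigma>"
    unfolding S_def by (rule cSup_upper[OF A0 bdd], rule cSup_least) (use A0 ub in auto)
  have below: "decay s" if s: "0 \<le> s" "s < S" for s
  proof -
    obtain s' where "s' \<in> A" "s < s'" using less_cSupD[of A s] s(2) A0 unfolding S_def by blast
    then show ?thesis using decay_mono[of s' s] s(1) unfolding A_def by simp
  qed
  define n where "n = (real DIM('a) - 2) / 2"
  have n: "n \<ge> 0" using dim_ge_2 by (simp add: n_def)
  define m where "m = min S n"
  \<comment> \<open>The gain of a step is governed by m - S + 1 - \<alpha>/2. This equals the first
    entry if m = S, and if m = n the second, the distance of S to the critical exponent n + 1 -
    \<alpha>/2.\<close>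
  define gap where "gap = min (1 - \<alpha> / 2) ((real DIM('a) - \<alpha>) / 2 - S)"
  have gap: "gap > 0" using \<alpha>_less_2 S(2) assms(2) by (simp add: gap_def)
  \<comment> \<open>Decay is known strictly below S only, hence the retreat by gap/4; done twice it
    still leaves \<tau> >= S + gap/4. The cap m keeps s in the superharmonic range, and
    \<open>max 0\<close> falls back on \<open>decay_0\<close>.\<close>
  define s where "s = max 0 (m - gap / 4)"
  define \<sigma>' where "\<sigma>' = max 0 (S - gap / 4)"
  define \<tau> where "\<tau> = (s + \<sigma>' + 1 - \<alpha> / 2) / 2"
  have m: "0 \<le> m" "m \<le> S" "m \<le> n" using S(1) n by (auto simp: m_def)
  have s: "0 \<le> s" "s \<le> m" "s \<ge> m - gap / 4" using m gap by (auto simp: s_def)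
  have \<sigma>': "0 \<le> \<sigma>'" "\<sigma>' \<le> S" "\<sigma>' \<ge> S - gap / 4" using S gap by (auto simp: \<sigma>'_def)
  have ds: "decay s" using below[of s] decay_0 s m gap by (cases "s = 0") (auto simp: s_def)
  have d\<sigma>': "decay \<sigma>'" using below[of \<sigma>'] decay_0 gap by (cases "\<sigma>' = 0") (auto simp: \<sigma>'_def)
  have nm: "n + 1 - \<alpha> / 2 = (real DIM('a) - \<alpha>) / 2" by (simp add: n_def field_simps)
  have gm: "gap \<le> m - S + 1 - \<alpha> / 2"
    using nm unfolding gap_def m_def by linarith
  have \<tau>S: "\<tau> > S" using s(3) \<sigma>'(3) gm gap by (simp add: \<tau>_def)
  have "2 * \<tau> \<le> n + S + 1 - \<alpha> / 2" using s(2) m(3) \<sigma>'(2) by (simp add: \<tau>_def)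
  then have \<tau>2: "2 * \<tau> < real DIM('a) - \<alpha>" using nm S(2) assms(2) by simp
  have "decay \<tau>"
    by (rule decay_step[OF ds s(1) _ d\<sigma>' \<sigma>'(1) _ \<tau>2]) (use s(2) m(3) in \<open>auto simp: n_def \<tau>_def\<close>)
  then have "\<tau> \<in> A" using \<tau>2 \<tau>S S(1) by (simp add: A_def)
  then have "\<tau> \<le> S" unfolding S_def by (rule cSup_upper[OF _ bdd])
  with \<tau>S show False by simp
qed

text \<open>Duality: by symmetry, \<open>\<parallel>T t v\<parallel>\<^sup>2 = \<langle>v, T (2 * t) v\<rangle>\<close>, which pairs a growing weight on
  \<open>v\<close> with a decaying weight on the solution.\<close>

lemma weighted_decay:
  assumes \<sigma>: "\<sigma> \<ge> 0" "2 * \<sigma> < real DIM('a) - \<alpha>"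
  obtains C where "C > 0" "\<And>v t. (\<lambda>x. bracket_sq x powr (\<sigma> / 2) * v x) \<in> L2 \<mu> \<Longrightarrow> v \<in> L2 \<mu> \<Longrightarrow> t \<ge> 0 \<Longrightarrow>
     L2_norm \<mu> (T t v) \<le> C * (1 + t) powr (- \<sigma> / (2 - \<alpha>)) * L2_norm \<mu> (\<lambda>x. bracket_sq x powr (\<sigma> / 2) * v x)"
proof -
  define p where "p = \<sigma> / (2 - \<alpha>)"
  have p: "p \<ge> 0" "- \<sigma> / (2 - \<alpha>) = - p" using \<sigma>(1) \<alpha>_less_2 by (auto simp: p_def)
  obtain C where C: "C \<ge> 0" "\<And>f t. f \<in> L2 \<mu> \<Longrightarrow> t > 0 \<Longrightarrow> wnorm \<sigma> (T t f) \<le> C * t powr (- p) * L2_norm \<mu> f"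
    using decay_subcritical[OF \<sigma>] unfolding decay_def p by blast
  \<comment> \<open>For t <= 1 contraction suffices, because 2^p (1 + t)^(-p) >= 1; for larger t one
    has t >= (1 + t)/2, which costs 2^p as well. \<open>max 1 C\<close> serves both cases.\<close>
  define C' where "C' = max 1 C * 2 powr p"
  have "C' > 0" unfolding C'_def by simp
  moreover have "L2_norm \<mu> (T t v) \<le> C' * (1 + t) powr (- p) * L2_norm \<mu> (\<lambda>x. bracket_sq x powr (\<sigma> / 2) * v x)"
    if V: "(\<lambda>x. bracket_sq x powr (\<sigma> / 2) * v x) \<in> L2 \<mu>" and v: "v \<in> L2 \<mu>" and t: "t \<ge> 0" for v t
  proof -
    let ?V = "\<lambda>x. bracket_sq x powr (\<sigma> / 2) * v x" let ?N = "L2_norm \<mu> ?V" let ?n = "L2_norm \<mu> (T t v)"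
    have two: "1 \<le> 2 powr p * (1 + t) powr (- p)" if "t \<le> 1"
    proof -
      have "2 powr (- p) \<le> (1 + t) powr (- p)" using that p(1) t by (intro powr_mono2') auto
      then have "2 powr p * 2 powr (- p) \<le> 2 powr p * (1 + t) powr (- p)" by (intro mult_left_mono) auto
      then show ?thesis by (simp add: powr_minus)
    qed
    show ?thesis
    proof (cases "t \<le> 1")
      case True
      have "wnorm \<sigma> ?V = L2_norm \<mu> v"
      proof -
        have "bracket_sq x powr (- \<sigma> / 2) * (bracket_sq x powr (\<sigma> / 2) * v x) = v x" for x
          using bracket_powr_add[of "- \<sigma> / 2" "\<sigma> / 2" 0 x] bracket_sq_pos[of x] by (simp flip: mult.assoc)
        then show ?thesis by (simp only: wnorm_def)
      qed
      then have "?n \<le> 1 * ?N"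
        using contraction[OF t v] wnorm_le_norm[OF V \<sigma>(1)] by simp
      also have "\<dots> \<le> (max 1 C * (2 powr p * (1 + t) powr (- p))) * ?N"
        using mult_mono[of 1 "max 1 C" 1 "2 powr p * (1 + t) powr (- p)"] two[OF True]
        by (intro mult_right_mono) auto
      finally show ?thesis by (simp add: C'_def mult_ac)
    next
      case False
      then have t0: "t > 0" "t \<ge> 1" by auto
      have u: "T t v \<in> L2 \<mu>" using T_L2 v t by simp
      have w: "T t (T t v) \<in> L2 \<mu>" "T (2 * t) v \<in> L2 \<mu>" using T_L2 u v t by auto
      have "?n\<^sup>2 = L2_inner \<mu> v (T (2 * t) v)" by (rule T_symmetric_square[OF t0(1) v])
      also have "\<dots> = L2_inner \<mu> (T t (T t v)) v"
      proof -
        have "AE x in \<mu>. T (2 * t) v x = T t (T t v) x" using T_add[OF t t v] by simp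
        from L2_inner_cong_AE[OF L2_measurable[OF w(2)] L2_measurable[OF w(1)] this L2_measurable[OF v]]
        show ?thesis by (simp add: L2_inner_commute[of _ v])
      qed
      also have "\<dots> = L2_inner \<mu> (\<lambda>x. bracket_sq x powr (- \<sigma> / 2) * T t (T t v) x) ?V"
        unfolding L2_inner_def
      proof (rule Bochner_Integration.integral_cong[OF refl])
        fix x :: 'a
        have "bracket_sq x powr (- \<sigma> / 2) * bracket_sq x powr (\<sigma> / 2) = 1"
          using bracket_powr_add[of "- \<sigma> / 2" "\<sigma> / 2" 0 x] bracket_sq_pos[of x] by simp
        then have "(bracket_sq x powr (- \<sigma> / 2) * bracket_sq x powr (\<sigma> / 2)) * (T t (T t v) x * v x) = T t (T t v) x * v x" by simp
        then show "T t (T t v) x * v x = bracket_sq x powr (- \<sigma> / 2) * T t (T t v) x * (bracket_sq x powr (\<sigma> / 2) * v x)"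
          by (simp add: mult_ac)
      qed
      also have "\<dots> \<le> wnorm \<sigma> (T t (T t v)) * ?N"
        using L2_Cauchy_Schwarz[OF wnorm_L2[OF w(1) \<sigma>(1)] V] by (simp add: wnorm_def)
      \<comment> \<open>The decay bound is applied with \<open>T t v\<close> as initial datum, so
        that its norm can be cancelled from both sides.\<close>
      also have "\<dots> \<le> (C * t powr (- p) * ?n) * ?N" by (intro mult_right_mono C(2) u t0) simp
      finally have "?n * ?n \<le> (C * t powr (- p) * ?N) * ?n" by (simp add: power2_eq_square mult_ac)
      then have "?n \<le> C * t powr (- p) * ?N"
        using C(1) by (cases "?n = 0") (simp_all add: mult_le_cancel_right less_le)
      also have "\<dots> \<le> (max 1 C * (2 powr p * (1 + t) powr (- p))) * ?N"
      proof (intro mult_right_mono mult_mono)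
        have "t powr (- p) \<le> ((1 + t) / 2) powr (- p)" using t0 p(1) by (intro powr_mono2') auto
        also have "\<dots> = (1 + t) powr (- p) / 2 powr (- p)" by (rule powr_divide)
        also have "2 powr (- p) = inverse (2 powr p)" by (rule powr_minus)
        finally show "t powr (- p) \<le> 2 powr p * (1 + t) powr (- p)" by (simp only: divide_inverse inverse_inverse_eq mult.commute)
      qed auto
      finally show ?thesis by (simp add: C'_def mult_ac)
    qed
  qed
  ultimately show ?thesis using that unfolding p by blast
qed

end

section \<open>From the limit condition on D to bounds on the weight\<close>

lemma japanese_bracket_powr: "japanese_bracket x powr e = bracket_sq x powr (e / 2)"
  using bracket_sq_pos[of x] by (simp add: japanese_bracket_def bracket_sq_def powr_half_sqrt[symmetric] powr_powr)

text \<open>F = <x>^(-\<alpha>) D is continuous and positive and has the positive limit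
  \<open>D\<^sub>0\<close> at infinity: the limit bounds it outside a ball, compactness inside.
  Passing from |x| to <x> costs the factor (1 + |x|^(-2))^(-\<alpha>/2), which tends to 1.\<close>

lemma weight_two_sided_bound:
  fixes D :: "'a::euclidean_space \<Rightarrow> real"
  assumes cont: "continuous_on UNIV D" and pos: "\<And>x. D x > 0" and "D\<^sub>0 > 0"
    and lim: "((\<lambda>x. norm x powr (- \<alpha>) * D x) \<longlongrightarrow> D\<^sub>0) at_infinity"
  obtains c\<^sub>1 c\<^sub>2 where "c\<^sub>1 > 0" "c\<^sub>2 > 0"
    "\<And>x. c\<^sub>1 * bracket_sq x powr (- \<alpha> / 2) \<le> inverse (D x)"
    "\<And>x. inverse (D x) \<le> c\<^sub>2 * bracket_sq x powr (- \<alpha> / 2)"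
proof -
  define F where "F = (\<lambda>x. bracket_sq x powr (- \<alpha> / 2) * D x)"
  have Fpos: "F x > 0" for x using pos[of x] bracket_sq_pos[of x] by (simp add: F_def)
  have Fc: "continuous_on S F" for S
    unfolding F_def using cont
    by (intro continuous_on_mult smooth_continuous[OF smooth_bracket_powr] continuous_on_subset[OF cont]) auto
  have "((\<lambda>x::'a. inverse (norm x)) \<longlongrightarrow> 0) at_infinity"
    by (rule tendsto_inverse_0_at_top[OF filterlim_norm_at_top])
  then have "((\<lambda>x::'a. (1 + (inverse (norm x))\<^sup>2) powr (- \<alpha> / 2)) \<longlongrightarrow> (1 + 0\<^sup>2) powr (- \<alpha> / 2)) at_infinity"
    by (intro tendsto_intros) auto
  from tendsto_mult[OF lim this]
  have "((\<lambda>x. norm x powr (- \<alpha>) * D x * (1 + (inverse (norm x))\<^sup>2) powr (- \<alpha> / 2)) \<longlongrightarrow> D\<^sub>0) at_infinity" by simp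
  moreover have "\<forall>\<^sub>F x in at_infinity. norm x powr (- \<alpha>) * D x * (1 + (inverse (norm x))\<^sup>2) powr (- \<alpha> / 2) = F x"
    unfolding eventually_at_infinity
  proof (intro exI[of _ 1] allI impI)
    fix x :: 'a assume "1 \<le> norm x"
    then have n: "norm x > 0" by linarith
    have "norm x powr (- \<alpha>) = ((norm x)\<^sup>2) powr (- \<alpha> / 2)"
      using n by (simp add: powr_powr flip: powr_numeral)
    moreover have "bracket_sq x = (norm x)\<^sup>2 * (1 + (inverse (norm x))\<^sup>2)"
      using n by (simp add: bracket_sq_def field_simps)
    moreover have "((norm x)\<^sup>2 * (1 + (inverse (norm x))\<^sup>2)) powr (- \<alpha> / 2) =
        ((norm x)\<^sup>2) powr (- \<alpha> / 2) * (1 + (inverse (norm x))\<^sup>2) powr (- \<alpha> / 2)"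
      by (rule powr_mult)
    ultimately show "norm x powr (- \<alpha>) * D x * (1 + (inverse (norm x))\<^sup>2) powr (- \<alpha> / 2) = F x"
      unfolding F_def by (simp only: mult_ac)
  qed
  ultimately have Flim: "(F \<longlongrightarrow> D\<^sub>0) at_infinity" by (rule Lim_transform_eventually)
  have "\<forall>\<^sub>F x in at_infinity. D\<^sub>0 / 2 < F x \<and> F x < 2 * D\<^sub>0"
    using order_tendstoD[OF Flim, of "D\<^sub>0 / 2"] order_tendstoD[OF Flim, of "2 * D\<^sub>0"] \<open>D\<^sub>0 > 0\<close> by (simp add: eventually_conj_iff)
  then obtain b where b: "\<And>x. b \<le> norm x \<Longrightarrow> D\<^sub>0 / 2 < F x \<and> F x < 2 * D\<^sub>0"
    unfolding eventually_at_infinity by blast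
  \<comment> \<open>\<open>max b 0\<close> keeps the ball nonempty if b is negative.\<close>
  let ?B = "cball (0::'a) (max b 0)"
  have B: "compact ?B" "?B \<noteq> {}" by auto
  obtain y where y: "\<And>x. x \<in> ?B \<Longrightarrow> F y \<le> F x" using continuous_attains_inf[OF B Fc] by blast
  obtain z where z: "\<And>x. x \<in> ?B \<Longrightarrow> F x \<le> F z" using continuous_attains_sup[OF B Fc] by blast
  define lo where "lo = min (F y) (D\<^sub>0 / 2)"
  define hi where "hi = max (F z) (2 * D\<^sub>0)"
  have lo: "lo > 0" and hi: "hi > 0" using Fpos \<open>D\<^sub>0 > 0\<close> by (auto simp: lo_def hi_def less_max_iff_disj)
  have F: "lo \<le> F x" "F x \<le> hi" for x
  proof -
    have "lo \<le> F x \<and> F x \<le> hi"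
      using y[of x] z[of x] b[of x] by (cases "x \<in> ?B") (auto simp: lo_def hi_def min_le_iff_disj le_max_iff_disj less_imp_le)
    then show "lo \<le> F x" "F x \<le> hi" by auto
  qed
  show ?thesis
  proof (rule that)
    show "1 / hi > 0" "1 / lo > 0" using lo hi by auto
    show "1 / hi * bracket_sq x powr (- \<alpha> / 2) \<le> inverse (D x)" for x
      using F(2)[of x] hi pos[of x] unfolding F_def by (simp add: field_simps)
    show "inverse (D x) \<le> 1 / lo * bracket_sq x powr (- \<alpha> / 2)" for x
      using F(1)[of x] lo pos[of x] unfolding F_def by (simp add: field_simps)
  qed
qed

section \<open>Comparison of the weighted space with the norms of the statement\<close>

context decay_setting
begin

lemma bracket_weight_measurable:
  "(\<lambda>x. bracket_sq x powr p) \<in> borel_measurable (lebesgue_on \<Omega>)"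
  by (rule measurable_restrict_space1[OF bracket_powr_measurable])

lemma L2_norm_extend: "L2_norm (lebesgue_on \<Omega>) (\<lambda>x. bracket_sq x powr (- \<alpha> / 4) * f x) = L2_norm lebesgue (zext 0 f)"
proof -
  have "(\<integral>x. (norm (bracket_sq x powr (- \<alpha> / 4) * f x))\<^sup>2 \<partial>lebesgue_on \<Omega>) = (\<integral>x. (norm (zext 0 f x))\<^sup>2 \<partial>lebesgue)"
    unfolding integral_lebesgue_on_eq[OF domain_lebesgue]
    by (rule Bochner_Integration.integral_cong[OF refl]) (auto simp: zext_def indicator_def)
  then show ?thesis by (simp only: L2_norm_def)
qed

text \<open>Measurability of f itself is recovered by multiplying with the inverse weight.\<close>

lemma L2_extend_iff:
  "(\<lambda>x. bracket_sq x powr (- \<alpha> / 4) * f x) \<in> L2 (lebesgue_on \<Omega>) \<longleftrightarrow> f \<in> borel_measurable (lebesgue_on \<Omega>) \<and> integrable lebesgue (\<lambda>x. (zext 0 f x)\<^sup>2)"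
proof -
  have "f \<in> borel_measurable (lebesgue_on \<Omega>)" if "(\<lambda>x. bracket_sq x powr (- \<alpha> / 4) * f x) \<in> borel_measurable (lebesgue_on \<Omega>)"
  proof -
    have "(\<lambda>x. bracket_sq x powr (\<alpha> / 4) * (bracket_sq x powr (- \<alpha> / 4) * f x)) \<in> borel_measurable (lebesgue_on \<Omega>)"
      by (rule borel_measurable_times[OF bracket_weight_measurable that])
    moreover have "bracket_sq x powr (\<alpha> / 4) * (bracket_sq x powr (- \<alpha> / 4) * f x) = f x" for x
      using bracket_powr_add[of "\<alpha> / 4" "- \<alpha> / 4" 0 x] bracket_sq_pos[of x] by (simp flip: mult.assoc)
    ultimately show ?thesis by (simp only:)
  qed
  moreover have "(\<lambda>x. indicator \<Omega> x * (bracket_sq x powr (- \<alpha> / 4) * f x)\<^sup>2) = (\<lambda>x. (zext 0 f x)\<^sup>2)"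
    by (auto simp: zext_def indicator_def fun_eq_iff)
  ultimately show ?thesis
    unfolding L2_real_iff integrable_lebesgue_on_eq[OF domain_lebesgue]
    using borel_measurable_times[OF bracket_weight_measurable] by metis
qed

lemma L2_weighted_to_bracket:
  assumes "f \<in> L2 \<mu>"
  shows "(\<lambda>x. bracket_sq x powr (- \<alpha> / 4) * f x) \<in> L2 (lebesgue_on \<Omega>)"
    and "sqrt c\<^sub>1 * L2_norm (lebesgue_on \<Omega>) (\<lambda>x. bracket_sq x powr (- \<alpha> / 4) * f x) \<le> L2_norm \<mu> f"
proof -
  show "(\<lambda>x. bracket_sq x powr (- \<alpha> / 4) * f x) \<in> L2 (lebesgue_on \<Omega>)"
    unfolding L2_extend_iff using L2_weighted_iff[THEN iffD1, OF assms] zext_L2[OF assms order_refl, unfolded L2_real_iff] by blast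
  have "c\<^sub>1 * (L2_norm lebesgue (zext 0 f))\<^sup>2 \<le> (L2_norm \<mu> f)\<^sup>2"
    using zext_le_wnorm[OF assms order_refl] by (simp add: wnorm_0)
  then have "(sqrt c\<^sub>1 * L2_norm lebesgue (zext 0 f))\<^sup>2 \<le> (L2_norm \<mu> f)\<^sup>2"
    using c\<^sub>1_pos by (simp add: power_mult_distrib)
  then show "sqrt c\<^sub>1 * L2_norm (lebesgue_on \<Omega>) (\<lambda>x. bracket_sq x powr (- \<alpha> / 4) * f x) \<le> L2_norm \<mu> f"
    unfolding L2_norm_extend by (rule power2_le_imp_le) simp
qed

lemma L2_bracket_to_weighted:
  assumes "(\<lambda>x. bracket_sq x powr (- \<alpha> / 4) * f x) \<in> L2 (lebesgue_on \<Omega>)"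
  shows "f \<in> L2 \<mu>"
    and "L2_norm \<mu> f \<le> sqrt c\<^sub>2 * L2_norm (lebesgue_on \<Omega>) (\<lambda>x. bracket_sq x powr (- \<alpha> / 4) * f x)"
proof -
  have m: "f \<in> borel_measurable (lebesgue_on \<Omega>)" and i: "integrable lebesgue (\<lambda>x. (zext 0 f x)\<^sup>2)"
    using assms unfolding L2_extend_iff by auto
  have "integrable lebesgue (\<lambda>x. indicator \<Omega> x * (inverse (D x) * (f x)\<^sup>2))"
  proof (rule Bochner_Integration.integrable_bound)
    show "integrable lebesgue (\<lambda>x. c\<^sub>2 * (zext 0 f x)\<^sup>2)" using i by simp
    show "AE x in lebesgue. norm (indicator \<Omega> x * (inverse (D x) * (f x)\<^sup>2)) \<le> norm (c\<^sub>2 * (zext 0 f x)\<^sup>2)"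
    proof (rule AE_I2)
      fix x
      have "inverse (D x) * (f x)\<^sup>2 \<le> c\<^sub>2 * bracket_sq x powr (2 * (- \<alpha> / 4)) * (f x)\<^sup>2"
        using weight_upper[of x] by (intro mult_right_mono) auto
      then show "norm (indicator \<Omega> x * (inverse (D x) * (f x)\<^sup>2)) \<le> norm (c\<^sub>2 * (zext 0 f x)\<^sup>2)"
        using c\<^sub>2_pos pos[of x] by (cases "x \<in> \<Omega>") (simp_all add: zext_def power_mult_distrib bracket_powr_square abs_mult)
    qed
    have "(\<lambda>x. inverse (D x) * (f x)\<^sup>2) \<in> borel_measurable (lebesgue_on \<Omega>)"
      by (intro borel_measurable_times[OF weight_measurable(2)] borel_measurable_power m)
    then show "(\<lambda>x. indicator \<Omega> x * (inverse (D x) * (f x)\<^sup>2)) \<in> borel_measurable lebesgue"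
      by (simp add: measurable_extension)
  qed
  with m show f: "f \<in> L2 \<mu>" by (simp add: L2_weighted_iff)
  have "(L2_norm \<mu> f)\<^sup>2 \<le> c\<^sub>2 * (L2_norm lebesgue (zext 0 f))\<^sup>2"
    using wnorm_le_zext[OF f order_refl] by (simp add: wnorm_0)
  then have "(L2_norm \<mu> f)\<^sup>2 \<le> (sqrt c\<^sub>2 * L2_norm lebesgue (zext 0 f))\<^sup>2"
    using c\<^sub>2_pos by (simp add: power_mult_distrib)
  then show "L2_norm \<mu> f \<le> sqrt c\<^sub>2 * L2_norm (lebesgue_on \<Omega>) (\<lambda>x. bracket_sq x powr (- \<alpha> / 4) * f x)"
    unfolding L2_norm_extend by (rule power2_le_imp_le) (use c\<^sub>2_pos in simp)
qed

end

theorem proposition1p3: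
  fixes \<Omega> :: "'a::euclidean_space set"
    and D :: "'a \<Rightarrow> real"
    and \<alpha> \<sigma> D\<^sub>0 :: real
    and T :: "real \<Rightarrow> ('a \<Rightarrow> real) \<Rightarrow> 'a \<Rightarrow> real"
  assumes "DIM('a) \<ge> 2"
    and "exterior_domain \<Omega>" and "smooth_boundary \<Omega>"
    and "\<alpha> < min 2 (real DIM('a))"
    and "continuous_on UNIV D" and "\<And>x. D x > 0"
    and "D\<^sub>0 > 0" and "((\<lambda>x. norm x powr (- \<alpha>) * D x) \<longlongrightarrow> D\<^sub>0) at_infinity"
    and "0 < \<sigma>" and "\<sigma> < (real DIM('a) - \<alpha>) / 2"
    and "analytic_semigroup (weighted_measure \<Omega> D) T"
    and "generator (weighted_measure \<Omega> D) T = dirichlet_operator \<Omega> D"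
  shows "\<exists>C>0. \<forall>v\<^sub>0.
    (\<lambda>x. japanese_bracket x powr (\<sigma> - \<alpha> / 2) * v\<^sub>0 x) \<in> L2 (lebesgue_on \<Omega>) \<longrightarrow>
    (\<forall>t\<ge>0.
      (\<lambda>x. japanese_bracket x powr (- \<alpha> / 2) * T t v\<^sub>0 x) \<in> L2 (lebesgue_on \<Omega>) \<and>
      L2_norm (lebesgue_on \<Omega>) (\<lambda>x. japanese_bracket x powr (- \<alpha> / 2) * T t v\<^sub>0 x)
        \<le> C * (1 + t) powr (- \<sigma> / (2 - \<alpha>)) *
          L2_norm (lebesgue_on \<Omega>) (\<lambda>x. japanese_bracket x powr (\<sigma> - \<alpha> / 2) * v\<^sub>0 x))"
proof -
  obtain c\<^sub>1 c\<^sub>2 where c: "c\<^sub>1 > 0" "c\<^sub>2 > 0"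
    "\<And>x. c\<^sub>1 * bracket_sq x powr (- \<alpha> / 2) \<le> inverse (D x)"
    "\<And>x. inverse (D x) \<le> c\<^sub>2 * bracket_sq x powr (- \<alpha> / 2)"
    using weight_two_sided_bound[OF assms(5-8)] by metis
  interpret decay_setting \<Omega> D \<alpha> c\<^sub>1 c\<^sub>2 T
    by unfold_locales (use assms c in \<open>auto simp: exterior_domain_def\<close>)
  obtain C where C: "C > 0" "\<And>v t. (\<lambda>x. bracket_sq x powr (\<sigma> / 2) * v x) \<in> L2 \<mu> \<Longrightarrow> v \<in> L2 \<mu> \<Longrightarrow> t \<ge> 0 \<Longrightarrow>
     L2_norm \<mu> (T t v) \<le> C * (1 + t) powr (- \<sigma> / (2 - \<alpha>)) * L2_norm \<mu> (\<lambda>x. bracket_sq x powr (\<sigma> / 2) * v x)"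
    using weighted_decay[of \<sigma>] assms(9,10) by (auto simp: field_simps)
  have left: "(\<lambda>x. japanese_bracket x powr (- \<alpha> / 2) * f x) = (\<lambda>x. bracket_sq x powr (- \<alpha> / 4) * f x)" for f :: "'a \<Rightarrow> real"
    by (simp add: japanese_bracket_powr)
  \<comment> \<open>The exponent \<sigma> - \<alpha>/2 splits into \<sigma>, the weight of the decay
    estimate, and -\<alpha>/2, which accounts for dmu.\<close>
  have right: "(\<lambda>x. japanese_bracket x powr (\<sigma> - \<alpha> / 2) * v x) = (\<lambda>x. bracket_sq x powr (- \<alpha> / 4) * (bracket_sq x powr (\<sigma> / 2) * v x))"
    for v :: "'a \<Rightarrow> real"
  proof
    fix x :: 'a
    have "bracket_sq x powr (- \<alpha> / 4) * bracket_sq x powr (\<sigma> / 2) = bracket_sq x powr ((\<sigma> - \<alpha> / 2) / 2)"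
      by (rule bracket_powr_add) (simp add: field_simps)
    then show "japanese_bracket x powr (\<sigma> - \<alpha> / 2) * v x = bracket_sq x powr (- \<alpha> / 4) * (bracket_sq x powr (\<sigma> / 2) * v x)"
      by (simp only: japanese_bracket_powr mult.assoc[symmetric])
  qed
  show ?thesis
  \<comment> \<open>\<open>sqrt c\<^sub>2\<close> bounds the weighted datum in L2(dmu) by its norm
    in the statement, and \<open>1 / sqrt c\<^sub>1\<close> returns from L2(dmu) for the
    solution.\<close>
  proof (intro exI[of _ "C * sqrt c\<^sub>2 / sqrt c\<^sub>1"] conjI allI impI)
    show "C * sqrt c\<^sub>2 / sqrt c\<^sub>1 > 0" using C(1) c(1,2) by simp
    fix v\<^sub>0 :: "'a \<Rightarrow> real" and t :: real
    assume v: "(\<lambda>x. japanese_bracket x powr (\<sigma> - \<alpha> / 2) * v\<^sub>0 x) \<in> L2 (lebesgue_on \<Omega>)" and t: "0 \<le> t"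
    let ?V = "\<lambda>x. bracket_sq x powr (\<sigma> / 2) * v\<^sub>0 x"
    let ?d = "(1 + t) powr (- \<sigma> / (2 - \<alpha>))"
    have V: "?V \<in> L2 \<mu>" "L2_norm \<mu> ?V \<le> sqrt c\<^sub>2 * L2_norm (lebesgue_on \<Omega>) (\<lambda>x. bracket_sq x powr (- \<alpha> / 4) * ?V x)"
      using L2_bracket_to_weighted[OF v[unfolded right]] by auto
    \<comment> \<open>Undoing the weight only shrinks the function, as <x>^(-\<sigma>) <= 1; so the
      datum lies in L2(dmu), where the semigroup acts.\<close>
    have "bracket_sq x powr (- \<sigma> / 2) * (bracket_sq x powr (\<sigma> / 2) * v\<^sub>0 x) = v\<^sub>0 x" for x
      using bracket_powr_add[of "- \<sigma> / 2" "\<sigma> / 2" 0 x] bracket_sq_pos[of x] by (simp flip: mult.assoc)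
    then have v0: "v\<^sub>0 \<in> L2 \<mu>" using wnorm_L2[OF V(1), of \<sigma>] assms(9) by (simp only: less_imp_le)
    note u = L2_weighted_to_bracket[OF T_L2[OF t v0]]
    show "(\<lambda>x. japanese_bracket x powr (- \<alpha> / 2) * T t v\<^sub>0 x) \<in> L2 (lebesgue_on \<Omega>)"
      unfolding left by (rule u(1))
    have "sqrt c\<^sub>1 * L2_norm (lebesgue_on \<Omega>) (\<lambda>x. bracket_sq x powr (- \<alpha> / 4) * T t v\<^sub>0 x) \<le> L2_norm \<mu> (T t v\<^sub>0)"
      by (rule u(2))
    also have "\<dots> \<le> C * ?d * L2_norm \<mu> ?V" by (rule C(2)[OF V(1) v0 t])
    also have "\<dots> \<le> C * ?d * (sqrt c\<^sub>2 * L2_norm (lebesgue_on \<Omega>) (\<lambda>x. bracket_sq x powr (- \<alpha> / 4) * ?V x))"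
      using C(1) by (intro mult_left_mono V(2)) auto
    finally show "L2_norm (lebesgue_on \<Omega>) (\<lambda>x. japanese_bracket x powr (- \<alpha> / 2) * T t v\<^sub>0 x)
        \<le> C * sqrt c\<^sub>2 / sqrt c\<^sub>1 * ?d * L2_norm (lebesgue_on \<Omega>) (\<lambda>x. japanese_bracket x powr (\<sigma> - \<alpha> / 2) * v\<^sub>0 x)"
      unfolding left right using c(1) by (simp add: field_simps)
  qed
qed

end
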